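(* Let $A:D(A)\subset H\to H$ be a negative definite self-adjoint operator with $A^{-1}$ of trace class, and let $\theta\in(0,1)$. For $f\in C_b^\theta(H)$, $\lambda>0$ and $z\in H$ let $$u^{(z)}(x)=\int_0^\infty e^{-\lambda t}P_t^{(z)}f(x)\,dt,\qquad x\in H,$$ which belongs to $C^1_b(H)$. The following assertions hold. (i) For any $x\in H$ one has $Du^{(z)}(x)\in D((-A)^{1/2})$, and $(-A)^{1/2}Du^{(z)}\in C_b^\theta(H,H)$. There exist constants $C_\theta(\lambda)>0$ and $M_\theta>0$, independent of $f$ and $z$, with $M_\theta$ also independent of $\lambda$, with $\lambda\mapsto C_\theta(\lambda)$ decreasing on $(0,\infty)$ and $\lim_{\lambda\to\infty}C_\theta(\lambda)=0$, such that $$\sup_{x\in H}\Big[\sum_{k\ge1}\lambda_k\,(D_{e_k}u^{(z)}(x))^2\Big]^{1/2}=\|(-A)^{1/2}Du^{(z)}\|_0\le C_\theta(\lambda)\,\|f\|_{C^\theta},$$ $$[(-A)^{1/2}Du^{(z)}]_{C^\theta}\le M_\theta\,\|f\|_{C^\theta}.$$ (ii) Let $(f_n)\subset C_b^\theta(H)$ be such that $\sup_{n\ge1}\|f_n\|_{C^\theta}\le C<\infty$ and $f_n(x)\to f(x)$ for every $x\in H$, and define $u_n^{(z)}(x)=\int_0^\infty e^{-\lambda t}P_t^{(z)}f_n(x)\,dt$. Then, for all $h,x,z\in H$, $$\langle(-A)^{1/2}Du_n^{(z)}(x),h\rangle\to\langle(-A)^{1/2}Du^{(z)}(x),h\rangle\quad\text{as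 }n\to\infty.$$
   Context: $H$ is a real separable (infinite-dimensional) Hilbert space with norm $|\cdot|_H$ and inner product $\langle\cdot,\cdot\rangle$. Negative definite means $\langle Ax,x\rangle\le-\omega|x|_H^2$ on $D(A)$ for some $\omega>0$. There are an orthonormal basis $(e_k)_{k\ge1}$ of $H$ and positive $\lambda_k$ with $Ae_k=-\lambda_ke_k$, $\sum_k\lambda_k^{-1}<\infty$; $(e^{tA})$ is the semigroup generated by $A$. For a separable Banach space $E$ and $f:H\to E$: $\|f\|_0=\sup_{x\in H}|f(x)|_E$, $[f]_{C^\theta}=\sup_{x\ne x'}|f(x)-f(x')|_E\,|x-x'|_H^{-\theta}$, $\|f\|_{C^\theta}=\|f\|_0+[f]_{C^\theta}$; $C_b^\theta(H,E)$ is the space of bounded $\theta$-Hölder continuous functions with this norm, $C_b^\theta(H)=C_b^\theta(H,\mathbb R)$. $C^1_b(H)$ is the space of bounded, Fréchet differentiable functions $H\to\mathbb R$ with bounded continuous derivative $Du:H\to H$; $D_hu(x)=\langle Du(x),h\rangle$. For $z\in H$, $(P_t^{(z)})_{t\ge0}$ is the generalized Ornstein–Uhlenbeck semigroup $$P_t^{(z)}f(x)=\int_Hf(e^{tA}x+y+\Gamma_tz)\,N(0,Q_t)(dy),\quad x\in H,$$ for bounded Borel $f:H\to\mathbb R$, where $N(0,Q_t)$ is the centered Gaussian measure on $H$ with covariance $Q_t=\int_0^te^{2sA}ds=(-2A)^{-1}(I-e^{2tA})$ and $\Gamma_tz=(-A)^{-1/2}(z-e^{tA}z)=\sum_k\frac{1-e^{-t\lambda_k}}{\lambda_k^{1/2}}\langle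 z,e_k\rangle e_k$. *)

theory Defs
  imports "HOL-Probability.Probability"
begin

text \<open>
  An unbounded operator is a pair of a domain \<open>D\<close> and a total function that is only
  meaningful on \<open>D\<close>. The Hilbert space is a type of sort
  \<open>{real_inner, banach, second_countable_topology}\<close>; it is infinite-dimensional as soon as
  it carries an orthonormal sequence.
\<close>

definition linear_op :: "'a::real_inner set \<Rightarrow> ('a \<Rightarrow> 'a) \<Rightarrow> bool" where
  "linear_op D A \<longleftrightarrow> subspace D \<and>
     (\<forall>x\<in>D. \<forall>y\<in>D. A (x + y) = A x + A y) \<and> (\<forall>c. \<forall>x\<in>D. A (c *\<^sub>R x) = c *\<^sub>R A x)"

text \<open>The last conjunct states that the graph of the operator is the graph of its adjoint.\<close>

definition self_adjoint_op :: "'a::real_inner set \<Rightarrow> ('a \<Rightarrow> 'a) \<Rightarrow> bool" where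
  "self_adjoint_op D A \<longleftrightarrow> linear_op D A \<and> closure D = UNIV \<and>
     (\<forall>y z. (y \<in> D \<and> A y = z) \<longleftrightarrow> (\<forall>x\<in>D. A x \<bullet> y = x \<bullet> z))"

definition negative_definite_op :: "'a::real_inner set \<Rightarrow> ('a \<Rightarrow> 'a) \<Rightarrow> bool" where
  "negative_definite_op D A \<longleftrightarrow> (\<exists>\<omega>>0. \<forall>x\<in>D. A x \<bullet> x \<le> - \<omega> * (norm x)\<^sup>2)"

text \<open>Trace class (nuclear) operators, as in Da Prato and Zabczyk: those with an absolutely
  convergent expansion into operators of rank one.\<close>

definition trace_class :: "('a::real_inner \<Rightarrow> 'a) \<Rightarrow> bool" where
  "trace_class T \<longleftrightarrow> bounded_linear T \<and>
     (\<exists>a b :: nat \<Rightarrow> 'a. summable (\<lambda>k. norm (a k) * norm (b k)) \<and>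
        (\<forall>x. (\<lambda>k. (x \<bullet> a k) *\<^sub>R b k) sums T x))"

definition trace_class_inverse :: "'a::real_inner set \<Rightarrow> ('a \<Rightarrow> 'a) \<Rightarrow> bool" where
  "trace_class_inverse D A \<longleftrightarrow> bij_betw A D UNIV \<and> trace_class (inv_into D A)"

text \<open>An orthonormal basis of eigenvectors, with index set \<open>{0, 1, \<dots>}\<close>.\<close>

definition eigenbasis ::
  "'a::real_inner set \<Rightarrow> ('a \<Rightarrow> 'a) \<Rightarrow> (nat \<Rightarrow> 'a) \<Rightarrow> (nat \<Rightarrow> real) \<Rightarrow> bool" where
  "eigenbasis D A e l \<longleftrightarrow>
     (\<forall>i j. e i \<bullet> e j = (if i = j then 1 else 0)) \<and> closure (span (range e)) = UNIV \<and>
     (\<forall>k. l k > 0 \<and> e k \<in> D \<and> A (e k) = - (l k *\<^sub>R e k)) \<and> summable (\<lambda>k. inverse (l k))"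

text \<open>\<open>(D', R)\<close> is the nonnegative self-adjoint square root of \<open>(D, B)\<close>; \<open>R \<circ> R = B\<close> includes
  equality of the domains.\<close>

definition is_sqrt_op ::
  "'a::real_inner set \<Rightarrow> ('a \<Rightarrow> 'a) \<Rightarrow> 'a set \<Rightarrow> ('a \<Rightarrow> 'a) \<Rightarrow> bool" where
  "is_sqrt_op D B D' R \<longleftrightarrow> self_adjoint_op D' R \<and> (\<forall>x\<in>D'. 0 \<le> R x \<bullet> x) \<and>
     D = {x \<in> D'. R x \<in> D'} \<and> (\<forall>x\<in>D. R (R x) = B x)"

definition C0_semigroup :: "(real \<Rightarrow> 'a::real_inner \<Rightarrow> 'a) \<Rightarrow> bool" where
  "C0_semigroup S \<longleftrightarrow> (\<forall>t\<ge>0. bounded_linear (S t)) \<and> (\<forall>x. S 0 x = x) \<and>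
     (\<forall>s\<ge>0. \<forall>t\<ge>0. \<forall>x. S (s + t) x = S s (S t x)) \<and>
     (\<forall>x. ((\<lambda>t. S t x) \<longlongrightarrow> x) (at_right 0))"

definition generated_semigroup ::
  "'a::real_inner set \<Rightarrow> ('a \<Rightarrow> 'a) \<Rightarrow> (real \<Rightarrow> 'a \<Rightarrow> 'a) \<Rightarrow> bool" where
  "generated_semigroup D A S \<longleftrightarrow> C0_semigroup S \<and>
     (\<forall>x y. (x \<in> D \<and> A x = y) \<longleftrightarrow> ((\<lambda>t. (S t x - x) /\<^sub>R t) \<longlongrightarrow> y) (at_right 0))"

definition cov_op :: "(real \<Rightarrow> 'a::{real_inner,banach} \<Rightarrow> 'a) \<Rightarrow> real \<Rightarrow> 'a \<Rightarrow> 'a" where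
  "cov_op S t x = integral {0..t} (\<lambda>s. S (2 * s) x)"

definition centered_gaussian :: "'a::real_inner measure \<Rightarrow> ('a \<Rightarrow> 'a) \<Rightarrow> bool" where
  "centered_gaussian M Q \<longleftrightarrow> prob_space M \<and> sets M = sets borel \<and>
     (\<forall>h. (CLINT y|M. iexp (h \<bullet> y)) = complex_of_real (exp (- (Q h \<bullet> h) / 2)))"

text \<open>In the following, \<open>(D', R)\<close> stands for the square root of \<open>- A\<close>.\<close>

definition shift_op ::
  "(real \<Rightarrow> 'a::real_inner \<Rightarrow> 'a) \<Rightarrow> 'a set \<Rightarrow> ('a \<Rightarrow> 'a) \<Rightarrow> real \<Rightarrow> 'a \<Rightarrow> 'a" where
  "shift_op S D' R t z = inv_into D' R (z - S t z)"

definition gen_OU ::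
  "(real \<Rightarrow> 'a::real_inner \<Rightarrow> 'a) \<Rightarrow> 'a set \<Rightarrow> ('a \<Rightarrow> 'a) \<Rightarrow> (real \<Rightarrow> 'a measure) \<Rightarrow>
   'a \<Rightarrow> real \<Rightarrow> ('a \<Rightarrow> real) \<Rightarrow> 'a \<Rightarrow> real" where
  "gen_OU S D' R N z t f x = (LINT y|N t. f (S t x + y + shift_op S D' R t z))"

definition resolvent_OU ::
  "(real \<Rightarrow> 'a::real_inner \<Rightarrow> 'a) \<Rightarrow> 'a set \<Rightarrow> ('a \<Rightarrow> 'a) \<Rightarrow> (real \<Rightarrow> 'a measure) \<Rightarrow>
   real \<Rightarrow> 'a \<Rightarrow> ('a \<Rightarrow> real) \<Rightarrow> 'a \<Rightarrow> real" where
  "resolvent_OU S D' R N \<mu> z f x =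
     (LINT t:{0..}|lborel. exp (- \<mu> * t) * gen_OU S D' R N z t f x)"

definition sup_norm :: "('a \<Rightarrow> 'b::real_normed_vector) \<Rightarrow> real" where
  "sup_norm f = (SUP x. norm (f x))"

definition holder_quotients ::
  "real \<Rightarrow> ('a::real_normed_vector \<Rightarrow> 'b::real_normed_vector) \<Rightarrow> real set" where
  "holder_quotients \<theta> f = {norm (f x - f y) * norm (x - y) powr (- \<theta>) | x y. x \<noteq> y}"

definition holder_seminorm ::
  "real \<Rightarrow> ('a::real_normed_vector \<Rightarrow> 'b::real_normed_vector) \<Rightarrow> real" where
  "holder_seminorm \<theta> f = Sup (holder_quotients \<theta> f)"

definition holder_norm ::
  "real \<Rightarrow> ('a::real_normed_vector \<Rightarrow> 'b::real_normed_vector) \<Rightarrow> real" where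
  "holder_norm \<theta> f = sup_norm f + holder_seminorm \<theta> f"

definition Cb_holder ::
  "real \<Rightarrow> ('a::real_normed_vector \<Rightarrow> 'b::real_normed_vector) set" where
  "Cb_holder \<theta> = {f. bounded (range f) \<and> bdd_above (holder_quotients \<theta> f)}"

definition grad :: "('a::real_inner \<Rightarrow> real) \<Rightarrow> 'a \<Rightarrow> 'a" where
  "grad u x = (THE g. GDERIV u x :> g)"

definition C1_b :: "('a::real_inner \<Rightarrow> real) set" where
  "C1_b = {u. bounded (range u) \<and> (\<forall>x. GDERIV u x :> grad u x) \<and>
     bounded (range (grad u)) \<and> continuous_on UNIV (grad u)}"

end

theory Submission
  imports Defs "HOL-Probability.Probability"
begin

text \<open>
  In the eigenbasis every operator of the statement is diagonal: \<open>e\<^sup>t\<^sup>A\<close> has the multipliers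
  \<open>exp (- t * l k)\<close>, the covariance \<open>Q\<^sub>t\<close> has the multipliers \<open>(1 - exp (- 2 * t * l k)) / (2 * l k)\<close> and
  \<open>(-A)\<^bsup>-1/2\<^esup>\<close> has the multipliers \<open>1 / sqrt (l k)\<close>. The rates in \<open>t\<close> come from elementary
  inequalities for such multipliers, uniform in \<open>l k > 0\<close>; the summability of \<open>1 / l k\<close> makes the
  trace of \<open>Q\<^sub>t\<close> tend to \<open>0\<close> with \<open>t\<close>, whence \<open>P\<^sub>t f(x)\<close> is a right-continuous function of \<open>t\<close>.

  Smoothing is a one-dimensional effect. Fix \<open>t > 0\<close> and \<open>w\<close>, let \<open>Y\<close> have the law \<open>N(0, Q\<^sub>t)\<close> and put
  \<open>c\<^sup>2 = \<langle>Q\<^sub>t w, w\<rangle>\<close>. Gaussian regression (lemma \<open>regression\<close>) splits \<open>Y\<close> into a part independent of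
  \<open>\<langle>w, Y\<rangle>\<close> and \<open>(r / c) Q\<^sub>t w\<close> with \<open>r\<close> standard normal. Translating \<open>Y\<close> along \<open>Q\<^sub>t w\<close> is the same as
  translating \<open>r\<close>, so \<open>E F(Y + \<tau> Q\<^sub>t w)\<close> is differentiable in \<open>\<tau>\<close> with derivative \<open>E \<langle>w, Y\<rangle> F(Y)\<close> for
  every bounded Borel function \<open>F\<close> (\<open>mean_has_derivative\<close>). If \<open>F\<close> is \<open>\<theta>\<close>-Hoelder with constant \<open>K\<close>, one may subtract
  from \<open>F(Y)\<close> its value at \<open>r = 0\<close>, which gives the dimension-free bound \<open>2 K c\<^bsup>1-\<theta>\<^esup> |Q\<^sub>t w|\<^bsup>\<theta>\<^esup>\<close> for the
  derivative (\<open>weighted_mean_holder\<close>); no interpolation theory is involved. Since the splitting is an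
  identity between laws that are known through their characteristic functionals only, it rests on the
  theorem that such functionals determine a law on \<open>H\<close> (\<open>characteristic_functional_unique\<close>).

  For \<open>w = Q\<^sub>t\<^bsup>-1\<^esup> e\<^sup>t\<^sup>A (-A)\<^bsup>1/2\<^esup> k\<close> one has \<open>c \<le> |k| / t\<close> and \<open>|Q\<^sub>t w| \<le> t\<^bsup>-1/2\<^esup> |k|\<close>, hence
  \<open>|\<langle>(-A)\<^bsup>1/2\<^esup> D P\<^sub>t f, k\<rangle>| \<le> 2 K t\<^bsup>\<theta>/2-1\<^esup> |k|\<close>, which is integrable at \<open>t = 0\<close>. The identity
  \<open>P\<^sub>t = P\<^sub>t\<^sub>/\<^sub>2 P\<^sub>t\<^sub>/\<^sub>2\<close> together with a Lipschitz bound for \<open>P\<^sub>t\<^sub>/\<^sub>2 f\<close> shows that this derivative is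
  Lipschitz in \<open>x\<close> with constant of order \<open>t\<^bsup>\<theta>/2-3/2\<^esup>\<close>. The first bound, integrated against
  \<open>exp (- \<mu> * t)\<close>, gives a multiple of \<open>\<mu>\<^bsup>-\<theta>/2\<^esup>\<close>, the function \<open>C\<close> of the statement. Using the first bound
  for \<open>t \<le> |x - x'|\<^sup>2\<close> and the second for larger \<open>t\<close> gives the Hoelder estimate with exponent exactly
  \<open>\<theta>\<close> and a constant that does not depend on \<open>\<mu>\<close> (\<open>two_scale_bound\<close>).

  The vector \<open>V(x)\<close> that represents the integrated functional is \<open>(-A)\<^bsup>1/2\<^esup> D u(x)\<close>: the same two-scale
  estimate bounds \<open>u(x + h) - u(x) - \<langle>V(x), (-A)\<^bsup>-1/2\<^esup> h\<rangle>\<close> by a multiple of \<open>|h|\<^bsup>1+\<theta>\<^esup>\<close>, so \<open>u\<close> is Frechet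
  differentiable with gradient \<open>(-A)\<^bsup>-1/2\<^esup> V(x)\<close>. Part (ii) is dominated convergence, first under the
  Gaussian law and then in \<open>t\<close>.
\<close>

section \<open>Diagonal operators in an orthonormal basis\<close>

text \<open>Density of the span is the form of completeness that the eigenbasis provides; Parseval's identity and
the Riesz representation are derived from it.\<close>

locale orthonormal_basis =
  fixes e :: "nat \<Rightarrow> 'a::{real_inner,banach,second_countable_topology}"
  assumes inner_basis: "e i \<bullet> e j = (if i = j then 1 else 0)"
    and span_dense: "closure (span (range e)) = UNIV"
begin

lemma norm_basis [simp]: "norm (e k) = 1"
  by (simp add: norm_eq_sqrt_inner inner_basis)

lemma inner_basis_sum:
  assumes "finite A"
  shows "(\<Sum>k\<in>A. c k *\<^sub>R e k) \<bullet> e j = (if j \<in> A then c j else 0)"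
proof -
  have "(\<Sum>k\<in>A. c k *\<^sub>R e k) \<bullet> e j = (\<Sum>k\<in>A. if k = j then c k else 0)"
    unfolding inner_sum_left by (intro sum.cong refl) (simp add: inner_basis)
  then show ?thesis using assms by simp
qed

lemma norm_basis_sum:
  assumes "finite A"
  shows "(norm (\<Sum>k\<in>A. c k *\<^sub>R e k))\<^sup>2 = (\<Sum>k\<in>A. (c k)\<^sup>2)"
proof -
  have "(norm (\<Sum>k\<in>A. c k *\<^sub>R e k))\<^sup>2 = (\<Sum>j\<in>A. c j * ((\<Sum>k\<in>A. c k *\<^sub>R e k) \<bullet> e j))"
    by (simp only: power2_norm_eq_inner inner_sum_right inner_scaleR_right)
  also have "\<dots> = (\<Sum>j\<in>A. (c j)\<^sup>2)"
    by (intro sum.cong refl) (simp only: inner_basis_sum[OF assms] if_True power2_eq_square)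
  finally show ?thesis .
qed

text \<open>The Riesz--Fischer theorem: partial sums have the norms of the partial sums of the squares, so the
series is Cauchy.\<close>

lemma basis_series_summable:
  assumes "summable (\<lambda>k. (c k)\<^sup>2)"
  shows "summable (\<lambda>k. c k *\<^sub>R e k)"
  unfolding summable_Cauchy
proof (intro allI impI)
  fix \<epsilon> :: real assume \<epsilon>: "\<epsilon> > 0"
  obtain M where M: "\<And>m n. m \<ge> M \<Longrightarrow> norm (\<Sum>k\<in>{m..<n}. (c k)\<^sup>2) < \<epsilon>\<^sup>2"
    using assms[unfolded summable_Cauchy, rule_format, of "\<epsilon>\<^sup>2"] \<epsilon> by auto
  show "\<exists>M. \<forall>m\<ge>M. \<forall>n. norm (\<Sum>k\<in>{m..<n}. c k *\<^sub>R e k) < \<epsilon>"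
  proof (intro exI allI impI)
    fix m n assume "m \<ge> M"
    then have "(norm (\<Sum>k\<in>{m..<n}. c k *\<^sub>R e k))\<^sup>2 < \<epsilon>\<^sup>2"
      using M[of m n] by (simp add: norm_basis_sum)
    then show "norm (\<Sum>k\<in>{m..<n}. c k *\<^sub>R e k) < \<epsilon>"
      by (rule power2_less_imp_less) (use \<epsilon> in simp)
  qed
qed

lemma inner_basis_suminf:
  assumes "summable (\<lambda>k. (c k)\<^sup>2)"
  shows "(\<Sum>k. c k *\<^sub>R e k) \<bullet> e j = c j"
proof -
  have "(\<lambda>k. (c k *\<^sub>R e k) \<bullet> e j) sums ((\<Sum>k. c k *\<^sub>R e k) \<bullet> e j)"
    by (intro bounded_linear.sums[OF bounded_linear_inner_left] summable_sums basis_series_summable assms)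
  moreover have "(\<lambda>k. (c k *\<^sub>R e k) \<bullet> e j) = (\<lambda>k. if k = j then c k else 0)"
    by (auto simp: inner_basis)
  ultimately have "(\<lambda>k. if k = j then c k else 0) sums ((\<Sum>k. c k *\<^sub>R e k) \<bullet> e j)" by simp
  then show ?thesis
    using sums_unique2[OF _ sums_single[of j c]] by simp
qed

lemma coord_zero_imp_zero:
  assumes "\<And>k. x \<bullet> e k = 0"
  shows "x = 0"
proof -
  have "span (range e) \<subseteq> {y. x \<bullet> y = 0}"
    using assms by (intro span_minimal) (auto simp: subspace_def inner_add_right)
  moreover have "closed {y. x \<bullet> y = 0}"
    by (intro closed_Collect_eq continuous_intros)
  ultimately have "closure (span (range e)) \<subseteq> {y. x \<bullet> y = 0}"
    by (rule closure_minimal)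
  then have "x \<bullet> x = 0" unfolding span_dense by blast
  then show ?thesis by simp
qed

lemma coord_eqI:
  assumes "\<And>k. x \<bullet> e k = y \<bullet> e k"
  shows "x = y"
  using coord_zero_imp_zero[of "x - y"] assms by (simp add: inner_diff_left)

lemma bessel: "(\<Sum>k\<in>{..<n}. (x \<bullet> e k)\<^sup>2) \<le> (norm x)\<^sup>2"
proof -
  let ?p = "\<Sum>k\<in>{..<n}. (x \<bullet> e k) *\<^sub>R e k"
  have "x \<bullet> ?p = (\<Sum>k\<in>{..<n}. (x \<bullet> e k)\<^sup>2)"
    by (simp add: inner_sum_right power2_eq_square)
  moreover have "?p \<bullet> ?p = (\<Sum>k\<in>{..<n}. (x \<bullet> e k)\<^sup>2)"
    using norm_basis_sum[of "{..<n}" "\<lambda>k. x \<bullet> e k"] by (simp add: power2_norm_eq_inner)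
  moreover have "0 \<le> (x - ?p) \<bullet> (x - ?p)" by simp
  ultimately show ?thesis
    by (simp add: inner_diff_left inner_diff_right inner_commute power2_norm_eq_inner)
qed

lemma summable_coord_square: "summable (\<lambda>k. (x \<bullet> e k)\<^sup>2)"
  by (rule summableI_nonneg_bounded[of _ "(norm x)\<^sup>2"]) (use bessel in auto)

lemma basis_expansion: "(\<lambda>k. (x \<bullet> e k) *\<^sub>R e k) sums x"
proof -
  have "(\<Sum>k. (x \<bullet> e k) *\<^sub>R e k) = x"
    by (rule coord_eqI) (simp add: inner_basis_suminf summable_coord_square)
  then show ?thesis
    using summable_sums[OF basis_series_summable[OF summable_coord_square], of x] by simp
qed

lemma parseval_inner: "(\<lambda>k. (x \<bullet> e k) * (y \<bullet> e k)) sums (x \<bullet> y)"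
  using bounded_linear.sums[OF bounded_linear_inner_right basis_expansion[of y], of x]
  by (simp add: mult.commute)

lemma parseval: "(\<lambda>k. (x \<bullet> e k)\<^sup>2) sums (norm x)\<^sup>2"
  using parseval_inner[of x x] unfolding power2_norm_eq_inner by (simp only: power2_eq_square)

text \<open>Operator norms of diagonal operators are read off coordinatewise by this comparison.\<close>

lemma norm_le_coord:
  assumes "\<And>k. \<bar>x \<bullet> e k\<bar> \<le> C * \<bar>y \<bullet> e k\<bar>" and "C \<ge> 0"
  shows "norm x \<le> C * norm y"
proof -
  have "(norm x)\<^sup>2 \<le> C\<^sup>2 * (norm y)\<^sup>2"
  proof (rule sums_le[OF _ parseval sums_mult[OF parseval]])
    fix k
    have "\<bar>x \<bullet> e k\<bar>\<^sup>2 \<le> (C * \<bar>y \<bullet> e k\<bar>)\<^sup>2" by (intro power_mono assms) auto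
    then show "(x \<bullet> e k)\<^sup>2 \<le> C\<^sup>2 * (y \<bullet> e k)\<^sup>2" by (simp add: power_mult_distrib)
  qed
  then have "(norm x)\<^sup>2 \<le> (C * norm y)\<^sup>2" by (simp add: power_mult_distrib)
  then show ?thesis by (rule power2_le_imp_le) (use \<open>C \<ge> 0\<close> in simp)
qed

text \<open>Riesz\<close>

text \<open>The candidate is \<open>\<Sum>k. F (e k) *\<^sub>R e k\<close>. Testing the functional on a partial sum of this series
gives \<open>s \<le> B * sqrt s\<close> for the partial sums \<open>s\<close> of the squares, hence their boundedness.\<close>

lemma riesz_representation:
  assumes "bounded_linear (F :: 'a \<Rightarrow> real)"
  obtains v where "\<And>x. F x = v \<bullet> x"
proof -
  interpret F: bounded_linear F by fact
  obtain B where B: "B \<ge> 0" "\<And>x. norm (F x) \<le> norm x * B" using F.nonneg_bounded by blast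
  have "(\<Sum>k<n. (F (e k))\<^sup>2) \<le> B\<^sup>2" for n
  proof -
    let ?s = "\<Sum>k<n. (F (e k))\<^sup>2" and ?p = "\<Sum>k<n. F (e k) *\<^sub>R e k"
    have "F ?p = ?s" by (simp add: F.sum F.scaleR power2_eq_square)
    then have "?s\<^sup>2 \<le> (norm ?p * B)\<^sup>2" using B(2)[of ?p]
      by (metis abs_ge_zero power2_abs power_mono real_norm_def)
    also have "\<dots> = ?s * B\<^sup>2" by (simp add: power_mult_distrib norm_basis_sum)
    finally have *: "?s * ?s \<le> ?s * B\<^sup>2" by (simp add: power2_eq_square)
    have "?s \<ge> 0" by (intro sum_nonneg) auto
    then show ?thesis using * by (cases "?s = 0") auto
  qed
  then have sum: "summable (\<lambda>k. (F (e k))\<^sup>2)"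
    by (intro summableI_nonneg_bounded[of _ "B\<^sup>2"]) auto
  define v where "v = (\<Sum>k. F (e k) *\<^sub>R e k)"
  have v: "v \<bullet> e k = F (e k)" for k unfolding v_def by (rule inner_basis_suminf[OF sum])
  have "F x = v \<bullet> x" for x
  proof -
    have "(\<lambda>k. F ((x \<bullet> e k) *\<^sub>R e k)) sums F x"
      by (intro F.sums basis_expansion)
    then have "(\<lambda>k. (v \<bullet> e k) * (x \<bullet> e k)) sums F x"
      by (simp add: F.scaleR v mult.commute)
    then show ?thesis using parseval_inner sums_unique2 by blast
  qed
  then show ?thesis by (rule that)
qed

text \<open>The series converges for bounded multipliers, and only such multipliers are used.\<close>

definition diag :: "(nat \<Rightarrow> real) \<Rightarrow> 'a \<Rightarrow> 'a" where
  "diag m x = (\<Sum>k. (m k * (x \<bullet> e k)) *\<^sub>R e k)"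

lemma diag_coord:
  assumes "\<And>k. \<bar>m k\<bar> \<le> C"
  shows "diag m x \<bullet> e k = m k * (x \<bullet> e k)"
  unfolding diag_def
proof (rule inner_basis_suminf)
  show "summable (\<lambda>k. (m k * (x \<bullet> e k))\<^sup>2)"
  proof (rule summable_comparison_test'[OF summable_mult[OF summable_coord_square[of x], of "C\<^sup>2"]])
    fix k
    have "\<bar>m k\<bar>\<^sup>2 \<le> C\<^sup>2" by (intro power_mono assms) auto
    then show "norm ((m k * (x \<bullet> e k))\<^sup>2) \<le> C\<^sup>2 * (x \<bullet> e k)\<^sup>2"
      by (simp add: power_mult_distrib mult_right_mono)
  qed
qed

lemma norm_diag_le:
  assumes "\<And>k. \<bar>m k\<bar> \<le> C"
  shows "norm (diag m x) \<le> C * norm x"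
proof (rule norm_le_coord)
  show "C \<ge> 0" using assms[of 0] by linarith
  show "\<bar>diag m x \<bullet> e k\<bar> \<le> C * \<bar>x \<bullet> e k\<bar>" for k
    by (simp add: diag_coord[OF assms] abs_mult mult_right_mono assms)
qed

lemma bounded_linear_diag:
  assumes "\<And>k. \<bar>m k\<bar> \<le> C"
  shows "bounded_linear (diag m)"
proof (rule bounded_linear_intro)
  show "diag m (x + y) = diag m x + diag m y" for x y
    by (rule coord_eqI) (simp only: diag_coord[OF assms] inner_add_left distrib_left)
  show "diag m (c *\<^sub>R x) = c *\<^sub>R diag m x" for c x
    by (rule coord_eqI) (simp add: diag_coord[of m C, OF assms])
  show "norm (diag m x) \<le> norm x * C" for x
    using norm_diag_le[OF assms] by (simp add: mult.commute)
qed

end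

section \<open>Laws on the Hilbert space are determined by their characteristic functionals\<close>

text \<open>A nonnegative weight turns the two laws into finite measures whose images under \<open>X\<close> have equal Fourier
transforms; after normalisation Levy's uniqueness theorem on the line applies. Cosines with an
arbitrary phase encode both the real and the imaginary part of the transform.\<close>

lemma weighted_law_eqI:
  fixes X :: "'b::topological_space \<Rightarrow> real" and w :: "'b \<Rightarrow> real"
  assumes M1: "prob_space M1" "sets M1 = sets borel" and M2: "prob_space M2" "sets M2 = sets borel"
    and [measurable]: "w \<in> borel_measurable borel" "X \<in> borel_measurable borel"
    and w: "\<And>y. 0 \<le> w y" "\<And>y. w y \<le> K"
    and eq: "\<And>\<xi> b. (LINT y|M1. w y * cos (\<xi> * X y + b)) = (LINT y|M2. w y * cos (\<xi> * X y + b))"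
    and B: "B \<in> sets borel"
  shows "(LINT y|M1. w y * indicator B (X y)) = (LINT y|M2. w y * indicator B (X y))"
proof -
  have meas: "(f \<in> borel_measurable M1) = (f \<in> borel_measurable borel)"
    "(f \<in> borel_measurable M2) = (f \<in> borel_measurable borel)" for f :: "'b \<Rightarrow> 'c::topological_space"
    using M1(2) M2(2) by (auto intro: measurable_cong_sets)
  have integ: "integrable M (\<lambda>y. w y * g y)"
    if "prob_space M" "sets M = sets borel" "g \<in> borel_measurable borel" "\<And>y. \<bar>g y\<bar> \<le> 1" for M g
  proof -
    interpret prob_space M by fact
    have [measurable_cong]: "sets M = sets borel" by fact
    have [measurable]: "g \<in> borel_measurable borel" by fact
    show ?thesis
    proof (rule integrable_const_bound[of _ K])
      have "\<bar>w y * g y\<bar> \<le> K" for y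
        using mult_mono[OF w(2)[of y] that(4)[of y]] w(1)[of y] order.trans[OF w(1)[of y] w(2)[of y]]
        by (simp add: abs_mult)
      then show "AE y in M. norm (w y * g y) \<le> K" by simp
    qed measurable
  qed
  define m where "m = (LINT y|M1. w y)"
  have m2: "m = (LINT y|M2. w y)" using eq[of 0 0] by (simp add: m_def)
  have m0: "m \<ge> 0" unfolding m_def by (intro integral_nonneg_AE) (use w in auto)
  show ?thesis
  proof (cases "m = 0")
    case True
    have "(LINT y|M. w y * indicator B (X y)) = 0"
      if "prob_space M" "sets M = sets borel" "(LINT y|M. w y) = 0" for M
    proof -
      have "AE y in M. w y = 0"
        using integral_nonneg_eq_0_iff_AE[of M w] integ[OF that(1,2), of "\<lambda>_. 1"] that(3) w by simp
      then have "AE y in M. w y * indicator B (X y) = 0" by auto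
      then show ?thesis by (rule integral_eq_zero_AE)
    qed
    then show ?thesis using M1 M2 True m2 m_def by metis
  next
    case False
    then have m: "m > 0" using m0 by simp
    \<comment> \<open>the law of \<open>X\<close> under the normalised weighted measure\<close>
    define L where "L M = distr (density M (\<lambda>y. w y / m)) borel X" for M
    have L: "real_distribution (L M)"
      "char (L M) \<xi> = ((LINT y|M. w y * cos (\<xi> * X y + 0)) / m
         + \<i> * ((LINT y|M. w y * cos (\<xi> * X y + (- pi / 2))) / m))"
      "measure (L M) B = (LINT y|M. w y * indicator B (X y)) / m"
      if M: "prob_space M" "sets M = sets borel" "(LINT y|M. w y) = m" for M \<xi>
    proof -
      interpret prob_space M by fact
      have [measurable_cong]: "sets M = sets borel" by fact
      have [measurable]: "B \<in> sets borel" by fact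
      have em: "emeasure (L M) C = ennreal ((LINT y|M. w y * indicator C (X y)) / m)"
        if [measurable]: "C \<in> sets borel" for C
      proof -
        have "emeasure (L M) C = (\<integral>\<^sup>+ y. ennreal (w y / m) * indicator (X -` C \<inter> space M) y \<partial>M)"
          unfolding L_def by (subst emeasure_distr; (subst emeasure_density)?) auto
        also have "\<dots> = (\<integral>\<^sup>+ y. ennreal (w y * indicator C (X y) / m) \<partial>M)"
          by (intro nn_integral_cong) (auto split: split_indicator)
        also have "\<dots> = ennreal (LINT y|M. w y * indicator C (X y) / m)"
          by (intro nn_integral_eq_integral integrable_divide_zero integ M AE_I2)
             (use w m in \<open>auto split: split_indicator\<close>)
        finally show ?thesis by simp
      qed
      have "emeasure (L M) (space (L M)) = 1"
        using em[of UNIV] m M(3) by (simp add: L_def)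
      then have "prob_space (L M)" by (rule prob_spaceI)
      then show "real_distribution (L M)"
        unfolding real_distribution_def real_distribution_axioms_def by (simp add: L_def)
      show "measure (L M) B = (LINT y|M. w y * indicator B (X y)) / m"
        unfolding measure_def em[OF B]
        by (intro enn2real_ennreal divide_nonneg_pos integral_nonneg_AE m) (use w in auto)
      have "char (L M) \<xi> = (CLINT y|density M (\<lambda>y. w y / m). iexp (\<xi> * X y))"
        unfolding L_def char_def by (subst integral_distr) auto
      also have "\<dots> = (CLINT y|M. (w y / m) *\<^sub>R iexp (\<xi> * X y))"
        by (subst integral_density) (use w m in auto)
      also have "\<dots> = (CLINT y|M. complex_of_real (w y * cos (\<xi> * X y + 0) / m)
          + \<i> * complex_of_real (w y * cos (\<xi> * X y + (- pi / 2)) / m))"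
      proof (intro Bochner_Integration.integral_cong refl)
        fix y
        have "cos (\<xi> * X y + (- pi / 2)) = sin (\<xi> * X y)"
          by (simp add: cos_diff)
        then show "(w y / m) *\<^sub>R iexp (\<xi> * X y) = complex_of_real (w y * cos (\<xi> * X y + 0) / m)
          + \<i> * complex_of_real (w y * cos (\<xi> * X y + (- pi / 2)) / m)"
          by (simp add: complex_eq_iff Re_exp Im_exp)
      qed
      also have "\<dots> = (CLINT y|M. complex_of_real (w y * cos (\<xi> * X y + 0) / m))
          + \<i> * (CLINT y|M. complex_of_real (w y * cos (\<xi> * X y + (- pi / 2)) / m))"
      proof (subst Bochner_Integration.integral_add)
        show "integrable M (\<lambda>y. complex_of_real (w y * cos (\<xi> * X y + 0) / m))"
          by (intro integrable_of_real integrable_divide_zero integ M) auto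
        show "integrable M (\<lambda>y. \<i> * complex_of_real (w y * cos (\<xi> * X y + (- pi / 2)) / m))"
          by (intro integrable_mult_right integrable_of_real integrable_divide_zero integ M) auto
      qed (simp only: integral_mult_right_zero)
      also have "\<dots> = ((LINT y|M. w y * cos (\<xi> * X y + 0)) / m
         + \<i> * ((LINT y|M. w y * cos (\<xi> * X y + (- pi / 2))) / m))"
        by (simp only: integral_complex_of_real integral_divide_zero of_real_divide)
      finally show "char (L M) \<xi> = ((LINT y|M. w y * cos (\<xi> * X y + 0)) / m
         + \<i> * ((LINT y|M. w y * cos (\<xi> * X y + (- pi / 2))) / m))" .
    qed
    note L1 = L[OF M1 m_def[symmetric]] and L2 = L[OF M2 m2[symmetric]]
    have "L M1 = L M2"
    proof (rule Levy_uniqueness[OF L1(1) L2(1)])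
      show "char (L M1) = char (L M2)" by (rule ext) (simp only: L1(2) L2(2) eq)
    qed
    then show ?thesis using L1(3) L2(3) m by simp
  qed
qed

context orthonormal_basis
begin

text \<open>Coordinates are converted from Fourier to indicator form one at a time. The factor \<open>cos (h \<bullet> y + b)\<close>
carries the directions that are still in Fourier form, and its phase keeps the family of test functions
closed under the product formula for cosines.\<close>

lemma cylinder_cos_eq:
  fixes M1 M2 :: "'a measure"
  assumes M1: "prob_space M1" "sets M1 = sets borel" and M2: "prob_space M2" "sets M2 = sets borel"
    and cf: "\<And>h. (CLINT y|M1. iexp (h \<bullet> y)) = (CLINT y|M2. iexp (h \<bullet> y))"
    and B: "\<And>i. B i \<in> sets borel"
  shows "(LINT y|M1. (\<Prod>i<n. indicator (B i) (y \<bullet> e i)) * cos (h \<bullet> y + b)) =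
         (LINT y|M2. (\<Prod>i<n. indicator (B i) (y \<bullet> e i)) * cos (h \<bullet> y + b))"
proof (induction n arbitrary: h b)
  case 0
  have "(LINT y|M. cos (h \<bullet> y + b)) = Re (iexp b * (CLINT y|M. iexp (h \<bullet> y)))"
    if M: "prob_space M" "sets M = sets borel" for M
  proof -
    interpret prob_space M by fact
    have [measurable_cong]: "sets M = sets borel" by fact
    have int: "integrable M (\<lambda>y. iexp (h \<bullet> y))" by (rule integrable_iexp) auto
    have "(LINT y|M. cos (h \<bullet> y + b)) = (LINT y|M. Re (iexp b * iexp (h \<bullet> y)))"
      by (intro Bochner_Integration.integral_cong refl) (simp add: Re_exp Im_exp cos_add)
    also have "\<dots> = Re (CLINT y|M. iexp b * iexp (h \<bullet> y))"
      by (intro integral_Re integrable_mult_right int)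
    finally show ?thesis by simp
  qed
  then show ?case using M1 M2 cf by simp
next
  case (Suc n)
  define \<rho> :: "'a \<Rightarrow> real" where "\<rho> y = (\<Prod>i<n. indicator (B i) (y \<bullet> e i))" for y
  have [measurable]: "\<And>i. B i \<in> sets borel" by fact
  have \<rho>_meas [measurable]: "\<rho> \<in> borel_measurable borel" unfolding \<rho>_def by measurable
  have \<rho>: "0 \<le> \<rho> y" "\<rho> y \<le> 1" for y
    unfolding \<rho>_def by (auto intro: prod_nonneg prod_le_1)
  have integ: "integrable M (\<lambda>y. \<rho> y * g y)"
    if "prob_space M" "sets M = sets borel" "g \<in> borel_measurable borel" "\<And>y. \<bar>g y\<bar> \<le> 1" for M g
  proof -
    interpret prob_space M by fact
    have [measurable_cong]: "sets M = sets borel" by fact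
    have [measurable]: "g \<in> borel_measurable borel" by fact
    have "\<bar>\<rho> y * g y\<bar> \<le> 1" for y
      using mult_mono[OF \<rho>(2)[of y] that(4)[of y]] \<rho>(1)[of y] by (simp add: abs_mult)
    then show ?thesis by (intro integrable_const_bound[of _ 1]) auto
  qed
  have IH: "(LINT y|M1. \<rho> y * cos (h \<bullet> y + b)) = (LINT y|M2. \<rho> y * cos (h \<bullet> y + b))" for h b
    using Suc.IH by (simp add: \<rho>_def)
  \<comment> \<open>\<open>1 + cos\<close> is nonnegative, so it may be used as a weight; products of cosines split into cosines of sums\<close>
  have step: "(LINT y|M1. (\<rho> y * (1 + cos (h \<bullet> y + a))) * indicator (B n) (y \<bullet> e n)) =
      (LINT y|M2. (\<rho> y * (1 + cos (h \<bullet> y + a))) * indicator (B n) (y \<bullet> e n))" for h a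
  proof (rule weighted_law_eqI[OF M1 M2, where K = 2])
    show "0 \<le> \<rho> y * (1 + cos (h \<bullet> y + a))" for y
      using mult_nonneg_nonneg[OF \<rho>(1)[of y], of "1 + cos (h \<bullet> y + a)"] cos_ge_minus_one[of "h \<bullet> y + a"] by linarith
    have "1 + cos (h \<bullet> y + a) \<le> 2" for y
      using cos_le_one[of "h \<bullet> y + a"] by simp
    then show "\<rho> y * (1 + cos (h \<bullet> y + a)) \<le> 2" for y
      using mult_mono[OF \<rho>(2)[of y], of "1 + cos (h \<bullet> y + a)" 2] cos_ge_minus_one[of "h \<bullet> y + a"] \<rho>(1)[of y]
      by simp
    have expand: "(LINT y|M. \<rho> y * (1 + cos (h \<bullet> y + a)) * cos (\<xi> * (y \<bullet> e n) + b)) =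
        (LINT y|M. \<rho> y * cos ((\<xi> *\<^sub>R e n) \<bullet> y + b))
        + (LINT y|M. \<rho> y * cos ((\<xi> *\<^sub>R e n + h) \<bullet> y + (b + a))) / 2
        + (LINT y|M. \<rho> y * cos ((\<xi> *\<^sub>R e n - h) \<bullet> y + (b - a))) / 2"
      if M: "prob_space M" "sets M = sets borel" for M \<xi> b
    proof -
      have "(LINT y|M. \<rho> y * (1 + cos (h \<bullet> y + a)) * cos (\<xi> * (y \<bullet> e n) + b)) =
        (LINT y|M. \<rho> y * cos ((\<xi> *\<^sub>R e n) \<bullet> y + b)
        + \<rho> y * cos ((\<xi> *\<^sub>R e n + h) \<bullet> y + (b + a)) / 2
        + \<rho> y * cos ((\<xi> *\<^sub>R e n - h) \<bullet> y + (b - a)) / 2)"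
      proof (intro Bochner_Integration.integral_cong refl)
        fix y
        define p q where "p = \<xi> * (y \<bullet> e n) + b" and "q = h \<bullet> y + a"
        have "(\<xi> *\<^sub>R e n) \<bullet> y + b = p" "(\<xi> *\<^sub>R e n + h) \<bullet> y + (b + a) = p + q"
          "(\<xi> *\<^sub>R e n - h) \<bullet> y + (b - a) = p - q"
          by (simp_all add: p_def q_def inner_add_left inner_diff_left inner_commute[of "e n" y])
        moreover have "r * (1 + cos q) * cos p = r * cos p + r * cos (p + q) / 2 + r * cos (p - q) / 2" for r
          by (simp add: cos_add cos_diff algebra_simps add_divide_distrib[symmetric])
        ultimately show "\<rho> y * (1 + cos (h \<bullet> y + a)) * cos (\<xi> * (y \<bullet> e n) + b) = \<rho> y * cos ((\<xi> *\<^sub>R e n) \<bullet> y + b)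
        + \<rho> y * cos ((\<xi> *\<^sub>R e n + h) \<bullet> y + (b + a)) / 2
        + \<rho> y * cos ((\<xi> *\<^sub>R e n - h) \<bullet> y + (b - a)) / 2"
          by (simp only: p_def[symmetric] q_def[symmetric])
      qed
      also have "\<dots> = (LINT y|M. \<rho> y * cos ((\<xi> *\<^sub>R e n) \<bullet> y + b))
        + (LINT y|M. \<rho> y * cos ((\<xi> *\<^sub>R e n + h) \<bullet> y + (b + a))) / 2
        + (LINT y|M. \<rho> y * cos ((\<xi> *\<^sub>R e n - h) \<bullet> y + (b - a))) / 2"
        by (subst Bochner_Integration.integral_add Bochner_Integration.integral_add integral_divide_zero |
            (intro Bochner_Integration.integrable_add integrable_divide_zero integ M; auto; fail))+ simp
      finally show ?thesis .
    qed
    show "(LINT y|M1. \<rho> y * (1 + cos (h \<bullet> y + a)) * cos (\<xi> * (y \<bullet> e n) + b)) =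
      (LINT y|M2. \<rho> y * (1 + cos (h \<bullet> y + a)) * cos (\<xi> * (y \<bullet> e n) + b))" for \<xi> b
      by (simp only: expand[OF M1] expand[OF M2] IH)
  qed (use B in measurable)
  define \<rho>' where "\<rho>' y = \<rho> y * indicator (B n) (y \<bullet> e n)" for y
  have split: "(LINT y|M. (\<rho> y * (1 + cos (h \<bullet> y + a))) * indicator (B n) (y \<bullet> e n)) =
      (LINT y|M. \<rho>' y) + (LINT y|M. \<rho>' y * cos (h \<bullet> y + a))"
    if M: "prob_space M" "sets M = sets borel" for M h a
  proof -
    have "integrable M (\<lambda>y. \<rho> y * (indicator (B n) (y \<bullet> e n) :: real))"
      by (intro integ M) (auto split: split_indicator)
    moreover have "integrable M (\<lambda>y. \<rho> y * ((indicator (B n) (y \<bullet> e n) :: real) * cos (h \<bullet> y + a)))"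
      by (intro integ M) (auto split: split_indicator)
    ultimately show ?thesis
      unfolding \<rho>'_def by (subst Bochner_Integration.integral_add[symmetric]) (auto simp: algebra_simps)
  qed
  have "(LINT y|M1. \<rho>' y) = (LINT y|M2. \<rho>' y)"
    \<comment> \<open>with \<open>h = 0\<close> and the phase \<open>pi / 2\<close> the cosine vanishes and only the constant weight is left\<close>
    using step[of 0 "pi / 2"] by (simp add: \<rho>'_def)
  then have "(LINT y|M1. \<rho>' y * cos (h \<bullet> y + b)) = (LINT y|M2. \<rho>' y * cos (h \<bullet> y + b))"
    using step[of h b] by (simp add: split[OF M1] split[OF M2])
  then show ?case by (simp add: \<rho>'_def \<rho>_def)
qed

text \<open>The coordinate map into the countable product of lines has a measurable left inverse, namely the sum of
the basis expansion, so it suffices to compare the two image laws on cylinders.\<close>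

theorem characteristic_functional_unique:
  fixes M1 M2 :: "'a measure"
  assumes M1: "prob_space M1" "sets M1 = sets borel" and M2: "prob_space M2" "sets M2 = sets borel"
    and cf: "\<And>h. (CLINT y|M1. iexp (h \<bullet> y)) = (CLINT y|M2. iexp (h \<bullet> y))"
  shows "M1 = M2"
proof -
  interpret M1: prob_space M1 by fact
  interpret M2: prob_space M2 by fact
  define C where "C y = (\<lambda>k. y \<bullet> e k)" for y
  define PP where "PP = (Pi\<^sub>M UNIV (\<lambda>_. borel) :: (nat \<Rightarrow> real) measure)"
  have C: "C \<in> measurable M PP" if "sets M = sets borel" for M
  proof -
    have [measurable_cong]: "sets M = sets borel" by fact
    show ?thesis unfolding C_def PP_def by (rule measurable_PiM_single') auto
  qed
  define J where "J c = lim (\<lambda>n. \<Sum>k<n. c k *\<^sub>R e k)" for c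
  have J [measurable]: "J \<in> measurable PP borel"
    unfolding J_def PP_def by measurable
  have JC: "J (C y) = y" for y
    unfolding J_def C_def using basis_expansion[of y] by (simp add: sums_def limI)
  have recover: "M = distr (distr M PP C) borel J" if "sets M = sets borel" for M
  proof -
    have [measurable_cong]: "sets M = sets borel" by fact
    have "distr (distr M PP C) borel J = distr M borel (\<lambda>y. y)"
      by (simp add: distr_distr[OF J C[OF that]] o_def JC)
    also have "\<dots> = M" using that by (rule distr_id2[OF sym])
    finally show ?thesis by simp
  qed
  have "distr M1 PP C = distr M2 PP C"
  proof (rule measure_eqI_PiM_infinite[where I = UNIV and M = "\<lambda>_. borel"])
    show "finite_measure (distr M1 PP C)"
      using M1.prob_space_distr[OF C[OF M1(2)]] by (rule prob_space.axioms)
  next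
    fix A :: "nat \<Rightarrow> real set" and I :: "nat set"
    assume I: "finite I" and A: "\<And>i. i \<in> I \<Longrightarrow> A i \<in> sets borel"
    define B where "B i = (if i \<in> I then A i else UNIV)" for i
    obtain n where n: "\<And>i. i \<in> I \<Longrightarrow> i < n" using I by (meson finite_nat_set_iff_bounded)
    have B [measurable]: "B i \<in> sets borel" for i using A by (simp add: B_def)
    have emb: "prod_emb UNIV (\<lambda>_. borel) I (Pi\<^sub>E I A) \<in> sets PP"
      unfolding PP_def using I A by (intro sets_PiM_I) auto
    have "emeasure (distr M PP C) (prod_emb UNIV (\<lambda>_. borel) I (Pi\<^sub>E I A)) =
        ennreal (LINT y|M. (\<Prod>i<n. indicator (B i) (y \<bullet> e i)) * cos (0 \<bullet> y + 0))"
      if M: "prob_space M" "sets M = sets borel" for M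
    proof -
      interpret prob_space M by fact
      have [measurable_cong]: "sets M = sets borel" by fact
      have sp: "space M = UNIV" using sets_eq_imp_space_eq[OF M(2)] by simp
      have "C -` prod_emb UNIV (\<lambda>_. borel) I (Pi\<^sub>E I A) \<inter> space M = {y. \<forall>i<n. y \<bullet> e i \<in> B i}"
        using n by (auto simp: sp C_def prod_emb_def B_def PiE_iff extensional_def restrict_def space_PiM)
      then have "emeasure (distr M PP C) (prod_emb UNIV (\<lambda>_. borel) I (Pi\<^sub>E I A)) =
          emeasure M {y. \<forall>i<n. y \<bullet> e i \<in> B i}"
        by (simp add: emeasure_distr[OF C[OF M(2)] emb])
      also have "\<dots> = ennreal (LINT y|M. indicator {y. \<forall>i<n. y \<bullet> e i \<in> B i} y)"
        by (simp add: sp emeasure_eq_measure)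
      also have "(\<lambda>y. indicator {y. \<forall>i<n. y \<bullet> e i \<in> B i} y :: real) =
          (\<lambda>y. (\<Prod>i<n. indicator (B i) (y \<bullet> e i)) * cos (0 \<bullet> y + 0))"
        by (auto simp: fun_eq_iff indicator_def prod.If_cases)
      finally show ?thesis .
    qed
    then show "emeasure (distr M1 PP C) (prod_emb UNIV (\<lambda>_. borel) I (Pi\<^sub>E I A)) =
        emeasure (distr M2 PP C) (prod_emb UNIV (\<lambda>_. borel) I (Pi\<^sub>E I A))"
      using cylinder_cos_eq[OF M1 M2 cf B, where n = n and h = 0 and b = 0] M1 M2 by simp
  qed (simp_all add: PP_def)
  then show ?thesis using recover[OF M1(2)] recover[OF M2(2)] by simp
qed

end

section \<open>Shifts of the standard normal law\<close>

abbreviation std :: "real measure" where "std \<equiv> std_normal_distribution"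

lemma integral_std: 
  fixes g :: "real \<Rightarrow> 'b::{banach, second_countable_topology}"
  assumes [measurable]: "g \<in> borel_measurable borel"
  shows "(LINT r|std. g r) = (LINT r|lborel. std_normal_density r *\<^sub>R g r)"
    "integrable std g \<longleftrightarrow> integrable lborel (\<lambda>r. std_normal_density r *\<^sub>R g r)"
  by (subst integral_density; simp add: std_normal_density_def) (subst integrable_density; simp)

lemma std_moments:
  shows "integrable std (\<lambda>r. r)" "(LINT r|std. r) = 0"
    "integrable std (\<lambda>r. r\<^sup>2)" "(LINT r|std. r\<^sup>2) = 1"
proof -
  show "integrable std (\<lambda>r. r)" using integrable_std_normal_distribution_moment[of 1] by simp
  show "(LINT r|std. r) = 0" using integral_std_normal_distribution_moment_odd[of 1] by simp
  show "integrable std (\<lambda>r. r\<^sup>2)" using integrable_std_normal_distribution_moment[of 2] by simp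
  show "(LINT r|std. r\<^sup>2) = 1" using std_normal_distribution_even_moments(1)[of 1] by simp
qed

interpretation std: real_distribution std
  by (rule real_dist_normal_dist)

lemma std_abs_moment: "integrable std (\<lambda>r. \<bar>r\<bar>)" "(LINT r|std. \<bar>r\<bar>) \<le> 1"
proof -
  show i: "integrable std (\<lambda>r. \<bar>r\<bar>)" using std_moments(1) by (rule integrable_abs)
  have "(LINT r|std. \<bar>r\<bar>) \<le> (LINT r|std. (1 + r\<^sup>2) / 2)"
  proof (rule integral_mono[OF i])
    show "integrable std (\<lambda>r. (1 + r\<^sup>2) / 2)" using std_moments(3) by simp
    show "\<bar>r\<bar> \<le> (1 + r\<^sup>2) / 2" for r :: real
      using zero_le_power2[of "\<bar>r\<bar> - 1"] by (simp add: power2_diff)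
  qed
  also have "\<dots> = 1" using std_moments(3,4) std.prob_space by simp
  finally show "(LINT r|std. \<bar>r\<bar>) \<le> 1" .
qed

lemma std_normal_density_shift: "std_normal_density (r - s) = std_normal_density r * exp (r * s - s\<^sup>2 / 2)"
proof -
  have "exp (- (r - s)\<^sup>2 / 2) = exp (- r\<^sup>2 / 2 + (r * s - s\<^sup>2 / 2))"
    by (rule arg_cong[of _ _ exp]) (simp add: power2_diff field_simps)
  then show ?thesis unfolding std_normal_density_def exp_add by simp
qed

text \<open>The Cameron--Martin formula on the line: the density of the shifted law with respect to the standard
normal law is \<open>exp (r * s - s\<^sup>2 / 2)\<close>.\<close>

lemma std_shift:
  assumes [measurable]: "g \<in> borel_measurable borel"
  shows "(LINT r|std. g (r + s)) = (LINT r|std. exp (r * s - s\<^sup>2 / 2) * g r)" (is ?eq)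
    and "integrable std (\<lambda>r. g (r + s)) \<longleftrightarrow> integrable std (\<lambda>r. exp (r * s - s\<^sup>2 / 2) * g r)" (is ?int)
proof -
  have *: "std_normal_density (- s + 1 * r) *\<^sub>R g ((- s + 1 * r) + s)
      = std_normal_density r *\<^sub>R (exp (r * s - s\<^sup>2 / 2) * g r)" for r
    using std_normal_density_shift[of r s] by (simp add: algebra_simps)
  show ?eq
    using lborel_integral_real_affine[of 1 "\<lambda>r. std_normal_density r *\<^sub>R g (r + s)" "- s"]
    unfolding * by (simp add: integral_std(1))
  show ?int
    using lborel_integrable_real_affine_iff[of 1 "\<lambda>r. std_normal_density r *\<^sub>R g (r + s)" "- s"]
    unfolding * by (simp add: integral_std(2))
qed

text \<open>The second-order remainder of the Cameron--Martin density, \<open>Z r = exp (r * s - s\<^sup>2 / 2) - 1 - s * r\<close>, has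
the explicit second moment \<open>exp (s\<^sup>2) - 1 - s\<^sup>2 \<le> s\<^sup>4\<close>. Only the supremum of \<open>g\<close> enters, so the estimate
holds uniformly in the component of a Gaussian vector that is independent of the differentiated one.\<close>

lemma std_shift_second_order:
  assumes [measurable]: "g \<in> borel_measurable borel" and B: "\<And>r. \<bar>g r\<bar> \<le> B" and s: "\<bar>s\<bar> \<le> 1"
  shows "\<bar>(LINT r|std. g (r + s)) - (LINT r|std. g r) - s * (LINT r|std. r * g r)\<bar> \<le> B * s\<^sup>2"
proof (cases "s = 0")
  case False
  have B0: "B \<ge> 0" using B[of 0] by linarith
  define E where "E r = exp (r * s - s\<^sup>2 / 2)" for r
  have [measurable]: "E \<in> borel_measurable borel" unfolding E_def by measurable
  have E: "integrable std E" "(LINT r|std. E r) = 1"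
    using std_shift[of "\<lambda>_. 1" s] std.prob_space by (simp_all add: E_def[abs_def])
  have rE: "integrable std (\<lambda>r. E r * r)" "(LINT r|std. E r * r) = s"
  proof -
    have m: "(\<lambda>r::real. r) \<in> borel_measurable borel" by simp
    have "integrable std (\<lambda>r. r + s)" "(LINT r|std. r + s) = s"
      using std_moments(1,2) std.prob_space by simp_all
    then show "integrable std (\<lambda>r. E r * r)" "(LINT r|std. E r * r) = s"
      unfolding E_def std_shift[OF m] by blast+
  qed
  have E2_eq: "(E r)\<^sup>2 = exp (s\<^sup>2) * exp (r * (2 * s) - (2 * s)\<^sup>2 / 2)" for r
    unfolding E_def exp_add[symmetric] exp_double[symmetric]
    by (rule arg_cong[of _ _ exp]) (simp add: power2_eq_square field_simps)
  have E2: "integrable std (\<lambda>r. (E r)\<^sup>2)" "(LINT r|std. (E r)\<^sup>2) = exp (s\<^sup>2)"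
  proof -
    have m: "(\<lambda>r::real. 1::real) \<in> borel_measurable borel" by simp
    note i = std_shift[OF m, of "2 * s", unfolded mult_1_right]
    show "integrable std (\<lambda>r. (E r)\<^sup>2)"
      unfolding E2_eq by (intro integrable_mult_right i(2)[THEN iffD1]) simp
    show "(LINT r|std. (E r)\<^sup>2) = exp (s\<^sup>2)"
      unfolding E2_eq integral_mult_right_zero i(1)[symmetric] using std.prob_space by simp
  qed
  define Z where "Z r = E r - 1 - s * r" for r
  have Z: "integrable std Z" unfolding Z_def using E std_moments by simp
  have Z2_eq: "(Z r)\<^sup>2 = (E r)\<^sup>2 + 1 + s\<^sup>2 * r\<^sup>2 - 2 * E r - 2 * s * (E r * r) + 2 * s * r" for r
    unfolding Z_def by (simp add: power2_eq_square algebra_simps)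
  have Z2i: "integrable std (\<lambda>r. (Z r)\<^sup>2)"
    unfolding Z2_eq using E E2 rE std_moments by simp
  have "(LINT r|std. (Z r)\<^sup>2) = exp (s\<^sup>2) - 1 - s\<^sup>2"
  proof -
    have "(LINT r|std. (Z r)\<^sup>2) = (LINT r|std. (E r)\<^sup>2) + 1 + s\<^sup>2 * (LINT r|std. r\<^sup>2)
        - 2 * (LINT r|std. E r) - 2 * s * (LINT r|std. E r * r) + 2 * s * (LINT r|std. r)"
      unfolding Z2_eq using E(1) E2(1) rE(1) std_moments(1,3) std.prob_space by simp
    also have "\<dots> = exp (s\<^sup>2) - 1 - s\<^sup>2"
      unfolding E(2) E2(2) rE(2) std_moments(2,4) by (simp add: power2_eq_square)
    finally show ?thesis .
  qed
  also have "\<dots> \<le> (s\<^sup>2)\<^sup>2"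
    using exp_bound[of "s\<^sup>2"] s by (simp add: abs_square_le_1)
  finally have Z2: "(LINT r|std. (Z r)\<^sup>2) \<le> (s\<^sup>2)\<^sup>2" .
  have s2: "s\<^sup>2 > 0" using False by simp
  have "(LINT r|std. \<bar>Z r\<bar>) \<le> (LINT r|std. ((Z r)\<^sup>2 / s\<^sup>2 + s\<^sup>2) / 2)"
  proof (rule integral_mono)
    show "integrable std (\<lambda>r. \<bar>Z r\<bar>)" using Z by simp
    show "integrable std (\<lambda>r. ((Z r)\<^sup>2 / s\<^sup>2 + s\<^sup>2) / 2)" using Z2i by simp
    show "\<bar>Z r\<bar> \<le> ((Z r)\<^sup>2 / s\<^sup>2 + s\<^sup>2) / 2" for r
      \<comment> \<open>\<open>2 \<bar>Z r\<bar> \<le> (Z r)\<^sup>2 / s\<^sup>2 + s\<^sup>2\<close>; the weight \<open>s\<^sup>2\<close> balances the two terms\<close>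
      using zero_le_power2[of "\<bar>Z r\<bar> - s\<^sup>2"] s2 by (simp add: field_simps power2_diff)
  qed
  also have "\<dots> = ((LINT r|std. (Z r)\<^sup>2) / s\<^sup>2 + s\<^sup>2) / 2"
    using Z2i std.prob_space by simp
  also have "\<dots> \<le> s\<^sup>2"
  proof -
    have "(LINT r|std. (Z r)\<^sup>2) / s\<^sup>2 \<le> s\<^sup>2"
      using Z2 s2 by (simp add: divide_le_eq power2_eq_square)
    then show ?thesis by simp
  qed
  finally have absZ: "(LINT r|std. \<bar>Z r\<bar>) \<le> s\<^sup>2" .
  have bnd: "integrable std (\<lambda>r. h r * g r)" if "integrable std h" for h :: "real \<Rightarrow> real"
  proof (rule Bochner_Integration.integrable_bound)
    show "integrable std (\<lambda>r. h r * B)" using that by simp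
    show "(\<lambda>r. h r * g r) \<in> borel_measurable std" using borel_measurable_integrable[OF that] by measurable
    show "AE r in std. norm (h r * g r) \<le> norm (h r * B)"
    proof (rule AE_I2)
      show "norm (h r * g r) \<le> norm (h r * B)" for r
        using mult_left_mono[OF B[of r], of "\<bar>h r\<bar>"] B0 by (simp add: abs_mult)
    qed
  qed
  have "(LINT r|std. g (r + s)) - (LINT r|std. g r) - s * (LINT r|std. r * g r)
      = (LINT r|std. E r * g r) - (LINT r|std. 1 * g r) - (LINT r|std. (s * r) * g r)"
    unfolding std_shift(1)[OF assms(1)] E_def by (simp add: mult.assoc)
  also have "\<dots> = (LINT r|std. E r * g r - 1 * g r - (s * r) * g r)"
    using bnd[OF E(1)] bnd[of "\<lambda>_. 1"] bnd[of "\<lambda>r. s * r"] std_moments(1)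
    by (subst Bochner_Integration.integral_diff Bochner_Integration.integral_diff; simp)
  also have "\<dots> = (LINT r|std. Z r * g r)"
    by (intro Bochner_Integration.integral_cong refl) (simp add: Z_def algebra_simps)
  also have "\<bar>\<dots>\<bar> \<le> (LINT r|std. \<bar>Z r * g r\<bar>)"
    by (rule integral_abs_bound)
  also have "\<dots> \<le> (LINT r|std. B * \<bar>Z r\<bar>)"
  proof (rule integral_mono)
    show "integrable std (\<lambda>r. \<bar>Z r * g r\<bar>)" by (intro integrable_abs bnd Z)
    show "integrable std (\<lambda>r. B * \<bar>Z r\<bar>)" using Z by simp
    show "\<bar>Z r * g r\<bar> \<le> B * \<bar>Z r\<bar>" for r
      using mult_right_mono[OF B[of r], of "\<bar>Z r\<bar>"] by (simp add: abs_mult mult.commute)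
  qed
  also have "\<dots> \<le> B * s\<^sup>2"
    using absZ B0 by (simp add: mult_left_mono)
  finally show ?thesis .
qed simp

section \<open>Derivatives of Gaussian means\<close>

text \<open>Injectivity of the covariance makes every \<open>w \<noteq> 0\<close> a direction of positive variance. For the
Ornstein--Uhlenbeck semigroup it holds at positive times.\<close>

locale nondegenerate_gaussian = orthonormal_basis e
  for e :: "nat \<Rightarrow> 'a::{real_inner,banach,second_countable_topology}" +
  fixes M :: "'a measure" and Q :: "'a \<Rightarrow> 'a"
  assumes gaussian: "centered_gaussian M Q"
    and bounded_linear_cov: "bounded_linear Q"
    and cov_symmetric: "Q x \<bullet> y = x \<bullet> Q y"
    and cov_pos: "x \<noteq> 0 \<Longrightarrow> Q x \<bullet> x > 0"
begin

sublocale prob_space M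
  using gaussian by (simp add: centered_gaussian_def)

sublocale cov: bounded_linear Q by (rule bounded_linear_cov)

lemma sets_M [measurable_cong, simp]: "sets M = sets borel"
  using gaussian by (simp add: centered_gaussian_def)

lemma space_M [simp]: "space M = UNIV"
  using sets_eq_imp_space_eq[OF sets_M] by simp

definition sd :: "'a \<Rightarrow> real" where "sd w = sqrt (Q w \<bullet> w)"

lemma sd_pos: "w \<noteq> 0 \<Longrightarrow> sd w > 0" and sd_zero [simp]: "sd 0 = 0"
  by (simp_all add: sd_def cov_pos)

lemma sd_nonneg: "sd w \<ge> 0"
  using sd_pos[of w] by (cases "w = 0") auto

lemma sd_square: "(sd w)\<^sup>2 = Q w \<bullet> w"
  using cov_pos[of w] by (cases "w = 0") (auto simp: sd_def)

text \<open>The component of \<open>y\<close> that is correlated with \<open>\<langle>w, y\<rangle>\<close> is removed and replaced by the same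
multiple of \<open>Q w\<close> with an independent standard normal coefficient.\<close>

definition resample :: "'a \<Rightarrow> 'a \<times> real \<Rightarrow> 'a" where
  "resample w = (\<lambda>(y, r). y - ((w \<bullet> y) / (sd w)\<^sup>2) *\<^sub>R Q w + (r / sd w) *\<^sub>R Q w)"

lemma resample_measurable [measurable]: "resample w \<in> borel_measurable (M \<Otimes>\<^sub>M std)"
  unfolding resample_def by measurable

lemma resample_shift: "w \<noteq> 0 \<Longrightarrow> resample w (y, r) + \<tau> *\<^sub>R Q w = resample w (y, r + \<tau> * sd w)"
  using sd_pos[of w] by (simp add: resample_def add_divide_distrib scaleR_add_left)

lemma inner_resample:
  assumes "w \<noteq> 0" shows "w \<bullet> resample w (y, r) = sd w * r"
proof -
  have "w \<bullet> Q w = (sd w)\<^sup>2" by (simp add: sd_square inner_commute)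
  then show ?thesis
    using sd_pos[OF assms] by (simp add: resample_def inner_diff_right inner_add_right field_simps power2_eq_square)
qed

text \<open>The exponent of the characteristic functional loses \<open>(h \<bullet> Q w)\<^sup>2 / (Q w \<bullet> w)\<close> when the correlated
component is removed, and the independent replacement adds the same amount.\<close>

lemma regression:
  assumes w: "w \<noteq> 0"
  shows "distr (M \<Otimes>\<^sub>M std) borel (resample w) = M"
proof (rule characteristic_functional_unique)
  interpret P: pair_prob_space M std ..
  show "prob_space (distr (M \<Otimes>\<^sub>M std) borel (resample w))"
    by (rule P.prob_space_distr) simp
  show "sets (distr (M \<Otimes>\<^sub>M std) borel (resample w)) = sets borel" by simp
  show "prob_space M" by (rule prob_space_axioms)
  show "sets M = sets borel" by simp
  fix h
  define c where "c = sd w"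
  have c: "c > 0" using sd_pos[OF w] by (simp add: c_def)
  have c2: "c\<^sup>2 = Q w \<bullet> w" unfolding c_def by (rule sd_square)
  define a where "a = (h \<bullet> Q w) / c\<^sup>2"
  define d where "d = (h \<bullet> Q w) / c"
  have cf: "(CLINT y|M. iexp (k \<bullet> y)) = complex_of_real (exp (- (Q k \<bullet> k) / 2))" for k
    using gaussian by (simp add: centered_gaussian_def)
  have split: "h \<bullet> resample w (y, r) = (h - a *\<^sub>R w) \<bullet> y + d * r" for y r
    by (simp add: resample_def a_def d_def c_def inner_diff_left inner_diff_right inner_add_right mult.commute)
  have "(CLINT y|distr (M \<Otimes>\<^sub>M std) borel (resample w). iexp (h \<bullet> y))
      = (CLINT p|(M \<Otimes>\<^sub>M std). iexp (h \<bullet> resample w p))"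
    by (subst integral_distr) auto
  also have "\<dots> = (CLINT y|M. (CLINT r|std. iexp (h \<bullet> resample w (y, r))))"
    by (rule P.integral_fst'[symmetric], rule P.integrable_iexp) auto
  also have "\<dots> = (CLINT y|M. (CLINT r|std. iexp ((h - a *\<^sub>R w) \<bullet> y) * iexp (d * r)))"
    unfolding split by (simp add: exp_add distrib_left)
  also have "\<dots> = (CLINT y|M. iexp ((h - a *\<^sub>R w) \<bullet> y)) * char std d"
    by (simp add: char_def)
  also have "\<dots> = complex_of_real (exp (- (Q (h - a *\<^sub>R w) \<bullet> (h - a *\<^sub>R w)) / 2)) * complex_of_real (exp (- (d\<^sup>2) / 2))"
    unfolding cf by (simp add: char_std_normal_distribution)
  also have "\<dots> = complex_of_real (exp (- (Q h \<bullet> h) / 2))"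
  proof -
    have "Q h \<bullet> w = h \<bullet> Q w" "Q w \<bullet> h = h \<bullet> Q w" by (rule cov_symmetric, rule inner_commute)
    then have "Q (h - a *\<^sub>R w) \<bullet> (h - a *\<^sub>R w) = Q h \<bullet> h - 2 * a * (h \<bullet> Q w) + a\<^sup>2 * c\<^sup>2"
      unfolding c2 by (simp add: cov.diff cov.scaleR inner_diff_left inner_diff_right algebra_simps power2_eq_square)
    also have "\<dots> + d\<^sup>2 = Q h \<bullet> h"
      using c by (simp add: a_def d_def field_simps power2_eq_square)
    finally have "Q (h - a *\<^sub>R w) \<bullet> (h - a *\<^sub>R w) + d\<^sup>2 = Q h \<bullet> h" .
    then have "exp (- (Q (h - a *\<^sub>R w) \<bullet> (h - a *\<^sub>R w)) / 2) * exp (- (d\<^sup>2) / 2) = exp (- (Q h \<bullet> h) / 2)"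
      unfolding exp_add[symmetric] by (simp add: field_simps)
    then show ?thesis by (metis of_real_mult)
  qed
  also have "\<dots> = (CLINT y|M. iexp (h \<bullet> y))" unfolding cf ..
  finally show "(CLINT y|distr (M \<Otimes>\<^sub>M std) borel (resample w). iexp (h \<bullet> y)) = (CLINT y|M. iexp (h \<bullet> y))" .
qed

lemma integral_regression:
  fixes G :: "'a \<Rightarrow> real"
  assumes "w \<noteq> 0" and "integrable M G"
  shows "(LINT y|M. G y) = (LINT y|M. (LINT r|std. G (resample w (y, r))))"
    and "integrable (M \<Otimes>\<^sub>M std) (\<lambda>p. G (resample w p))"
    and "integrable M (\<lambda>y. LINT r|std. G (resample w (y, r)))"
proof -
  interpret P: pair_prob_space M std ..
  have [measurable]: "G \<in> borel_measurable borel"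
    using borel_measurable_integrable[OF assms(2)] by simp
  have "integrable (distr (M \<Otimes>\<^sub>M std) borel (resample w)) G"
    using assms(2) by (simp only: regression[OF assms(1)])
  then show i: "integrable (M \<Otimes>\<^sub>M std) (\<lambda>p. G (resample w p))"
    by (subst (asm) integrable_distr_eq) auto
  have "(LINT y|M. G y) = (LINT y|distr (M \<Otimes>\<^sub>M std) borel (resample w). G y)"
    by (simp only: regression[OF assms(1)])
  also have "\<dots> = (LINT p|(M \<Otimes>\<^sub>M std). G (resample w p))"
    by (subst integral_distr) auto
  also have "\<dots> = (LINT y|M. (LINT r|std. G (resample w (y, r))))"
    by (rule P.integral_fst'[symmetric, OF i])
  finally show "(LINT y|M. G y) = (LINT y|M. (LINT r|std. G (resample w (y, r))))" .
  show "integrable M (\<lambda>y. LINT r|std. G (resample w (y, r)))"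
    by (rule P.integrable_fst'[OF i])
qed

lemma nn_integral_inner:
  assumes w: "w \<noteq> 0" and [measurable]: "g \<in> borel_measurable borel"
  shows "(\<integral>\<^sup>+ y. g (w \<bullet> y) \<partial>M) = (\<integral>\<^sup>+ r. g (sd w * r) \<partial>std)"
proof -
  have "(\<integral>\<^sup>+ y. g (w \<bullet> y) \<partial>M) = (\<integral>\<^sup>+ y. g (w \<bullet> y) \<partial>distr (M \<Otimes>\<^sub>M std) borel (resample w))"
    by (simp only: regression[OF w])
  also have "\<dots> = (\<integral>\<^sup>+ p. g (w \<bullet> resample w p) \<partial>(M \<Otimes>\<^sub>M std))"
    by (subst nn_integral_distr) auto
  also have "\<dots> = (\<integral>\<^sup>+ y. \<integral>\<^sup>+ r. g (w \<bullet> resample w (y, r)) \<partial>std \<partial>M)"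
    by (rule std.nn_integral_fst[symmetric]) auto
  also have "\<dots> = (\<integral>\<^sup>+ r. g (sd w * r) \<partial>std)"
    by (simp add: inner_resample[OF w] emeasure_space_1[simplified])
  finally show ?thesis .
qed

lemma nn_second_moment: "(\<integral>\<^sup>+ y. ennreal ((w \<bullet> y)\<^sup>2) \<partial>M) = ennreal (Q w \<bullet> w)"
proof (cases "w = 0")
  case False
  have "(\<integral>\<^sup>+ y. ennreal ((w \<bullet> y)\<^sup>2) \<partial>M) = (\<integral>\<^sup>+ r. ennreal ((sd w * r)\<^sup>2) \<partial>std)"
    by (rule nn_integral_inner[OF False]) auto
  also have "\<dots> = ennreal (LINT r|std. (sd w * r)\<^sup>2)"
    using std_moments(3) by (intro nn_integral_eq_integral) (auto simp: power_mult_distrib)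
  also have "(LINT r|std. (sd w * r)\<^sup>2) = Q w \<bullet> w"
    using std_moments(4) by (simp add: power_mult_distrib sd_square)
  finally show ?thesis .
qed simp

lemma integrable_inner_square: "integrable M (\<lambda>y. (w \<bullet> y)\<^sup>2)"
  by (rule integrableI_nonneg) (auto simp: nn_second_moment)

lemma integrable_inner: "integrable M (\<lambda>y. w \<bullet> y)"
proof (rule Bochner_Integration.integrable_bound)
  show "integrable M (\<lambda>y. 1 + (w \<bullet> y)\<^sup>2)" using integrable_inner_square by simp
  have "\<bar>r\<bar> \<le> 1 + r\<^sup>2" for r :: real
    using zero_le_power2[of "\<bar>r\<bar> - 1"] by (simp add: power2_diff)
  then show "AE y in M. norm (w \<bullet> y) \<le> norm (1 + (w \<bullet> y)\<^sup>2)" by simp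
qed simp

lemma abs_moment_le: "(LINT y|M. \<bar>w \<bullet> y\<bar>) \<le> sd w"
proof (cases "w = 0")
  case False
  have "(LINT y|M. \<bar>w \<bullet> y\<bar>) = (LINT y|M. (LINT r|std. \<bar>w \<bullet> resample w (y, r)\<bar>))"
    using integrable_inner by (intro integral_regression False) simp
  also have "\<dots> = sd w * (LINT r|std. \<bar>r\<bar>)"
    by (simp add: inner_resample[OF False] abs_mult sd_nonneg prob_space[simplified])
  also have "\<dots> \<le> sd w"
    using std_abs_moment(2) sd_nonneg[of w] mult_left_le by blast
  finally show ?thesis .
qed simp

lemma integrable_inner_times:
  assumes [measurable]: "F \<in> borel_measurable borel" and "\<And>y. \<bar>F y\<bar> \<le> B"
  shows "integrable M (\<lambda>y. (w \<bullet> y) * F y)"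
proof (rule Bochner_Integration.integrable_bound)
  show "integrable M (\<lambda>y. B * (w \<bullet> y))" using integrable_inner by simp
  have "\<bar>(w \<bullet> y) * F y\<bar> \<le> \<bar>B * (w \<bullet> y)\<bar>" for y
    using mult_right_mono[OF order_trans[OF assms(2)[of y] abs_ge_self], of "\<bar>w \<bullet> y\<bar>"] by (simp add: abs_mult mult.commute)
  then show "AE y in M. norm ((w \<bullet> y) * F y) \<le> norm (B * (w \<bullet> y))" by simp
qed simp

lemma weighted_mean_bounded:
  assumes [measurable]: "F \<in> borel_measurable borel" and B: "\<And>y. \<bar>F y\<bar> \<le> B"
  shows "\<bar>LINT y|M. (w \<bullet> y) * F y\<bar> \<le> B * sd w"
proof -
  have "\<bar>LINT y|M. (w \<bullet> y) * F y\<bar> \<le> (LINT y|M. \<bar>(w \<bullet> y) * F y\<bar>)"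
    by (rule integral_abs_bound)
  also have "\<dots> \<le> (LINT y|M. B * \<bar>w \<bullet> y\<bar>)"
  proof (rule integral_mono)
    show "integrable M (\<lambda>y. \<bar>(w \<bullet> y) * F y\<bar>)"
      by (intro integrable_abs integrable_inner_times[OF assms])
    show "integrable M (\<lambda>y. B * \<bar>w \<bullet> y\<bar>)" using integrable_inner by simp
    show "\<bar>(w \<bullet> y) * F y\<bar> \<le> B * \<bar>w \<bullet> y\<bar>" for y
      using mult_right_mono[OF B[of y], of "\<bar>w \<bullet> y\<bar>"] by (simp add: abs_mult mult.commute)
  qed
  also have "\<dots> = B * (LINT y|M. \<bar>w \<bullet> y\<bar>)" by simp
  also have "\<dots> \<le> B * sd w"
    using abs_moment_le B[of 0] by (intro mult_left_mono) auto
  finally show ?thesis .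
qed

text \<open>Along the direction \<open>Q w\<close> the weight \<open>\<langle>w, y\<rangle>\<close> is \<open>sd w * r\<close> with \<open>r\<close> standard normal, hence has mean
zero for a fixed complementary part. Subtracting the value of \<open>F\<close> at \<open>r = 0\<close> therefore costs nothing
and brings in the Hoelder modulus at the distance \<open>\<bar>r\<bar> * norm (Q w) / sd w\<close>. The dimension of the space
does not appear, in contrast to a bound through moments of the norm.\<close>

lemma weighted_mean_holder:
  assumes [measurable]: "F \<in> borel_measurable borel" and B: "\<And>y. \<bar>F y\<bar> \<le> B"
    and holder: "\<And>x y. \<bar>F x - F y\<bar> \<le> K * norm (x - y) powr \<theta>" and \<theta>: "0 < \<theta>" "\<theta> < 1" and K: "K \<ge> 0"
  shows "\<bar>LINT y|M. (w \<bullet> y) * F y\<bar> \<le> 2 * K * sd w powr (1 - \<theta>) * norm (Q w) powr \<theta>"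
proof (cases "w = 0")
  case False
  define c where "c = sd w"
  have c: "c > 0" using sd_pos[OF False] by (simp add: c_def)
  let ?D = "K * c powr (1 - \<theta>) * norm (Q w) powr \<theta>"
  note ir = integral_regression[OF False integrable_inner_times[OF assms(1,2), of w]]
  have inner: "\<bar>LINT r|std. (w \<bullet> resample w (y, r)) * F (resample w (y, r))\<bar> \<le> 2 * ?D" for y
  proof -
    have [measurable]: "(\<lambda>r. resample w (y, r)) \<in> borel_measurable borel"
      unfolding resample_def by simp
    have i1: "integrable std (\<lambda>r. c * r * F (resample w (y, r)))"
    proof (rule Bochner_Integration.integrable_bound)
      show "integrable std (\<lambda>r. c * B * r)" using std_moments(1) by simp
      have "\<bar>c * r * F (resample w (y, r))\<bar> \<le> \<bar>c * B * r\<bar>" for r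
        using mult_left_mono[OF order_trans[OF B[of "resample w (y, r)"] abs_ge_self], of "\<bar>c * r\<bar>"]
        by (simp add: abs_mult mult_ac)
      then show "AE r in std. norm (c * r * F (resample w (y, r))) \<le> norm (c * B * r)" by simp
    qed simp
    have "\<bar>LINT r|std. (w \<bullet> resample w (y, r)) * F (resample w (y, r))\<bar>
        = \<bar>LINT r|std. c * r * F (resample w (y, r)) - c * F (resample w (y, 0)) * r\<bar>"
      using i1 std_moments(1,2) by (simp add: inner_resample[OF False] c_def)
    also have "\<dots> \<le> (LINT r|std. \<bar>c * r * F (resample w (y, r)) - c * F (resample w (y, 0)) * r\<bar>)"
      by (rule integral_abs_bound)
    also have "\<dots> \<le> (LINT r|std. ?D * (1 + r\<^sup>2))"
    proof (rule integral_mono)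
      have "integrable std (\<lambda>r. c * F (resample w (y, 0)) * r)"
        by (rule integrable_mult_right) (rule std_moments(1))
      then have "integrable std (\<lambda>r. c * r * F (resample w (y, r)) - c * F (resample w (y, 0)) * r)"
        by (rule Bochner_Integration.integrable_diff[OF i1])
      then show "integrable std (\<lambda>r. \<bar>c * r * F (resample w (y, r)) - c * F (resample w (y, 0)) * r\<bar>)"
        by (rule integrable_abs)
      show "integrable std (\<lambda>r. ?D * (1 + r\<^sup>2))" using std_moments(3) by simp
      fix r :: real
      have diff: "resample w (y, r) - resample w (y, 0) = (r / c) *\<^sub>R Q w"
        by (simp add: resample_def c_def)
      have "\<bar>c * r * F (resample w (y, r)) - c * F (resample w (y, 0)) * r\<bar>
          = c * \<bar>r\<bar> * \<bar>F (resample w (y, r)) - F (resample w (y, 0))\<bar>"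
        using c by (simp add: abs_mult[symmetric] algebra_simps) (simp add: abs_mult flip: right_diff_distrib)
      also have "\<dots> \<le> c * \<bar>r\<bar> * (K * norm ((r / c) *\<^sub>R Q w) powr \<theta>)"
        using holder[of "resample w (y, r)" "resample w (y, 0)"] c unfolding diff by (intro mult_left_mono) auto
      also have "norm ((r / c) *\<^sub>R Q w) powr \<theta> = \<bar>r\<bar> powr \<theta> * c powr (- \<theta>) * norm (Q w) powr \<theta>"
        using c by (simp add: powr_mult powr_divide powr_minus_divide)
      also have "c * \<bar>r\<bar> * (K * (\<bar>r\<bar> powr \<theta> * c powr (- \<theta>) * norm (Q w) powr \<theta>)) = ?D * (\<bar>r\<bar> * \<bar>r\<bar> powr \<theta>)"
        using c by (simp add: powr_diff powr_minus_divide)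
      also have "\<dots> \<le> ?D * (1 + r\<^sup>2)"
      proof (intro mult_left_mono)
        have "\<bar>r\<bar> powr \<theta> \<le> max 1 \<bar>r\<bar>"
        proof (cases "\<bar>r\<bar> \<le> 1")
          case True then show ?thesis using powr_le1[of \<theta> "\<bar>r\<bar>"] \<theta> by simp
        next
          case F: False then show ?thesis using powr_mono[of \<theta> 1 "\<bar>r\<bar>"] \<theta> by simp
        qed
        then have "\<bar>r\<bar> * \<bar>r\<bar> powr \<theta> \<le> \<bar>r\<bar> * max 1 \<bar>r\<bar>" by (intro mult_left_mono) auto
        also have "\<dots> \<le> 1 + r\<^sup>2"
        proof (cases "\<bar>r\<bar> \<le> 1")
          case True
          then have "\<bar>r\<bar> * max 1 \<bar>r\<bar> = \<bar>r\<bar>" by (simp add: max_absorb1)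
          then show ?thesis using True zero_le_power2[of r] by linarith
        next
          case F: False
          then show ?thesis by (simp add: max_def power2_eq_square)
        qed
        finally show "\<bar>r\<bar> * \<bar>r\<bar> powr \<theta> \<le> 1 + r\<^sup>2" .
      qed (use K in auto)
      finally show "\<bar>c * r * F (resample w (y, r)) - c * F (resample w (y, 0)) * r\<bar> \<le> ?D * (1 + r\<^sup>2)" .
    qed
    also have "\<dots> = 2 * ?D" using std_moments(3,4) std.prob_space by simp
    finally show ?thesis .
  qed
  have "\<bar>LINT y|M. (w \<bullet> y) * F y\<bar> \<le> (LINT y|M. \<bar>LINT r|std. (w \<bullet> resample w (y, r)) * F (resample w (y, r))\<bar>)"
    unfolding ir(1) by (rule integral_abs_bound)
  also have "\<dots> \<le> (LINT y|M. 2 * ?D)"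
    using ir(3) inner by (intro integral_mono) auto
  also have "\<dots> = 2 * K * sd w powr (1 - \<theta>) * norm (Q w) powr \<theta>"
    using prob_space by (simp add: c_def)
  finally show ?thesis .
qed simp

lemma shift_second_order:
  assumes [measurable]: "F \<in> borel_measurable borel" and B: "\<And>y. \<bar>F y\<bar> \<le> B" and \<tau>: "\<bar>\<tau>\<bar> * sd w \<le> 1"
  shows "\<bar>(LINT y|M. F (y + \<tau> *\<^sub>R Q w)) - (LINT y|M. F y) - \<tau> * (LINT y|M. (w \<bullet> y) * F y)\<bar> \<le> B * (\<tau> * sd w)\<^sup>2"
proof (cases "w = 0")
  case False
  define s where "s = \<tau> * sd w"
  have s: "\<bar>s\<bar> \<le> 1" using \<tau> sd_nonneg by (simp add: s_def abs_mult)
  have int: "integrable M G" if [measurable]: "G \<in> borel_measurable borel" and "\<And>y. \<bar>G y\<bar> \<le> B" for G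
    using that(2) by (intro integrable_const_bound[of _ B]) auto
  have i1: "integrable M (\<lambda>y. F (y + \<tau> *\<^sub>R Q w))" using B by (intro int) auto
  have i2: "integrable M F" using B by (intro int) auto
  have i3: "integrable M (\<lambda>y. (w \<bullet> y) * F y)" by (rule integrable_inner_times[OF assms(1,2)])
  note r1 = integral_regression[OF False i1] and r2 = integral_regression[OF False i2]
    and r3 = integral_regression[OF False i3]
  let ?g = "\<lambda>y r. F (resample w (y, r))"
  have e1: "(LINT r|std. F (resample w (y, r) + \<tau> *\<^sub>R Q w)) = (LINT r|std. ?g y (r + s))" for y
    by (simp add: resample_shift[OF False] s_def)
  have e3: "\<tau> * (LINT r|std. (w \<bullet> resample w (y, r)) * F (resample w (y, r))) = s * (LINT r|std. r * ?g y r)" for y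
    by (simp add: inner_resample[OF False] s_def mult.assoc)
  have eq: "(LINT y|M. F (y + \<tau> *\<^sub>R Q w)) - (LINT y|M. F y) - \<tau> * (LINT y|M. (w \<bullet> y) * F y)
    = (LINT y|M. (LINT r|std. ?g y (r + s)) - (LINT r|std. ?g y r) - s * (LINT r|std. r * ?g y r))"
  proof -
    have "(LINT y|M. F (y + \<tau> *\<^sub>R Q w)) - (LINT y|M. F y) - \<tau> * (LINT y|M. (w \<bullet> y) * F y)
      = (LINT y|M. (LINT r|std. F (resample w (y, r) + \<tau> *\<^sub>R Q w))) - (LINT y|M. (LINT r|std. ?g y r))
        - (LINT y|M. \<tau> * (LINT r|std. (w \<bullet> resample w (y, r)) * F (resample w (y, r))))"
      by (simp only: r1(1) r2(1) r3(1) integral_mult_right_zero)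
    also have "\<dots> = (LINT y|M. (LINT r|std. F (resample w (y, r) + \<tau> *\<^sub>R Q w)) - (LINT r|std. ?g y r)
        - \<tau> * (LINT r|std. (w \<bullet> resample w (y, r)) * F (resample w (y, r))))"
      using r1(3) r2(3) r3(3) by simp
    also have "\<dots> = (LINT y|M. (LINT r|std. ?g y (r + s)) - (LINT r|std. ?g y r) - s * (LINT r|std. r * ?g y r))"
      unfolding e1 e3 ..
    finally show ?thesis .
  qed
  have "\<bar>(LINT y|M. F (y + \<tau> *\<^sub>R Q w)) - (LINT y|M. F y) - \<tau> * (LINT y|M. (w \<bullet> y) * F y)\<bar> \<le> (LINT y|M. \<bar>(LINT r|std. ?g y (r + s)) - (LINT r|std. ?g y r) - s * (LINT r|std. r * ?g y r)\<bar>)"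
    unfolding eq by (rule integral_abs_bound)
  also have "\<dots> \<le> (LINT y|M. B * s\<^sup>2)"
  proof (rule integral_mono)
    show "integrable M (\<lambda>y. \<bar>(LINT r|std. ?g y (r + s)) - (LINT r|std. ?g y r) - s * (LINT r|std. r * ?g y r)\<bar>)"
    proof (intro integrable_abs Bochner_Integration.integrable_diff)
      show "integrable M (\<lambda>y. LINT r|std. ?g y (r + s))" using r1(3) unfolding e1 .
      show "integrable M (\<lambda>y. LINT r|std. ?g y r)" by (rule r2(3))
      show "integrable M (\<lambda>y. s * (LINT r|std. r * ?g y r))"
        using integrable_mult_right[OF r3(3), of \<tau>] unfolding e3 .
    qed
    show "\<bar>(LINT r|std. ?g y (r + s)) - (LINT r|std. ?g y r) - s * (LINT r|std. r * ?g y r)\<bar> \<le> B * s\<^sup>2" for y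
    proof (rule std_shift_second_order[OF _ _ s])
      have [measurable]: "(\<lambda>r. resample w (y, r)) \<in> borel_measurable borel"
        unfolding resample_def by simp
      show "?g y \<in> borel_measurable borel" by measurable
    qed (rule B)
  qed simp
  also have "\<dots> = B * (\<tau> * sd w)\<^sup>2" using prob_space by (simp add: s_def)
  finally show ?thesis .
qed simp

text \<open>The second-order estimate at \<open>0\<close>, applied to the translates of \<open>F\<close>, gives the derivative everywhere.\<close>

lemma mean_has_derivative:
  assumes [measurable]: "F \<in> borel_measurable borel" and B: "\<And>y. \<bar>F y\<bar> \<le> B"
  shows "((\<lambda>\<tau>. LINT y|M. F (y + \<tau> *\<^sub>R Q w)) has_real_derivative (LINT y|M. (w \<bullet> y) * F (y + \<tau>0 *\<^sub>R Q w))) (at \<tau>0)"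
proof -
  define d where "d = (LINT y|M. (w \<bullet> y) * F (y + \<tau>0 *\<^sub>R Q w))"
  define p where "p \<tau> = (LINT y|M. F (y + \<tau> *\<^sub>R Q w))" for \<tau>
  define C where "C = B * (sd w)\<^sup>2"
  have key: "\<bar>p (\<tau>0 + \<tau>) - p \<tau>0 - \<tau> * d\<bar> \<le> C * \<tau>\<^sup>2" if "\<bar>\<tau>\<bar> * sd w \<le> 1" for \<tau>
  proof -
    have 1: "y + \<tau> *\<^sub>R Q w + \<tau>0 *\<^sub>R Q w = y + (\<tau>0 + \<tau>) *\<^sub>R Q w" for y
      by (simp add: scaleR_add_left)
    have 2: "B * (\<tau> * sd w)\<^sup>2 = C * \<tau>\<^sup>2" by (simp add: C_def power_mult_distrib)
    show ?thesis
      using shift_second_order[of "\<lambda>y. F (y + \<tau>0 *\<^sub>R Q w)" B \<tau> w, OF _ B that]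
      unfolding p_def d_def 1 2 by simp
  qed
  have "((\<lambda>\<tau>. (p (\<tau>0 + \<tau>) - p \<tau>0) / \<tau> - d) \<longlongrightarrow> 0) (at 0)"
  proof (rule Lim_null_comparison)
    show "((\<lambda>\<tau>. C * \<bar>\<tau>\<bar>) \<longlongrightarrow> 0) (at 0)" by (auto intro!: tendsto_eq_intros)
    have "((\<lambda>\<tau>. \<bar>\<tau>\<bar> * sd w) \<longlongrightarrow> 0) (at 0)" by (auto intro!: tendsto_eq_intros)
    then have "\<forall>\<^sub>F \<tau> in at 0. \<bar>\<tau>\<bar> * sd w < 1" by (rule order_tendstoD) simp
    moreover have "\<forall>\<^sub>F \<tau> in at (0::real). \<tau> \<noteq> 0" by (simp add: eventually_at_filter)
    ultimately show "\<forall>\<^sub>F \<tau> in at 0. norm ((p (\<tau>0 + \<tau>) - p \<tau>0) / \<tau> - d) \<le> C * \<bar>\<tau>\<bar>"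
    proof eventually_elim
      case (elim \<tau>)
      have "(p (\<tau>0 + \<tau>) - p \<tau>0) / \<tau> - d = (p (\<tau>0 + \<tau>) - p \<tau>0 - \<tau> * d) / \<tau>"
        using elim by (simp add: field_simps)
      then show ?case
        using key[of \<tau>] elim by (simp add: divide_le_eq power2_eq_square abs_mult_self_eq mult.assoc)
    qed
  qed
  then show ?thesis
    unfolding DERIV_def p_def[symmetric] d_def[symmetric] by (simp add: LIM_zero_iff)
qed

end

section \<open>Spectral multipliers of the Ornstein--Uhlenbeck semigroup\<close>

text \<open>With \<open>x = t * a\<close> these come from \<open>exp (2 * x) - 1 \<ge> 2 * x\<close> and \<open>exp (2 * x) - 1 \<ge> 2 * x\<^sup>2\<close>. The second and
the third inequality control the variances \<open>\<langle>Q\<^sub>t w, w\<rangle>\<close> for the representing vectors \<open>w\<close> of \<open>D P\<^sub>t f\<close> and \<open>(-A)\<^bsup>1/2\<^esup> D P\<^sub>t f\<close>. The last one is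
for the existence of these vectors in the space.\<close>

lemma whiten_multiplier_bounds:
  fixes a t :: real
  assumes "a > 0" "t > 0"
  defines "q \<equiv> (1 - exp (- 2 * t * a)) / (2 * a)"
  shows "0 < q" "exp (- t * a) * (exp (- t * a) / q) \<le> 1 / t"
    "sqrt a * exp (- t * a) * (sqrt a * exp (- t * a) / q) \<le> (1 / t)\<^sup>2"
    "exp (- t * a) / q \<le> (1 + 2 * t * a) * exp (- t * a) / t"
proof -
  define x where "x = t * a"
  have x: "x > 0" using assms by (simp add: x_def)
  have E: "exp (2 * x) \<ge> 1 + 2 * x + 2 * x\<^sup>2"
    using exp_lower_Taylor_quadratic[of "2 * x"] x by (simp add: power2_eq_square)
  have E1: "exp (2 * x) > 1 + 2 * x" using E x by (smt (verit) zero_less_power2)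
  have ee: "exp (- t * a) = exp (- x)" "exp (- 2 * t * a) = exp (- 2 * x)" by (simp_all add: x_def mult.assoc)
  have sq: "exp (- x) * exp (- x) = exp (- 2 * x)" by (simp add: exp_add[symmetric])
  have inv: "exp (- 2 * x) = 1 / exp (2 * x)" by (simp add: exp_minus divide_inverse)
  have "exp (- 2 * x) < 1" using x by simp
  then show q: "0 < q" using assms by (simp add: q_def ee)
  have eq: "exp (- 2 * x) / q = 2 * a / (exp (2 * x) - 1)"
    using q E1 x assms(1) unfolding q_def ee inv by (simp add: field_simps)
  have "2 * a / (exp (2 * x) - 1) \<le> 2 * a / (2 * x)"
    using E1 x assms(1) by (intro divide_left_mono) (auto intro!: mult_pos_pos)
  also have "\<dots> = 1 / t" using assms by (simp add: x_def)
  finally show "exp (- t * a) * (exp (- t * a) / q) \<le> 1 / t"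
    unfolding ee times_divide_eq_right sq eq .
  have "a * (2 * a / (exp (2 * x) - 1)) \<le> a * (2 * a / (2 * x\<^sup>2))"
    using E E1 x assms(1) by (intro mult_left_mono divide_left_mono) (auto intro!: mult_pos_pos)
  also have "\<dots> = (1 / t)\<^sup>2" using assms by (simp add: x_def power2_eq_square)
  finally have "a * (exp (- 2 * x) / q) \<le> (1 / t)\<^sup>2" unfolding eq .
  moreover have "sqrt a * exp (- t * a) * (sqrt a * exp (- t * a) / q) = (sqrt a * sqrt a) * ((exp (- x) * exp (- x)) / q)"
    unfolding ee by (simp only: times_divide_eq_right mult_ac)
  moreover have "sqrt a * sqrt a = a" using assms(1) by simp
  ultimately show "sqrt a * exp (- t * a) * (sqrt a * exp (- t * a) / q) \<le> (1 / t)\<^sup>2"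
    by (simp only: sq)
  have "1 / q = 2 * a * exp (2 * x) / (exp (2 * x) - 1)"
    using q E1 x assms(1) unfolding q_def ee inv by (simp add: field_simps)
  also have "\<dots> \<le> (1 + 2 * x) / t"
  proof -
    have "2 * x * exp (2 * x) \<le> (1 + 2 * x) * (exp (2 * x) - 1)"
      using E1 by (simp add: algebra_simps)
    then have "t * (2 * a * exp (2 * x)) \<le> (1 + 2 * x) * (exp (2 * x) - 1)"
      by (simp add: x_def mult_ac)
    then show ?thesis using E1 x assms(2) by (simp add: field_simps)
  qed
  finally have "exp (- x) * (1 / q) \<le> exp (- x) * ((1 + 2 * x) / t)"
    by (intro mult_left_mono) auto
  then show "exp (- t * a) / q \<le> (1 + 2 * t * a) * exp (- t * a) / t"
    unfolding ee by (simp add: x_def mult_ac)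
qed

lemma polynomial_exp_le: "(1 + 2 * x) * (1 + x) * exp (- x) \<le> 4" if "x \<ge> 0" for x :: real
proof -
  have "1 + x + x\<^sup>2 / 2 \<le> exp x" using exp_lower_Taylor_quadratic[OF that] .
  then have "(1 + 2 * x) * (1 + x) \<le> 4 * exp x" using that by (simp add: algebra_simps power2_eq_square)
  then have "(1 + 2 * x) * (1 + x) * exp (- x) \<le> 4 * exp x * exp (- x)" by (intro mult_right_mono) auto
  also have "4 * exp x * exp (- x) = 4" using exp_minus_inverse[of x] by simp
  finally show ?thesis .
qed

lemma sqrt_exp_le:
  assumes "a > 0" "t > 0" shows "sqrt a * exp (- t * a) \<le> t powr (- 1 / 2)"
proof -
  define x where "x = t * a"
  have x: "x > 0" using assms by (simp add: x_def)
  have "sqrt x \<le> 1 + x"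
    using x by (intro real_le_lsqrt) (auto simp: power2_eq_square algebra_simps)
  also have "\<dots> \<le> exp x" by (rule exp_ge_add_one_self)
  finally have "sqrt x \<le> exp x" .
  then have "sqrt t * (sqrt a * exp (- t * a)) \<le> 1"
    by (simp add: x_def real_sqrt_mult exp_minus field_simps)
  then have "sqrt a * exp (- t * a) \<le> 1 / sqrt t" using assms by (simp add: field_simps)
  also have "1 / sqrt t = t powr (- 1 / 2)"
    using assms by (simp add: powr_half_sqrt[symmetric] powr_minus_divide)
  finally show ?thesis .
qed

text \<open>Bound and Hoelder constant are kept as parameters because all estimates are linear in them, and because
the semigroup preserves the class for fixed parameters.\<close>

definition holder_bounded :: "real \<Rightarrow> real \<Rightarrow> real \<Rightarrow> ('a::real_normed_vector \<Rightarrow> real) \<Rightarrow> bool" where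
  "holder_bounded \<theta> B K f \<longleftrightarrow> 0 \<le> K \<and> (\<forall>x. \<bar>f x\<bar> \<le> B) \<and>
     (\<forall>x y. \<bar>f x - f y\<bar> \<le> K * norm (x - y) powr \<theta>)"

lemma holder_boundedD:
  assumes "holder_bounded \<theta> B K f"
  shows "0 \<le> K" "\<bar>f x\<bar> \<le> B" "\<bar>f x - f y\<bar> \<le> K * norm (x - y) powr \<theta>"
  using assms by (auto simp: holder_bounded_def)

lemma holder_tendsto:
  assumes "0 < \<theta>" and le: "\<And>y. norm (g y - g x) \<le> K * norm (y - x) powr \<theta>"
  shows "(g \<longlongrightarrow> g x) (at x)"
proof (rule Lim_transform_bound[where g = "\<lambda>y. K * norm (y - x) powr \<theta>" and f = "\<lambda>y. g y - g x", THEN LIM_zero_cancel])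
  show "\<forall>\<^sub>F y in at x. norm (g y - g x) \<le> norm (K * norm (y - x) powr \<theta>)"
    using le by (intro always_eventually allI) (smt (verit) real_norm_def)
  have "((\<lambda>y. norm (y - x)) \<longlongrightarrow> norm (x - x)) (at x)" by (intro tendsto_intros)
  then have "((\<lambda>y. norm (y - x) powr \<theta>) \<longlongrightarrow> 0 powr \<theta>) (at x)"
    by (intro tendsto_powr2[OF _ tendsto_const]) (simp_all add: assms(1))
  then show "((\<lambda>y. K * norm (y - x) powr \<theta>) \<longlongrightarrow> 0) (at x)"
    by (intro tendsto_mult_right_zero) simp
qed

lemma holder_bounded_continuous:
  assumes "0 < \<theta>" "holder_bounded \<theta> B K f"
  shows "continuous_on UNIV f"
  unfolding continuous_on_eq_continuous_at[OF open_UNIV] continuous_at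
proof (intro ballI)
  show "(f \<longlongrightarrow> f x) (at x)" for x
    by (rule holder_tendsto[OF assms(1)]) (use holder_boundedD(3)[OF assms(2)] in simp)
qed

lemma holder_bounded_measurable:
  assumes "0 < \<theta>" "holder_bounded \<theta> B K f"
  shows "f \<in> borel_measurable borel"
  using holder_bounded_continuous[OF assms] by (rule borel_measurable_continuous_onI)

text \<open>The setting in spectral form. The drift \<open>z\<close> enters only through the translation \<open>shift t\<close>, which leaves
suprema and Hoelder constants unchanged; hence all bounds are uniform in \<open>z\<close>.\<close>

locale ornstein_uhlenbeck = orthonormal_basis e
  for e :: "nat \<Rightarrow> 'a::{real_inner,banach,second_countable_topology}" +
  fixes l :: "nat \<Rightarrow> real" and N :: "real \<Rightarrow> 'a measure" and z :: 'a and \<theta> :: real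
  assumes l_pos: "l k > 0" and l_summable: "summable (\<lambda>k. inverse (l k))"
    and gaussian: "t \<ge> 0 \<Longrightarrow> centered_gaussian (N t) (diag (\<lambda>k. (1 - exp (- 2 * t * l k)) / (2 * l k)))"
    and \<theta>: "0 < \<theta>" "\<theta> < 1"
begin

definition qvar :: "real \<Rightarrow> nat \<Rightarrow> real" where "qvar t k = (1 - exp (- 2 * t * l k)) / (2 * l k)"
definition semi :: "real \<Rightarrow> 'a \<Rightarrow> 'a" where "semi t = diag (\<lambda>k. exp (- t * l k))"
definition cov :: "real \<Rightarrow> 'a \<Rightarrow> 'a" where "cov t = diag (qvar t)"
definition inv_sqrt :: "'a \<Rightarrow> 'a" where "inv_sqrt = diag (\<lambda>k. 1 / sqrt (l k))"
definition shift :: "real \<Rightarrow> 'a" where "shift t = inv_sqrt (z - semi t z)"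
text \<open>\<open>Q\<^sub>t\<^bsup>-1\<^esup> e\<^sup>t\<^sup>A\<close>: the vector whose Gaussian linear functional represents the derivative of \<open>P\<^sub>t f\<close> in a
direction. It is a bounded operator although \<open>Q\<^sub>t\<close> is not invertible on the whole space.\<close>

definition whiten :: "real \<Rightarrow> 'a \<Rightarrow> 'a" where "whiten t = diag (\<lambda>k. exp (- t * l k) / qvar t k)"
text \<open>The same with \<open>(-A)\<^bsup>1/2\<^esup>\<close> applied first, \<open>Q\<^sub>t\<^bsup>-1\<^esup> e\<^sup>t\<^sup>A (-A)\<^bsup>1/2\<^esup>\<close>; it extends to the whole space.\<close>

definition whiten_sqrt :: "real \<Rightarrow> 'a \<Rightarrow> 'a" where "whiten_sqrt t = diag (\<lambda>k. sqrt (l k) * exp (- t * l k) / qvar t k)"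

definition inv_l_sum :: real where "inv_l_sum = (\<Sum>k. inverse (l k))"

lemma inverse_l_le: "inverse (l k) \<le> inv_l_sum"
  using sum_le_suminf[OF l_summable, of "{k}"] l_pos by (simp add: inv_l_sum_def less_imp_le)

lemma inv_l_sum_nonneg: "0 \<le> inv_l_sum"
  by (rule order_trans[OF _ inverse_l_le[of 0]]) (use l_pos[of 0] in simp)

lemma semi_multiplier: "t \<ge> 0 \<Longrightarrow> \<bar>exp (- t * l k)\<bar> \<le> 1"
  using l_pos[of k] by simp

lemma qvar_nonneg: "t \<ge> 0 \<Longrightarrow> 0 \<le> qvar t k"
  using l_pos[of k] by (simp add: qvar_def)

lemma qvar_le: "t \<ge> 0 \<Longrightarrow> qvar t k \<le> inverse (l k) / 2"
  using divide_right_mono[of "1 - exp (- 2 * t * l k)" 1 "2 * l k"] l_pos[of k]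
  by (simp add: qvar_def inverse_eq_divide)

lemma qvar_pos: "t > 0 \<Longrightarrow> 0 < qvar t k"
  unfolding qvar_def using whiten_multiplier_bounds(1)[OF l_pos] .

lemma qvar_multiplier: "t \<ge> 0 \<Longrightarrow> \<bar>qvar t k\<bar> \<le> inv_l_sum"
  using qvar_nonneg[of t k] qvar_le[of t k] inverse_l_le[of k] inv_l_sum_nonneg by linarith

lemma inv_sqrt_multiplier: "\<bar>1 / sqrt (l k)\<bar> \<le> sqrt inv_l_sum"
proof -
  have "\<bar>1 / sqrt (l k)\<bar> = sqrt (inverse (l k))"
    using l_pos[of k] by (simp add: real_sqrt_divide inverse_eq_divide)
  then show ?thesis using inverse_l_le by simp
qed

lemma whiten_multiplier:
  assumes t: "t > 0" shows "\<bar>exp (- t * l k) / qvar t k\<bar> \<le> 4 / t"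
proof -
  have x: "t * l k > 0" using t l_pos[of k] by simp
  have "exp (- t * l k) / qvar t k \<le> (1 + 2 * t * l k) * exp (- t * l k) / t"
    using whiten_multiplier_bounds(4)[OF l_pos t] by (simp add: qvar_def)
  also have "\<dots> \<le> 4 / t"
  proof (intro divide_right_mono)
    have "(1 + 2 * (t * l k)) * 1 * exp (- (t * l k)) \<le> (1 + 2 * (t * l k)) * (1 + t * l k) * exp (- (t * l k))"
      using x by (intro mult_right_mono mult_left_mono) auto
    also have "\<dots> \<le> 4" by (rule polynomial_exp_le) (use x in simp)
    finally show "(1 + 2 * t * l k) * exp (- t * l k) \<le> 4" by (simp add: mult.assoc)
  qed (use t in auto)
  finally show ?thesis using qvar_pos[OF t, of k] by simp
qed

lemma whiten_sqrt_multiplier: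
  assumes t: "t > 0" shows "\<bar>sqrt (l k) * exp (- t * l k) / qvar t k\<bar> \<le> 4 / (t * sqrt t)"
proof -
  define x where "x = t * l k"
  have x: "x > 0" using t l_pos[of k] by (simp add: x_def)
  have "sqrt (l k) = sqrt x / sqrt t" using t by (simp add: x_def real_sqrt_mult)
  also have "\<dots> \<le> (1 + x) / sqrt t"
    using x t by (intro divide_right_mono real_le_lsqrt) (auto simp: power2_eq_square algebra_simps)
  finally have s: "sqrt (l k) \<le> (1 + x) / sqrt t" .
  have "exp (- t * l k) / qvar t k \<le> (1 + 2 * x) * exp (- x) / t"
    using whiten_multiplier_bounds(4)[OF l_pos t, of k] by (simp add: qvar_def x_def mult.assoc)
  then have "sqrt (l k) * (exp (- t * l k) / qvar t k) \<le> (1 + x) / sqrt t * ((1 + 2 * x) * exp (- x) / t)"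
    using s x t qvar_pos[OF t, of k] l_pos[of k] by (intro mult_mono) auto
  also have "\<dots> = ((1 + 2 * x) * (1 + x) * exp (- x)) / (t * sqrt t)" by (simp only: times_divide_eq_right times_divide_eq_left divide_divide_eq_left mult_ac)
  also have "\<dots> \<le> 4 / (t * sqrt t)"
    using polynomial_exp_le[of x] x t by (intro divide_right_mono) auto
  finally show ?thesis using qvar_pos[OF t, of k] l_pos[of k] by simp
qed

lemma semi_coord: assumes t: "t \<ge> 0" shows "semi t x \<bullet> e k = exp (- t * l k) * (x \<bullet> e k)"
  unfolding semi_def by (rule diag_coord) (rule semi_multiplier[OF t])

lemma bounded_linear_semi: assumes t: "t \<ge> 0" shows "bounded_linear (semi t)"
  unfolding semi_def by (rule bounded_linear_diag) (rule semi_multiplier[OF t])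

lemma cov_coord: assumes t: "t \<ge> 0" shows "cov t x \<bullet> e k = qvar t k * (x \<bullet> e k)"
  unfolding cov_def by (rule diag_coord) (rule qvar_multiplier[OF t])

lemma bounded_linear_cov: assumes t: "t \<ge> 0" shows "bounded_linear (cov t)"
  unfolding cov_def by (rule bounded_linear_diag) (rule qvar_multiplier[OF t])

lemma inv_sqrt_coord: "inv_sqrt x \<bullet> e k = (1 / sqrt (l k)) * (x \<bullet> e k)"
  unfolding inv_sqrt_def by (rule diag_coord) (rule inv_sqrt_multiplier)

lemma bounded_linear_inv_sqrt: "bounded_linear inv_sqrt"
  unfolding inv_sqrt_def by (rule bounded_linear_diag) (rule inv_sqrt_multiplier)

lemma whiten_coord: assumes t: "t > 0" shows "whiten t x \<bullet> e k = (exp (- t * l k) / qvar t k) * (x \<bullet> e k)"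
  unfolding whiten_def by (rule diag_coord) (rule whiten_multiplier[OF t])

lemma whiten_sqrt_coord: assumes t: "t > 0" shows "whiten_sqrt t x \<bullet> e k = (sqrt (l k) * exp (- t * l k) / qvar t k) * (x \<bullet> e k)"
  unfolding whiten_sqrt_def by (rule diag_coord) (rule whiten_sqrt_multiplier[OF t])

lemma bounded_linear_whiten_sqrt: assumes t: "t > 0" shows "bounded_linear (whiten_sqrt t)"
  unfolding whiten_sqrt_def by (rule bounded_linear_diag) (rule whiten_sqrt_multiplier[OF t])

lemma norm_semi_le: "t \<ge> 0 \<Longrightarrow> norm (semi t x) \<le> norm x"
  unfolding semi_def using norm_diag_le[of "\<lambda>k. exp (- t * l k)" 1 x] semi_multiplier by simp

lemma norm_inv_sqrt_le: "norm (inv_sqrt x) \<le> sqrt inv_l_sum * norm x"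
  unfolding inv_sqrt_def using inv_sqrt_multiplier by (rule norm_diag_le)

lemma semi_add: "t \<ge> 0 \<Longrightarrow> s \<ge> 0 \<Longrightarrow> semi (t + s) x = semi t (semi s x)"
proof (rule coord_eqI)
  fix k assume "t \<ge> 0" "s \<ge> 0"
  moreover have "exp (- (t + s) * l k) = exp (- t * l k) * exp (- s * l k)"
    by (simp add: exp_add[symmetric] algebra_simps)
  ultimately show "semi (t + s) x \<bullet> e k = semi t (semi s x) \<bullet> e k"
    by (simp only: semi_coord add_nonneg_nonneg mult.assoc)
qed

lemma semi_diff: "t \<ge> 0 \<Longrightarrow> semi t x - semi t y = semi t (x - y)"
  using linear_diff[OF bounded_linear.linear[OF bounded_linear_semi]] by simp

lemma inv_sqrt_semi: "t \<ge> 0 \<Longrightarrow> inv_sqrt (semi t x) = semi t (inv_sqrt x)"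
  by (rule coord_eqI) (simp add: semi_coord inv_sqrt_coord)

text \<open>The cocycle identity that makes the shifted operators \<open>P\<^sub>t\<close> a semigroup.\<close>

lemma shift_add:
  assumes "t \<ge> 0" "s \<ge> 0" shows "shift (t + s) = semi t (shift s) + shift t"
proof -
  interpret semi: bounded_linear "semi t" using assms(1) by (rule bounded_linear_semi)
  interpret inv_sqrt: bounded_linear inv_sqrt by (rule bounded_linear_inv_sqrt)
  have "semi t (shift s) = inv_sqrt (semi t z - semi (t + s) z)"
    using assms by (simp add: shift_def inv_sqrt_semi[symmetric] semi.diff semi_add)
  then show ?thesis by (simp add: shift_def inv_sqrt.add[symmetric])
qed

lemma inv_sqrt_symmetric: "inv_sqrt x \<bullet> y = x \<bullet> inv_sqrt y"
proof (rule sums_unique2[OF parseval_inner])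
  show "(\<lambda>k. (inv_sqrt x \<bullet> e k) * (y \<bullet> e k)) sums (x \<bullet> inv_sqrt y)"
    using parseval_inner[of x "inv_sqrt y"] by (simp add: inv_sqrt_coord)
qed

lemma whiten_sqrt_inv_sqrt: "t > 0 \<Longrightarrow> whiten_sqrt t (inv_sqrt h) = whiten t h"
  by (rule coord_eqI) (simp add: whiten_sqrt_coord whiten_coord inv_sqrt_coord l_pos[THEN less_imp_neq, THEN not_sym])

lemma cov_whiten: "t > 0 \<Longrightarrow> cov t (whiten t h) = semi t h"
  by (rule coord_eqI) (simp add: cov_coord whiten_coord semi_coord qvar_pos[THEN less_imp_neq, THEN not_sym])

lemma gaussian_cov: "t \<ge> 0 \<Longrightarrow> centered_gaussian (N t) (cov t)"
  using gaussian by (simp add: cov_def qvar_def[abs_def])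

lemma cov_symmetric: "t \<ge> 0 \<Longrightarrow> cov t x \<bullet> y = x \<bullet> cov t y"
proof (rule sums_unique2[OF parseval_inner])
  assume t: "t \<ge> 0"
  show "(\<lambda>k. (cov t x \<bullet> e k) * (y \<bullet> e k)) sums (x \<bullet> cov t y)"
    using parseval_inner[of x "cov t y"] by (simp add: cov_coord[OF t] mult_ac)
qed

lemma cov_pos:
  assumes t: "t > 0" and "x \<noteq> 0" shows "cov t x \<bullet> x > 0"
proof -
  have s: "(\<lambda>k. qvar t k * (x \<bullet> e k)\<^sup>2) sums (cov t x \<bullet> x)"
    using parseval_inner[of "cov t x" x] t by (simp add: cov_coord power2_eq_square mult.assoc)
  obtain j where j: "x \<bullet> e j \<noteq> 0" using coord_zero_imp_zero \<open>x \<noteq> 0\<close> by blast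
  have "0 < qvar t j * (x \<bullet> e j)\<^sup>2" using qvar_pos[OF t] j by simp
  also have "\<dots> \<le> cov t x \<bullet> x"
    using sum_le_suminf[OF sums_summable[OF s], of "{j}"] sums_unique[OF s] qvar_nonneg t by simp
  finally show ?thesis .
qed

lemma nondegenerate: "t > 0 \<Longrightarrow> nondegenerate_gaussian e (N t) (cov t)"
  by (intro nondegenerate_gaussian.intro orthonormal_basis_axioms nondegenerate_gaussian_axioms.intro
      gaussian_cov bounded_linear_cov cov_symmetric cov_pos) auto

lemma inner_diag_le:
  assumes "\<And>k. v \<bullet> e k = a k * (h \<bullet> e k)" "\<And>k. w \<bullet> e k = b k * (h \<bullet> e k)" "\<And>k. a k * b k \<le> C"
  shows "v \<bullet> w \<le> C * (norm h)\<^sup>2"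
proof (rule sums_le[OF _ parseval_inner sums_mult[OF parseval]])
  show "(v \<bullet> e k) * (w \<bullet> e k) \<le> C * (h \<bullet> e k)\<^sup>2" for k
    using mult_right_mono[OF assms(3), of "(h \<bullet> e k)\<^sup>2" k] by (simp add: assms(1,2) power2_eq_square mult_ac)
qed

lemma sd_whiten_le:
  assumes t: "t > 0" shows "nondegenerate_gaussian.sd (cov t) (whiten t h) \<le> t powr (- 1 / 2) * norm h"
proof -
  interpret nondegenerate_gaussian e "N t" "cov t" using t by (rule nondegenerate)
  have "semi t h \<bullet> whiten t h \<le> 1 / t * (norm h)\<^sup>2"
  proof (rule inner_diag_le)
    show "semi t h \<bullet> e k = exp (- t * l k) * (h \<bullet> e k)" for k
      using t by (intro semi_coord) simp
    show "whiten t h \<bullet> e k = exp (- t * l k) / qvar t k * (h \<bullet> e k)" for k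
      by (rule whiten_coord[OF t])
    show "exp (- t * l k) * (exp (- t * l k) / qvar t k) \<le> 1 / t" for k
      unfolding qvar_def by (rule whiten_multiplier_bounds(2)[OF l_pos t])
  qed
  then have "(sd (whiten t h))\<^sup>2 \<le> 1 / t * (norm h)\<^sup>2" by (simp only: sd_square cov_whiten[OF t])
  also have "1 / t = (t powr (- 1 / 2))\<^sup>2"
    using t by (simp add: powr_minus_divide powr_half_sqrt power_divide)
  also have "(t powr (- 1 / 2))\<^sup>2 * (norm h)\<^sup>2 = (t powr (- 1 / 2) * norm h)\<^sup>2" by (simp add: power_mult_distrib)
  finally show ?thesis by (rule power2_le_imp_le) simp
qed

lemma cov_whiten_sqrt_coord: "t > 0 \<Longrightarrow> cov t (whiten_sqrt t h) \<bullet> e k = sqrt (l k) * exp (- t * l k) * (h \<bullet> e k)"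
  using qvar_pos[of t k] by (simp add: cov_coord whiten_sqrt_coord)

lemma norm_cov_whiten_sqrt_le:
  assumes t: "t > 0" shows "norm (cov t (whiten_sqrt t h)) \<le> t powr (- 1 / 2) * norm h"
proof (rule norm_le_coord)
  show "\<bar>cov t (whiten_sqrt t h) \<bullet> e k\<bar> \<le> t powr (- 1 / 2) * \<bar>h \<bullet> e k\<bar>" for k
    using mult_right_mono[OF sqrt_exp_le[OF l_pos t, of k], of "\<bar>h \<bullet> e k\<bar>"] l_pos[of k]
    by (simp add: cov_whiten_sqrt_coord[OF t] abs_mult)
qed simp

lemma sd_whiten_sqrt_le:
  assumes t: "t > 0" shows "nondegenerate_gaussian.sd (cov t) (whiten_sqrt t h) \<le> 1 / t * norm h"
proof -
  interpret nondegenerate_gaussian e "N t" "cov t" using t by (rule nondegenerate)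
  have "cov t (whiten_sqrt t h) \<bullet> whiten_sqrt t h \<le> (1 / t)\<^sup>2 * (norm h)\<^sup>2"
  proof (rule inner_diag_le)
    show "cov t (whiten_sqrt t h) \<bullet> e k = sqrt (l k) * exp (- t * l k) * (h \<bullet> e k)" for k
      by (rule cov_whiten_sqrt_coord[OF t])
    show "whiten_sqrt t h \<bullet> e k = sqrt (l k) * exp (- t * l k) / qvar t k * (h \<bullet> e k)" for k
      by (rule whiten_sqrt_coord[OF t])
    show "sqrt (l k) * exp (- t * l k) * (sqrt (l k) * exp (- t * l k) / qvar t k) \<le> (1 / t)\<^sup>2" for k
      unfolding qvar_def by (rule whiten_multiplier_bounds(3)[OF l_pos t])
  qed
  then have "(sd (whiten_sqrt t h))\<^sup>2 \<le> (1 / t * norm h)\<^sup>2" by (simp only: sd_square power_mult_distrib)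
  then show ?thesis by (rule power2_le_imp_le) (use t in simp)
qed

end

section \<open>Smoothing by the Ornstein--Uhlenbeck semigroup\<close>

context ornstein_uhlenbeck
begin

lemma prob_N: "t \<ge> 0 \<Longrightarrow> prob_space (N t)"
  using gaussian_cov by (simp add: centered_gaussian_def)

lemma sets_N: "t \<ge> 0 \<Longrightarrow> sets (N t) = sets borel"
  using gaussian_cov by (simp add: centered_gaussian_def)

lemma charf_N: "t \<ge> 0 \<Longrightarrow> (CLINT y|N t. iexp (h \<bullet> y)) = complex_of_real (exp (- (cov t h \<bullet> h) / 2))"
  using gaussian_cov by (simp add: centered_gaussian_def)

lemma integrable_N:
  assumes "t \<ge> 0" "g \<in> borel_measurable borel" "\<And>y. \<bar>g y :: real\<bar> \<le> C"
  shows "integrable (N t) g"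
proof -
  interpret prob_space "N t" using assms(1) by (rule prob_N)
  have [measurable_cong]: "sets (N t) = sets borel" using assms(1) by (rule sets_N)
  show ?thesis using assms(2,3) by (intro integrable_const_bound[of _ C]) auto
qed

lemma mean_N_le:
  assumes t: "t \<ge> 0" and g: "g \<in> borel_measurable borel" "\<And>y. \<bar>g y :: real\<bar> \<le> C"
  shows "\<bar>LINT y|N t. g y\<bar> \<le> C"
proof -
  interpret prob_space "N t" using t by (rule prob_N)
  have "\<bar>LINT y|N t. g y\<bar> \<le> (LINT y|N t. \<bar>g y\<bar>)" by (rule integral_abs_bound)
  also have "\<dots> \<le> (LINT y|N t. C)"
    using integrable_N[OF t g] g(2) by (intro integral_mono) auto
  finally show ?thesis using prob_space by simp
qed

definition ou :: "real \<Rightarrow> ('a \<Rightarrow> real) \<Rightarrow> 'a \<Rightarrow> real" where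
  "ou t f x = (LINT y|N t. f (semi t x + y + shift t))"

text \<open>For \<open>w = whiten t h\<close> this is the derivative of \<open>ou t f\<close> at \<open>x\<close> in the direction \<open>h\<close>; for
\<open>w = whiten_sqrt t k\<close> it is the pairing of \<open>(-A)\<^bsup>1/2\<^esup> D P\<^sub>t f(x)\<close> with \<open>k\<close>.\<close>

definition ou_deriv :: "real \<Rightarrow> ('a \<Rightarrow> real) \<Rightarrow> 'a \<Rightarrow> 'a \<Rightarrow> real" where
  "ou_deriv t f x w = (LINT y|N t. (w \<bullet> y) * f (semi t x + y + shift t))"

abbreviation holder_fun :: "real \<Rightarrow> real \<Rightarrow> ('a \<Rightarrow> real) \<Rightarrow> bool" where "holder_fun \<equiv> holder_bounded \<theta>"

lemma holder_fun_meas: "holder_fun B K f \<Longrightarrow> f \<in> borel_measurable borel"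
  using holder_bounded_measurable[OF \<theta>(1)] .

lemma holder_fun_shift_meas: "holder_fun B K f \<Longrightarrow> (\<lambda>y. f (a + y + b)) \<in> borel_measurable borel"
  using holder_fun_meas by measurable

lemma ou_holder_fun:
  assumes t: "t \<ge> 0" and f: "holder_fun B K f"
  shows "holder_fun B K (ou t f)"
  unfolding holder_bounded_def
proof (intro conjI allI)
  note fD = holder_boundedD[OF f]
  show "0 \<le> K" by (rule fD)
  show "\<bar>ou t f x\<bar> \<le> B" for x
    unfolding ou_def using holder_fun_shift_meas[OF f] fD(2) by (intro mean_N_le[OF t])
  fix x x'
  have "ou t f x - ou t f x' = (LINT y|N t. f (semi t x + y + shift t) - f (semi t x' + y + shift t))"
    unfolding ou_def using holder_fun_shift_meas[OF f] fD(2)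
    by (intro Bochner_Integration.integral_diff[symmetric] integrable_N[OF t])
  moreover have "\<bar>LINT y|N t. f (semi t x + y + shift t) - f (semi t x' + y + shift t)\<bar> \<le> K * norm (x - x') powr \<theta>"
  proof (rule mean_N_le[OF t])
    show "(\<lambda>y. f (semi t x + y + shift t) - f (semi t x' + y + shift t)) \<in> borel_measurable borel"
      using holder_fun_shift_meas[OF f] by measurable
    fix y
    have "\<bar>f (semi t x + y + shift t) - f (semi t x' + y + shift t)\<bar> \<le> K * norm (semi t x - semi t x') powr \<theta>"
      using fD(3)[of "semi t x + y + shift t" "semi t x' + y + shift t"] by simp
    also have "\<dots> \<le> K * norm (x - x') powr \<theta>"
      using norm_semi_le[OF t, of "x - x'"] fD(1) \<theta> unfolding semi_diff[OF t]
      by (intro mult_left_mono powr_mono2) auto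
    finally show "\<bar>f (semi t x + y + shift t) - f (semi t x' + y + shift t)\<bar> \<le> K * norm (x - x') powr \<theta>" .
  qed
  ultimately show "\<bar>ou t f x - ou t f x'\<bar> \<le> K * norm (x - x') powr \<theta>" by simp
qed

lemma ou_has_derivative:
  assumes t: "t > 0" and f: "holder_fun B K f"
  shows "((\<lambda>\<tau>. ou t f (x + \<tau> *\<^sub>R h)) has_real_derivative ou_deriv t f (x + \<tau>0 *\<^sub>R h) (whiten t h)) (at \<tau>0)"
proof -
  interpret nondegenerate_gaussian e "N t" "cov t" using t by (rule nondegenerate)
  interpret semi: bounded_linear "semi t" using t by (intro bounded_linear_semi) simp
  have eq: "semi t (x + \<tau> *\<^sub>R h) + y + shift t = semi t x + (y + \<tau> *\<^sub>R cov t (whiten t h)) + shift t" for \<tau> y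
    using t by (simp add: cov_whiten semi.add semi.scaleR add_ac)
  show ?thesis
    unfolding ou_def ou_deriv_def eq
    by (rule mean_has_derivative[where F = "\<lambda>y. f (semi t x + y + shift t)"])
       (use holder_fun_shift_meas[OF f] holder_boundedD(2)[OF f] in auto)
qed

lemma ou_deriv_bound:
  assumes t: "t > 0" and f: "holder_fun B K f"
    and a: "nondegenerate_gaussian.sd (cov t) w \<le> a" and b: "norm (cov t w) \<le> b"
  shows "\<bar>ou_deriv t f x w\<bar> \<le> 2 * K * a powr (1 - \<theta>) * b powr \<theta>"
proof -
  interpret nondegenerate_gaussian e "N t" "cov t" using t by (rule nondegenerate)
  note fD = holder_boundedD[OF f]
  have "\<bar>ou_deriv t f x w\<bar> \<le> 2 * K * sd w powr (1 - \<theta>) * norm (cov t w) powr \<theta>"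
    unfolding ou_deriv_def
  proof (rule weighted_mean_holder[OF holder_fun_shift_meas[OF f] fD(2) _ \<theta> fD(1)])
    show "\<bar>f (semi t x + y + shift t) - f (semi t x + y' + shift t)\<bar> \<le> K * norm (y - y') powr \<theta>" for y y'
      using fD(3)[of "semi t x + y + shift t" "semi t x + y' + shift t"] by simp
  qed
  also have "\<dots> \<le> 2 * K * a powr (1 - \<theta>) * b powr \<theta>"
    using a b sd_nonneg \<theta> fD(1) by (intro mult_mono powr_mono2 mult_nonneg_nonneg) auto
  finally show ?thesis .
qed

lemma ou_deriv_whiten_bound:
  assumes t: "t > 0" and f: "holder_fun B K f"
  shows "\<bar>ou_deriv t f x (whiten t h)\<bar> \<le> 2 * K * t powr ((\<theta> - 1) / 2) * norm h"
proof -
  have "\<bar>ou_deriv t f x (whiten t h)\<bar> \<le> 2 * K * (t powr (- 1 / 2) * norm h) powr (1 - \<theta>) * (norm h) powr \<theta>"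
    using cov_whiten[OF t] norm_semi_le t by (intro ou_deriv_bound[OF t f] sd_whiten_le) auto
  also have "(t powr (- 1 / 2) * norm h) powr (1 - \<theta>) = t powr ((\<theta> - 1) / 2) * norm h powr (1 - \<theta>)"
  proof -
    have "- 1 / 2 * (1 - \<theta>) = (\<theta> - 1) / 2" by (simp add: field_simps)
    then show ?thesis by (simp only: powr_mult powr_powr)
  qed
  also have "2 * K * (t powr ((\<theta> - 1) / 2) * norm h powr (1 - \<theta>)) * norm h powr \<theta>
      = 2 * K * t powr ((\<theta> - 1) / 2) * (norm h powr (1 - \<theta>) * norm h powr \<theta>)"
    by (simp only: mult.assoc)
  also have "norm h powr (1 - \<theta>) * norm h powr \<theta> = norm h"
    by (simp add: powr_add[symmetric])
  finally show ?thesis .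
qed

text \<open>The exponents add up as \<open>- (1 - \<theta>) - \<theta> / 2 = \<theta> / 2 - 1 > - 1\<close>; this integrability at \<open>t = 0\<close> is the
gain over the bound \<open>1 / t\<close> available for functions that are merely bounded.\<close>

lemma ou_deriv_whiten_sqrt_bound:
  assumes t: "t > 0" and f: "holder_fun B K f"
  shows "\<bar>ou_deriv t f x (whiten_sqrt t k)\<bar> \<le> 2 * K * t powr (\<theta> / 2 - 1) * norm k"
proof -
  have "\<bar>ou_deriv t f x (whiten_sqrt t k)\<bar> \<le> 2 * K * (1 / t * norm k) powr (1 - \<theta>) * (t powr (- 1 / 2) * norm k) powr \<theta>"
    by (intro ou_deriv_bound[OF t f] sd_whiten_sqrt_le norm_cov_whiten_sqrt_le t)
  also have "1 / t = t powr (- 1)" using t by (simp add: powr_minus_divide)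
  also have "2 * K * (t powr (- 1) * norm k) powr (1 - \<theta>) * (t powr (- 1 / 2) * norm k) powr \<theta>
      = 2 * K * (t powr (- 1 * (1 - \<theta>)) * t powr (- 1 / 2 * \<theta>)) * (norm k powr (1 - \<theta>) * norm k powr \<theta>)"
    by (simp only: powr_mult powr_powr mult_ac)
  also have "norm k powr (1 - \<theta>) * norm k powr \<theta> = norm k"
    by (simp add: powr_add[symmetric])
  also have "t powr (- 1 * (1 - \<theta>)) * t powr (- 1 / 2 * \<theta>) = t powr (\<theta> / 2 - 1)"
    unfolding powr_add[symmetric] by (rule arg_cong[of _ _ "(powr) t"]) (simp add: field_simps)
  finally show ?thesis .
qed

lemma mean_value:
  assumes t: "t > 0" and f: "holder_fun B K f"
  obtains x' where "norm (x' - x) \<le> norm h" "ou t f (x + h) - ou t f x = ou_deriv t f x' (whiten t h)"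
proof -
  obtain \<tau> where \<tau>: "0 < \<tau>" "\<tau> < 1"
    "ou t f (x + 1 *\<^sub>R h) - ou t f (x + 0 *\<^sub>R h) = (1 - 0) * ou_deriv t f (x + \<tau> *\<^sub>R h) (whiten t h)"
    using MVT2[of 0 1 "\<lambda>\<tau>. ou t f (x + \<tau> *\<^sub>R h)" "\<lambda>\<tau>. ou_deriv t f (x + \<tau> *\<^sub>R h) (whiten t h)"]
      ou_has_derivative[OF t f] by auto
  show ?thesis
    by (rule that[of "x + \<tau> *\<^sub>R h"]) (use \<tau> in \<open>auto simp: mult_left_le_one_le\<close>)
qed

lemma ou_lipschitz:
  assumes t: "t > 0" and f: "holder_fun B K f"
  shows "\<bar>ou t f x - ou t f x'\<bar> \<le> 2 * K * t powr ((\<theta> - 1) / 2) * norm (x - x')"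
proof -
  obtain y where "ou t f (x' + (x - x')) - ou t f x' = ou_deriv t f y (whiten t (x - x'))"
    by (rule mean_value[OF t f])
  then show ?thesis using ou_deriv_whiten_bound[OF t f] by simp
qed

text \<open>The variances satisfy \<open>Q\<^sub>t\<^sub>+\<^sub>s = e\<^sup>t\<^sup>A Q\<^sub>s e\<^sup>t\<^sup>A + Q\<^sub>t\<close>, so the characteristic functionals agree.\<close>

lemma N_convolution:
  assumes t: "t \<ge> 0" and s: "s \<ge> 0"
  shows "distr (N s \<Otimes>\<^sub>M N t) borel (\<lambda>(y, y'). semi t y + y') = N (t + s)"
proof (rule characteristic_functional_unique)
  interpret Ns: prob_space "N s" using s by (rule prob_N)
  interpret Nt: prob_space "N t" using t by (rule prob_N)
  interpret P: pair_prob_space "N s" "N t" ..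
  interpret semit: bounded_linear "semi t" using t by (rule bounded_linear_semi)
  have [measurable_cong]: "sets (N s) = sets borel" "sets (N t) = sets borel" using s t by (simp_all add: sets_N)
  have [measurable]: "semi t \<in> borel_measurable borel"
    by (intro borel_measurable_continuous_onI semit.continuous_on continuous_on_id)
  show "prob_space (distr (N s \<Otimes>\<^sub>M N t) borel (\<lambda>(y, y'). semi t y + y'))"
    by (rule P.prob_space_distr) simp
  show "sets (distr (N s \<Otimes>\<^sub>M N t) borel (\<lambda>(y, y'). semi t y + y')) = sets borel" by simp
  show "prob_space (N (t + s))" "sets (N (t + s)) = sets borel" using s t by (simp_all add: prob_N sets_N)
  fix h
  have sym: "h \<bullet> semi t y = semi t h \<bullet> y" for y
  proof (rule sums_unique2[OF parseval_inner])
    show "(\<lambda>k. (h \<bullet> e k) * (semi t y \<bullet> e k)) sums (semi t h \<bullet> y)"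
      using parseval_inner[of "semi t h" y] by (simp add: semi_coord[OF t] mult_ac)
  qed
  have "(CLINT y|distr (N s \<Otimes>\<^sub>M N t) borel (\<lambda>(y, y'). semi t y + y'). iexp (h \<bullet> y))
      = (CLINT q|(N s \<Otimes>\<^sub>M N t). iexp (h \<bullet> (case q of (y, y') \<Rightarrow> semi t y + y')))"
    by (subst integral_distr) auto
  also have "\<dots> = (CLINT y|N s. (CLINT y'|N t. iexp (h \<bullet> (case (y, y') of (y, y') \<Rightarrow> semi t y + y'))))"
    by (rule P.integral_fst'[symmetric], rule P.integrable_iexp) auto
  also have "\<dots> = (CLINT y|N s. (CLINT y'|N t. iexp (semi t h \<bullet> y) * iexp (h \<bullet> y')))"
    by (simp add: inner_add_right sym exp_add distrib_left)
  also have "\<dots> = (CLINT y|N s. iexp (semi t h \<bullet> y)) * (CLINT y'|N t. iexp (h \<bullet> y'))"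
    by simp
  also have "\<dots> = complex_of_real (exp (- (cov s (semi t h) \<bullet> semi t h) / 2) * exp (- (cov t h \<bullet> h) / 2))"
    by (simp add: charf_N s t)
  also have "exp (- (cov s (semi t h) \<bullet> semi t h) / 2) * exp (- (cov t h \<bullet> h) / 2) = exp (- (cov (t + s) h \<bullet> h) / 2)"
  proof -
    have "cov s (semi t h) \<bullet> semi t h + cov t h \<bullet> h = cov (t + s) h \<bullet> h"
    proof (rule sums_unique2[OF sums_add[OF parseval_inner parseval_inner]])
      have q: "qvar s k * exp (- t * l k) * exp (- t * l k) + qvar t k = qvar (t + s) k" for k
      proof -
        have "exp (- t * l k) * exp (- t * l k) = exp (- 2 * t * l k)"
          by (simp add: exp_add[symmetric])
        moreover have "exp (- 2 * (t + s) * l k) = exp (- 2 * s * l k) * exp (- 2 * t * l k)"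
          by (simp add: exp_add[symmetric] algebra_simps)
        ultimately show ?thesis
          by (simp only: qvar_def mult.assoc) (simp add: add_divide_distrib[symmetric] left_diff_distrib mult.assoc[symmetric] diff_divide_distrib)
      qed
      have c: "(cov s (semi t h) \<bullet> e k) * (semi t h \<bullet> e k) + (cov t h \<bullet> e k) * (h \<bullet> e k)
          = (cov (t + s) h \<bullet> e k) * (h \<bullet> e k)" for k
      proof -
        have "(cov s (semi t h) \<bullet> e k) * (semi t h \<bullet> e k) + (cov t h \<bullet> e k) * (h \<bullet> e k)
          = (qvar s k * exp (- t * l k) * exp (- t * l k) + qvar t k) * (h \<bullet> e k) * (h \<bullet> e k)"
          using s t by (simp add: cov_coord semi_coord algebra_simps)
        then show ?thesis unfolding q using s t by (simp add: cov_coord)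
      qed
      show "(\<lambda>k. (cov s (semi t h) \<bullet> e k) * (semi t h \<bullet> e k) + (cov t h \<bullet> e k) * (h \<bullet> e k)) sums (cov (t + s) h \<bullet> h)"
        unfolding c by (rule parseval_inner)
    qed
    then show ?thesis by (simp add: exp_add[symmetric] add_divide_distrib[symmetric] field_simps)
  qed
  also have "complex_of_real \<dots> = (CLINT y|N (t + s). iexp (h \<bullet> y))"
    using s t by (simp add: charf_N)
  finally show "(CLINT y|distr (N s \<Otimes>\<^sub>M N t) borel (\<lambda>(y, y'). semi t y + y'). iexp (h \<bullet> y)) =
      (CLINT y|N (t + s). iexp (h \<bullet> y))" .
qed

lemma ou_semigroup:
  assumes t: "t \<ge> 0" and s: "s \<ge> 0" and f: "holder_fun B K f"
  shows "ou (t + s) f x = ou s (ou t f) x"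
proof -
  interpret Ns: prob_space "N s" using s by (rule prob_N)
  interpret Nt: prob_space "N t" using t by (rule prob_N)
  interpret P: pair_prob_space "N s" "N t" ..
  interpret semit: bounded_linear "semi t" using t by (rule bounded_linear_semi)
  have [measurable_cong]: "sets (N s) = sets borel" "sets (N t) = sets borel" using s t by (simp_all add: sets_N)
  have [measurable]: "semi t \<in> borel_measurable borel"
    by (intro borel_measurable_continuous_onI semit.continuous_on continuous_on_id)
  have [measurable]: "f \<in> borel_measurable borel" using f by (rule holder_fun_meas)
  let ?F = "\<lambda>y y'. f (semi (t + s) x + (semi t y + y') + shift (t + s))"
  have eq: "?F y y' = f (semi t (semi s x + y + shift s) + y' + shift t)" for y y'
    unfolding semi_add[OF t s] shift_add[OF t s] semit.add by (simp add: add_ac)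
  have "ou (t + s) f x = (LINT y|distr (N s \<Otimes>\<^sub>M N t) borel (\<lambda>(y, y'). semi t y + y'). f (semi (t + s) x + y + shift (t + s)))"
    unfolding ou_def N_convolution[OF t s] ..
  also have "\<dots> = (LINT q|(N s \<Otimes>\<^sub>M N t). (case q of (y, y') \<Rightarrow> ?F y y'))"
    by (subst integral_distr) (auto simp: case_prod_unfold)
  also have "\<dots> = (LINT y|N s. (LINT y'|N t. ?F y y'))"
    using holder_boundedD(2)[OF f]
    by (subst P.integral_fst'[symmetric]) (auto intro!: P.integrable_const_bound[of _ B])
  also have "\<dots> = ou s (ou t f) x"
    unfolding eq ou_def ..
  finally show ?thesis .
qed

lemma ou_deriv_bounded_linear:
  assumes t: "t > 0" and f: "holder_fun B K f"
  shows "bounded_linear (ou_deriv t f x)"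
proof -
  interpret nondegenerate_gaussian e "N t" "cov t" using t by (rule nondegenerate)
  note i = integrable_inner_times[OF holder_fun_shift_meas[OF f] holder_boundedD(2)[OF f]]
  obtain C where C: "C \<ge> 0" "\<And>w. norm (cov t w) \<le> norm w * C" using cov.nonneg_bounded by blast
  show ?thesis
  proof (rule bounded_linear_intro)
    show "ou_deriv t f x (w + w') = ou_deriv t f x w + ou_deriv t f x w'" for w w'
      unfolding ou_deriv_def using i by (simp add: inner_add_left distrib_right)
    show "ou_deriv t f x (c *\<^sub>R w) = c *\<^sub>R ou_deriv t f x w" for c w
      unfolding ou_deriv_def by (simp add: mult.assoc)
    show "norm (ou_deriv t f x w) \<le> norm w * (B * sqrt C)" for w
    proof -
      have "B \<ge> 0" using holder_boundedD(2)[OF f, of 0] by linarith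
      have "cov t w \<bullet> w \<le> norm (cov t w) * norm w" by (rule norm_cauchy_schwarz)
      also have "\<dots> \<le> norm w * C * norm w" using C by (intro mult_right_mono) auto
      finally have "sd w \<le> sqrt (norm w * C * norm w)" unfolding sd_def by simp
      also have "\<dots> = norm w * sqrt C" by (simp add: real_sqrt_mult)
      finally have "B * sd w \<le> B * (norm w * sqrt C)" using \<open>B \<ge> 0\<close> by (rule mult_left_mono)
      then show ?thesis
        using weighted_mean_bounded[OF holder_fun_shift_meas[OF f] holder_boundedD(2)[OF f], of w "semi t x" "shift t"]
        by (simp add: ou_deriv_def mult_ac)
    qed
  qed
qed

lemma ou_deriv_whiten_sqrt_linear:
  assumes t: "t > 0" and f: "holder_fun B K f"
  shows "bounded_linear (\<lambda>k. ou_deriv t f x (whiten_sqrt t k))"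
  using bounded_linear_compose[OF ou_deriv_bounded_linear[OF t f] bounded_linear_whiten_sqrt[OF t]] .

text \<open>Each \<open>e k\<close> lies in the range of \<open>(-A)\<^bsup>-1/2\<^esup>\<close>, so this range is dense.\<close>

lemma functional_eqI:
  assumes "bounded_linear (F :: 'a \<Rightarrow> real)" "bounded_linear G" "\<And>h. F (inv_sqrt h) = G (inv_sqrt h)"
  shows "F k = G k"
proof -
  have "F (e j) = G (e j)" for j
  proof -
    have "inv_sqrt (sqrt (l j) *\<^sub>R e j) = e j"
      using l_pos[THEN less_imp_neq, THEN not_sym] by (intro coord_eqI) (auto simp: inv_sqrt_coord inner_basis)
    then show ?thesis using assms(3) by metis
  qed
  moreover have "(\<lambda>j. F ((k \<bullet> e j) *\<^sub>R e j)) sums F k" "(\<lambda>j. G ((k \<bullet> e j) *\<^sub>R e j)) sums G k"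
    by (rule bounded_linear.sums[OF assms(1) basis_expansion], rule bounded_linear.sums[OF assms(2) basis_expansion])
  moreover have "F ((k \<bullet> e j) *\<^sub>R e j) = (k \<bullet> e j) * F (e j)" "G ((k \<bullet> e j) *\<^sub>R e j) = (k \<bullet> e j) * G (e j)" for j
    using linear_scale[OF bounded_linear.linear[OF assms(1)]] linear_scale[OF bounded_linear.linear[OF assms(2)]]
    by simp_all
  ultimately show ?thesis using sums_unique2[of _ "F k" "G k"] by (simp only:)
qed

text \<open>On the range of \<open>(-A)\<^bsup>-1/2\<^esup>\<close> both sides are the derivative of \<open>P\<^sub>t f = P\<^sub>t\<^sub>/\<^sub>2 P\<^sub>t\<^sub>/\<^sub>2 f\<close> at \<open>x\<close>; density gives
the rest.\<close>

lemma ou_deriv_half: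
  assumes t: "t > 0" and f: "holder_fun B K f"
  shows "ou_deriv t f x (whiten_sqrt t k) = ou_deriv (t / 2) (ou (t / 2) f) x (whiten_sqrt (t / 2) k)"
proof -
  have t2: "t / 2 > 0" using t by simp
  have f2: "holder_fun B K (ou (t / 2) f)" using t by (intro ou_holder_fun f) simp
  have eq: "ou t f y = ou (t / 2) (ou (t / 2) f) y" for y
    using ou_semigroup[of "t / 2" "t / 2", OF _ _ f] t by simp
  show ?thesis
  proof (rule functional_eqI[OF ou_deriv_whiten_sqrt_linear[OF t f] ou_deriv_whiten_sqrt_linear[OF t2 f2]])
    fix h
    have "ou_deriv t f (x + 0 *\<^sub>R h) (whiten t h) = ou_deriv (t / 2) (ou (t / 2) f) (x + 0 *\<^sub>R h) (whiten (t / 2) h)"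
      using ou_has_derivative[OF t f, of x h 0] ou_has_derivative[OF t2 f2, of x h 0]
      unfolding eq by (rule DERIV_unique)
    then show "ou_deriv t f x (whiten_sqrt t (inv_sqrt h)) = ou_deriv (t / 2) (ou (t / 2) f) x (whiten_sqrt (t / 2) (inv_sqrt h))"
      by (simp add: whiten_sqrt_inv_sqrt t t2)
  qed
qed

text \<open>Half of the time smooths \<open>f\<close> to a Lipschitz function with constant of order \<open>t\<^bsup>(\<theta>-1)/2\<^esup>\<close>, and the other
half provides the derivative at the cost of a factor of order \<open>1 / t\<close>. No second derivative of \<open>P\<^sub>t f\<close> has to be
formed.\<close>

lemma ou_deriv_whiten_sqrt_lipschitz:
  assumes t: "t > 0" and f: "holder_fun B K f"
  shows "\<bar>ou_deriv t f x (whiten_sqrt t k) - ou_deriv t f x' (whiten_sqrt t k)\<bar>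
    \<le> 8 * K * t powr (\<theta> / 2 - 3 / 2) * norm (x - x') * norm k"
proof -
  define s where "s = t / 2"
  have s: "s > 0" using t by (simp add: s_def)
  define g where "g = ou s f"
  have g: "holder_fun B K g" unfolding g_def using s by (intro ou_holder_fun f) simp
  interpret nondegenerate_gaussian e "N s" "cov s" using s by (rule nondegenerate)
  let ?w = "whiten_sqrt s k"
  define C where "C = 2 * K * s powr ((\<theta> - 1) / 2) * norm (x - x')"
  have K: "K \<ge> 0" by (rule holder_boundedD[OF f])
  have 1: "ou_deriv t f x (whiten_sqrt t k) - ou_deriv t f x' (whiten_sqrt t k)
      = (LINT y|N s. (?w \<bullet> y) * (g (semi s x + y + shift s) - g (semi s x' + y + shift s)))"
    unfolding ou_deriv_half[OF t f]
    unfolding s_def[symmetric] g_def[symmetric] ou_deriv_def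
    using integrable_inner_times[OF holder_fun_shift_meas[OF g] holder_boundedD(2)[OF g]]
    by (simp add: right_diff_distrib)
  have 2: "\<bar>LINT y|N s. (?w \<bullet> y) * (g (semi s x + y + shift s) - g (semi s x' + y + shift s))\<bar> \<le> C * sd ?w"
  proof (rule weighted_mean_bounded)
    show "(\<lambda>y. g (semi s x + y + shift s) - g (semi s x' + y + shift s)) \<in> borel_measurable borel"
      using holder_fun_shift_meas[OF g] by measurable
    fix y
    have "\<bar>g (semi s x + y + shift s) - g (semi s x' + y + shift s)\<bar> \<le> 2 * K * s powr ((\<theta> - 1) / 2) * norm (semi s x - semi s x')"
      using ou_lipschitz[OF s f, of "semi s x + y + shift s" "semi s x' + y + shift s"] by (simp add: g_def)
    also have "\<dots> \<le> C"
      unfolding C_def using norm_semi_le[of s "x - x'"] semi_diff[of s x x'] s K by (intro mult_left_mono) auto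
    finally show "\<bar>g (semi s x + y + shift s) - g (semi s x' + y + shift s)\<bar> \<le> C" .
  qed
  have 3: "C * sd ?w \<le> C * (1 / s * norm k)"
    using sd_whiten_sqrt_le[OF s, of k] K by (intro mult_left_mono) (auto simp: C_def)
  have 4: "C * (1 / s * norm k) = 2 * K * (s powr ((\<theta> - 1) / 2) * s powr (- 1)) * norm (x - x') * norm k"
    using s by (simp add: C_def powr_minus_divide)
  have 5: "s powr ((\<theta> - 1) / 2) * s powr (- 1) = s powr (\<theta> / 2 - 3 / 2)"
    unfolding powr_add[symmetric] by (rule arg_cong[of _ _ "(powr) s"]) (simp add: field_simps)
  have "s powr (\<theta> / 2 - 3 / 2) \<le> 4 * t powr (\<theta> / 2 - 3 / 2)"
  proof -
    have "s = t * 2 powr (- 1)" by (simp add: s_def powr_minus_divide)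
    then have "s powr (\<theta> / 2 - 3 / 2) = t powr (\<theta> / 2 - 3 / 2) * 2 powr (- 1 * (\<theta> / 2 - 3 / 2))"
      by (simp only: powr_mult powr_powr)
    moreover have "2 powr (- 1 * (\<theta> / 2 - 3 / 2)) \<le> (2::real) powr 2"
      using \<theta> by (intro powr_mono) auto
    ultimately show ?thesis using mult_left_mono[of "2 powr (- 1 * (\<theta> / 2 - 3 / 2))" 4 "t powr (\<theta> / 2 - 3 / 2)"] by simp
  qed
  then have 6: "2 * K * s powr (\<theta> / 2 - 3 / 2) * norm (x - x') * norm k
      \<le> 2 * K * (4 * t powr (\<theta> / 2 - 3 / 2)) * norm (x - x') * norm k"
    using K by (intro mult_right_mono mult_left_mono) auto
  have "\<bar>ou_deriv t f x (whiten_sqrt t k) - ou_deriv t f x' (whiten_sqrt t k)\<bar> \<le> C * (1 / s * norm k)"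
    unfolding 1 using 2 3 by (rule order_trans)
  also have "\<dots> = 2 * K * s powr (\<theta> / 2 - 3 / 2) * norm (x - x') * norm k" unfolding 4 5 ..
  also note 6
  finally show ?thesis by (simp add: mult.assoc)
qed

end

section \<open>Dependence on time\<close>

lemma has_bochner_integral_of_has_integral:
  fixes f :: "real \<Rightarrow> real"
  assumes I: "(f has_integral I) \<Omega>" and nonneg: "\<And>x. x \<in> \<Omega> \<Longrightarrow> 0 \<le> f x"
    and [measurable]: "f \<in> borel_measurable borel" "\<Omega> \<in> sets borel"
  shows "has_bochner_integral lborel (\<lambda>x. indicator \<Omega> x * f x) I"
proof (rule has_bochner_integral_nn_integral)
  show "0 \<le> I" using I nonneg by (rule has_integral_nonneg)
  show "(\<integral>\<^sup>+ x. ennreal (indicator \<Omega> x * f x) \<partial>lborel) = ennreal I"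
    using nn_integral_has_integral_lebesgue[OF nonneg I] by simp
  show "AE x in lborel. 0 \<le> indicator \<Omega> x * f x" using nonneg by (auto simp: indicator_def)
qed measurable

lemma powr_integral_near_0:
  assumes "a > - 1" "c > 0"
  shows "has_bochner_integral lborel (\<lambda>t::real. indicator {0..c} t * t powr a) (c powr (a + 1) / (a + 1))"
  using assms by (intro has_bochner_integral_of_has_integral has_integral_powr_from_0) auto

lemma powr_integral_to_inf:
  assumes "a < - 1" "c > 0"
  shows "has_bochner_integral lborel (\<lambda>t::real. indicator {c..} t * t powr a) (- (c powr (a + 1)) / (a + 1))"
  using assms by (intro has_bochner_integral_of_has_integral has_integral_powr_to_inf) auto

lemma exp_integral_to_inf:
  assumes "\<mu> > 0"
  shows "has_bochner_integral lborel (\<lambda>t::real. indicator {c..} t * exp (- \<mu> * t)) (exp (- \<mu> * c) / \<mu>)"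
  using assms by (intro has_bochner_integral_of_has_integral has_integral_exp_minus_to_infinity) auto

abbreviation laplace_kernel :: "real \<Rightarrow> real \<Rightarrow> real \<Rightarrow> real" where
  "laplace_kernel \<theta> \<mu> t \<equiv> indicator {0<..} t * (exp (- \<mu> * t) * t powr (\<theta> / 2 - 1))"

text \<open>The integral is \<open>\<Gamma>(\<theta>/2) \<mu>\<^bsup>-\<theta>/2\<^esup>\<close>. Splitting at \<open>t = 1 / \<mu>\<close> gives the right power of \<open>\<mu>\<close> from elementary
integrals.\<close>

lemma laplace_powr_bound:
  assumes \<theta>: "0 < \<theta>" "\<theta> < 1" and \<mu>: "\<mu> > 0"
  defines "g \<equiv> (\<lambda>t::real. laplace_kernel \<theta> \<mu> t)"
  shows "integrable lborel g" "(LINT t|lborel. g t) \<le> (2 / \<theta> + 1) * \<mu> powr (- \<theta> / 2)"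
proof -
  define a where "a = 1 / \<mu>"
  have a: "a > 0" using \<mu> by (simp add: a_def)
  define G where "G t = indicator {0..a} t * t powr (\<theta> / 2 - 1) + a powr (\<theta> / 2 - 1) * (indicator {a..} t * exp (- \<mu> * t))" for t :: real
  have bi: "has_bochner_integral lborel G (a powr (\<theta> / 2 - 1 + 1) / (\<theta> / 2 - 1 + 1)
      + a powr (\<theta> / 2 - 1) * (exp (- \<mu> * a) / \<mu>))"
    unfolding G_def
    by (intro has_bochner_integral_add has_bochner_integral_mult_right powr_integral_near_0 exp_integral_to_inf a \<mu>)
       (use \<theta> in auto)
  have le: "0 \<le> g t" "g t \<le> G t" for t
  proof -
    show "0 \<le> g t" by (simp add: g_def)
    show "g t \<le> G t"
    proof (cases "t \<le> 0 \<or> t > a")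
      case True
      show ?thesis
      proof (cases "t \<le> 0")
        case False
        then have t: "t > a" "t > 0" using True a by auto
        have "t powr (\<theta> / 2 - 1) \<le> a powr (\<theta> / 2 - 1)" using t a \<theta> by (intro powr_mono2') auto
        then have "exp (- \<mu> * t) * t powr (\<theta> / 2 - 1) \<le> exp (- \<mu> * t) * a powr (\<theta> / 2 - 1)"
          by (intro mult_left_mono) auto
        then show ?thesis using t by (simp add: g_def G_def mult.commute)
      qed (simp add: g_def G_def)
    next
      case False
      then have t: "t > 0" "t \<le> a" by auto
      have "exp (- \<mu> * t) * t powr (\<theta> / 2 - 1) \<le> 1 * t powr (\<theta> / 2 - 1)"
        using t \<mu> by (intro mult_right_mono) auto
      also have "\<dots> \<le> G t" using t by (simp add: G_def)
      finally show ?thesis using t by (simp add: g_def)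
    qed
  qed
  show gi: "integrable lborel g"
  proof (rule Bochner_Integration.integrable_bound[OF integrable.intros[OF bi]])
    show "g \<in> borel_measurable lborel" unfolding g_def by measurable
    show "AE t in lborel. norm (g t) \<le> norm (G t)" using le order_trans[OF le] by (auto intro!: AE_I2)
  qed
  have "(LINT t|lborel. g t) \<le> (LINT t|lborel. G t)"
    by (intro integral_mono gi integrable.intros[OF bi] le)
  also have "\<dots> = a powr (\<theta> / 2 - 1 + 1) / (\<theta> / 2 - 1 + 1) + a powr (\<theta> / 2 - 1) * (exp (- \<mu> * a) / \<mu>)"
    by (rule has_bochner_integral_integral_eq[OF bi])
  also have "\<dots> \<le> 2 / \<theta> * a powr (\<theta> / 2) + a powr (\<theta> / 2 - 1) * a"
  proof (intro add_mono mult_left_mono)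
    have "exp (- \<mu> * a) \<le> 1" using \<mu> a by simp
    then show "exp (- \<mu> * a) / \<mu> \<le> a" unfolding a_def using \<mu> by (intro divide_right_mono) auto
  qed (use \<theta> in \<open>auto simp: mult.commute\<close>)
  also have "a powr (\<theta> / 2 - 1) * a = a powr (\<theta> / 2)" using a by (simp add: powr_diff)
  also have "2 / \<theta> * a powr (\<theta> / 2) + a powr (\<theta> / 2) = (2 / \<theta> + 1) * a powr (\<theta> / 2)" by (simp add: distrib_right)
  also have "a powr (\<theta> / 2) = \<mu> powr (- \<theta> / 2)"
    using \<mu> by (simp add: a_def powr_divide powr_minus_divide)
  finally show "(LINT t|lborel. g t) \<le> (2 / \<theta> + 1) * \<mu> powr (- \<theta> / 2)" .
qed

text \<open>The two bounds on \<open>h\<close> are of the same order at \<open>t = d\<^sup>2\<close>, the parabolic scale. The first is integrated up to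
there and the second from there on; both contribute the order \<open>d powr \<theta>\<close> because \<open>0 < \<theta> < 1\<close>.\<close>

lemma two_scale_bound:
  fixes h :: "real \<Rightarrow> real"
  assumes \<theta>: "0 < \<theta>" "\<theta> < 1" and d: "d > 0" and AB: "A \<ge> 0" "B \<ge> 0"
    and h: "h \<in> borel_measurable borel" "\<And>t. t \<le> 0 \<Longrightarrow> h t = 0"
    and small: "\<And>t. t > 0 \<Longrightarrow> \<bar>h t\<bar> \<le> A * t powr (\<theta> / 2 - 1)"
    and large: "\<And>t. t > 0 \<Longrightarrow> \<bar>h t\<bar> \<le> B * d * t powr (\<theta> / 2 - 3 / 2)"
  shows "\<bar>LINT t|lborel. h t\<bar> \<le> (2 / \<theta> * A + 2 / (1 - \<theta>) * B) * d powr \<theta>"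
proof -
  \<comment> \<open>both bounds on \<open>h\<close> meet at this scale\<close>
  define a where "a = d\<^sup>2"
  have a: "a > 0" using d by (simp add: a_def)
  have ad: "a = d powr 2" using d by (simp add: a_def)
  define G where "G t = A * (indicator {0..a} t * t powr (\<theta> / 2 - 1)) + B * d * (indicator {a..} t * t powr (\<theta> / 2 - 3 / 2))" for t :: real
  have bi: "has_bochner_integral lborel G (A * (a powr (\<theta> / 2 - 1 + 1) / (\<theta> / 2 - 1 + 1))
      + B * d * (- (a powr (\<theta> / 2 - 3 / 2 + 1)) / (\<theta> / 2 - 3 / 2 + 1)))"
    unfolding G_def
    by (intro has_bochner_integral_add has_bochner_integral_mult_right powr_integral_near_0 powr_integral_to_inf a)
       (use \<theta> in auto)
  have le: "\<bar>h t\<bar> \<le> G t" for t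
  proof -
    consider "t \<le> 0" | "t > 0" "t \<le> a" | "t > 0" "t > a" by linarith
    then show ?thesis
    proof cases
      case 1 then show ?thesis using h(2) AB d by (simp add: G_def)
    next
      case 2
      have "A * t powr (\<theta> / 2 - 1) \<le> G t" using 2 AB d by (simp add: G_def)
      then show ?thesis using small[OF 2(1)] by simp
    next
      case 3
      have "B * d * t powr (\<theta> / 2 - 3 / 2) \<le> G t" using 3 AB d by (simp add: G_def)
      then show ?thesis using large[OF 3(1)] by simp
    qed
  qed
  have hi: "integrable lborel h"
  proof (rule Bochner_Integration.integrable_bound[OF integrable.intros[OF bi]])
    show "h \<in> borel_measurable lborel" using h(1) by simp
    show "AE t in lborel. norm (h t) \<le> norm (G t)" using order_trans[OF le abs_ge_self] by (auto intro!: AE_I2)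
  qed
  have "\<bar>LINT t|lborel. h t\<bar> \<le> (LINT t|lborel. \<bar>h t\<bar>)" by (rule integral_abs_bound)
  also have "\<dots> \<le> (LINT t|lborel. G t)"
    by (intro integral_mono integrable_abs hi integrable.intros[OF bi] le)
  also have "\<dots> = A * (a powr (\<theta> / 2 - 1 + 1) / (\<theta> / 2 - 1 + 1))
      + B * d * (- (a powr (\<theta> / 2 - 3 / 2 + 1)) / (\<theta> / 2 - 3 / 2 + 1))"
    by (rule has_bochner_integral_integral_eq[OF bi])
  also have "\<dots> = (2 / \<theta> * A + 2 / (1 - \<theta>) * B) * d powr \<theta>"
  proof -
    have 1: "a powr (\<theta> / 2 - 1 + 1) = d powr \<theta>" unfolding ad powr_powr by simp
    have "a powr (\<theta> / 2 - 3 / 2 + 1) = d powr (\<theta> - 1)" unfolding ad powr_powr by simp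
    then have 2: "a powr (\<theta> / 2 - 3 / 2 + 1) = d powr \<theta> / d" using d by (simp add: powr_diff)
    have 3: "\<theta> / 2 - 3 / 2 + 1 = - ((1 - \<theta>) / 2)" by (simp add: field_simps)
    have 4: "\<theta> / 2 - 1 + 1 = \<theta> / 2" by simp
    show ?thesis
      unfolding 1 2 unfolding 3 4 using d \<theta> by (simp add: field_simps)
  qed
  finally show ?thesis .
qed

lemma suminf_tendsto_0_at_right:
  fixes a :: "nat \<Rightarrow> real \<Rightarrow> real"
  assumes "\<And>k. (a k \<longlongrightarrow> 0) (at_right 0)" and le: "\<And>k t. t > 0 \<Longrightarrow> \<bar>a k t\<bar> \<le> M k" and "summable M"
  shows "((\<lambda>t. \<Sum>k. a k t) \<longlongrightarrow> 0) (at_right 0)"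
proof -
  have pos: "\<forall>\<^sub>F t in at_right (0::real). t > 0" by (simp add: eventually_at_right_less)
  have "\<forall>\<^sub>F q in (at_top :: nat filter) \<times>\<^sub>F at_right (0::real). True \<and> snd q > 0"
    using eventually_prodI[OF eventually_True[of "at_top :: nat filter"] pos] by simp
  then have "\<forall>\<^sub>F (k, t) in at_top \<times>\<^sub>F at_right 0. norm (a k t) \<le> M k"
    by eventually_elim (use le in auto)
  from tannerys_theorem[OF assms(1) this assms(3)] show ?thesis by simp
qed

context ornstein_uhlenbeck
begin

definition cov_trace :: "real \<Rightarrow> real" where "cov_trace t = (\<Sum>k. qvar t k)"

lemma summable_qvar: "t \<ge> 0 \<Longrightarrow> summable (qvar t)"
  by (rule summable_comparison_test'[OF l_summable, of 0])
    (use qvar_nonneg qvar_le inverse_l_le l_pos in \<open>smt (verit) inverse_positive_iff_positive real_norm_def field_sum_of_halves\<close>)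

lemma second_moment:
  assumes t: "t > 0"
  shows "integrable (N t) (\<lambda>y. (norm y)\<^sup>2)" "(LINT y|N t. (norm y)\<^sup>2) = cov_trace t"
proof -
  interpret nondegenerate_gaussian e "N t" "cov t" using t by (rule nondegenerate)
  have t0: "t \<ge> 0" using t by simp
  have "(\<integral>\<^sup>+ y. ennreal ((norm y)\<^sup>2) \<partial>N t) = (\<integral>\<^sup>+ y. (\<Sum>k. ennreal ((e k \<bullet> y)\<^sup>2)) \<partial>N t)"
    by (intro nn_integral_cong suminf_ennreal_eq[symmetric]) (use parseval in \<open>auto simp: inner_commute\<close>)
  also have "\<dots> = (\<Sum>k. \<integral>\<^sup>+ y. ennreal ((e k \<bullet> y)\<^sup>2) \<partial>N t)"
    by (rule nn_integral_suminf) simp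
  also have "\<dots> = (\<Sum>k. ennreal (qvar t k))"
    using t0 by (simp add: nn_second_moment cov_coord inner_basis)
  also have "\<dots> = ennreal (cov_trace t)"
    unfolding cov_trace_def using summable_qvar[OF t0] qvar_nonneg[OF t0] by (intro suminf_ennreal_eq summable_sums)
  finally have nn: "(\<integral>\<^sup>+ y. ennreal ((norm y)\<^sup>2) \<partial>N t) = ennreal (cov_trace t)" .
  have "cov_trace t \<ge> 0" unfolding cov_trace_def using summable_qvar[OF t0] qvar_nonneg[OF t0] by (rule suminf_nonneg)
  then have "has_bochner_integral (N t) (\<lambda>y. (norm y)\<^sup>2) (cov_trace t)"
    using nn by (intro has_bochner_integral_nn_integral) auto
  then show "integrable (N t) (\<lambda>y. (norm y)\<^sup>2)" "(LINT y|N t. (norm y)\<^sup>2) = cov_trace t"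
    by (simp_all add: has_bochner_integral_iff)
qed

lemma cov_trace_tendsto_0: "(cov_trace \<longlongrightarrow> 0) (at_right 0)"
proof -
  have "((\<lambda>t. \<Sum>k. qvar t k) \<longlongrightarrow> 0) (at_right 0)"
  proof (rule suminf_tendsto_0_at_right[OF _ _ l_summable])
    show "((\<lambda>t. qvar t k) \<longlongrightarrow> 0) (at_right 0)" for k
      unfolding qvar_def using l_pos[of k] by (auto intro!: tendsto_eq_intros)
    show "\<bar>qvar t k\<bar> \<le> inverse (l k)" if "t > 0" for k t
      using qvar_nonneg[of t k] qvar_le[of t k] l_pos[of k] that by simp
  qed
  then show ?thesis by (simp add: cov_trace_def[abs_def])
qed

text \<open>By Parseval the squared distance is a series dominated termwise by the squared coordinates of \<open>x\<close>.\<close>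

lemma semi_tendsto: "((\<lambda>t. semi t x) \<longlongrightarrow> x) (at_right 0)"
proof -
  have lim: "((\<lambda>t. \<Sum>k. (1 - exp (- t * l k))\<^sup>2 * (x \<bullet> e k)\<^sup>2) \<longlongrightarrow> 0) (at_right 0)"
  proof (rule suminf_tendsto_0_at_right[OF _ _ summable_coord_square[of x]])
    show "((\<lambda>t. (1 - exp (- t * l k))\<^sup>2 * (x \<bullet> e k)\<^sup>2) \<longlongrightarrow> 0) (at_right 0)" for k
      by (auto intro!: tendsto_eq_intros)
    show "\<bar>(1 - exp (- t * l k))\<^sup>2 * (x \<bullet> e k)\<^sup>2\<bar> \<le> (x \<bullet> e k)\<^sup>2" if "t > 0" for k t
    proof -
      have "(1 - exp (- t * l k))\<^sup>2 \<le> 1" using l_pos[of k] that by (intro power_le_one) auto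
      then show ?thesis by (simp add: mult_left_le_one_le)
    qed
  qed
  have "\<forall>\<^sub>F t in at_right (0::real). t > 0" by (simp add: eventually_at_right_less)
  then have "\<forall>\<^sub>F t in at_right 0. suminf (\<lambda>k. (1 - exp (- t * l k))\<^sup>2 * (x \<bullet> e k)\<^sup>2) = (norm (x - semi t x))\<^sup>2"
  proof eventually_elim
    case (elim t)
    have "(x - semi t x) \<bullet> e k = (1 - exp (- t * l k)) * (x \<bullet> e k)" for k
      using elim by (simp add: inner_diff_left semi_coord left_diff_distrib)
    then show ?case using sums_unique[OF parseval[of "x - semi t x"]] by (simp add: power_mult_distrib)
  qed
  then have "((\<lambda>t. (norm (x - semi t x))\<^sup>2) \<longlongrightarrow> 0) (at_right 0)"
    using lim by (simp cong: filterlim_cong add: tendsto_cong)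
  then have "((\<lambda>t. sqrt ((norm (x - semi t x))\<^sup>2)) \<longlongrightarrow> sqrt 0) (at_right 0)" by (rule tendsto_real_sqrt)
  then have "((\<lambda>t. x - semi t x) \<longlongrightarrow> 0) (at_right 0)" by (simp add: tendsto_norm_zero_iff)
  then have "((\<lambda>t. x - (x - semi t x)) \<longlongrightarrow> x - 0) (at_right 0)" by (intro tendsto_intros)
  then show ?thesis by simp
qed

lemma shift_tendsto: "(shift \<longlongrightarrow> 0) (at_right 0)"
proof -
  have "((\<lambda>t. z - semi t z) \<longlongrightarrow> z - z) (at_right 0)" by (intro tendsto_intros semi_tendsto)
  then have "((\<lambda>t. inv_sqrt (z - semi t z)) \<longlongrightarrow> inv_sqrt (z - z)) (at_right 0)"
    by (rule bounded_linear.tendsto[OF bounded_linear_inv_sqrt])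
  then show ?thesis
    using linear_0[OF bounded_linear.linear[OF bounded_linear_inv_sqrt]] by (simp add: shift_def[abs_def])
qed

text \<open>With \<open>m\<close> an upper bound for the second moment of the displacement, Young's inequality
\<open>s\<^bsup>\<theta>\<^esup> \<le> m\<^bsup>\<theta>/2\<^esup> + m\<^bsup>\<theta>/2-1\<^esup> s\<^sup>2\<close> reduces its moment of order \<open>\<theta>\<close> to the second one. The summand \<open>r\<close> in the
bound makes \<open>m\<close> positive.\<close>

lemma ou_near_identity:
  assumes r: "r > 0" and g: "holder_fun B K g"
  shows "\<bar>ou r g x - g x\<bar> \<le> 2 * K * (2 * (norm (semi r x - x + shift r))\<^sup>2 + 2 * cov_trace r + r) powr (\<theta> / 2)"
proof -
  interpret nondegenerate_gaussian e "N r" "cov r" using r by (rule nondegenerate)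
  note gD = holder_boundedD[OF g]
  define b where "b = semi r x - x + shift r"
  define m where "m = 2 * (norm b)\<^sup>2 + 2 * cov_trace r + r"
  have cov_trace: "cov_trace r \<ge> 0" unfolding cov_trace_def using summable_qvar[of r] qvar_nonneg[of r] r by (intro suminf_nonneg) auto
  have m: "m > 0" unfolding m_def using r cov_trace by (intro add_nonneg_pos) auto
  have i2: "integrable (N r) (\<lambda>y. (norm (b + y))\<^sup>2)" and m2: "(LINT y|N r. (norm (b + y))\<^sup>2) \<le> m"
  proof -
    have le: "(norm (b + y))\<^sup>2 \<le> 2 * (norm b)\<^sup>2 + 2 * (norm y)\<^sup>2" for y
    proof -
      have "(norm (b + y))\<^sup>2 \<le> (norm b + norm y)\<^sup>2" by (intro power_mono norm_triangle_ineq) simp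
      also have "\<dots> \<le> 2 * (norm b)\<^sup>2 + 2 * (norm y)\<^sup>2"
        using zero_le_power2[of "norm b - norm y"] by (simp add: power2_sum power2_diff)
      finally show ?thesis .
    qed
    have i1: "integrable (N r) (\<lambda>y. 2 * (norm b)\<^sup>2 + 2 * (norm y)\<^sup>2)"
      using second_moment(1)[OF r] by simp
    show i2: "integrable (N r) (\<lambda>y. (norm (b + y))\<^sup>2)"
      by (rule Bochner_Integration.integrable_bound[OF i1]) (use le in \<open>auto intro!: AE_I2\<close>)
    have "(LINT y|N r. (norm (b + y))\<^sup>2) \<le> (LINT y|N r. 2 * (norm b)\<^sup>2 + 2 * (norm y)\<^sup>2)"
      by (intro integral_mono i1 i2 le)
    also have "\<dots> = 2 * (norm b)\<^sup>2 + 2 * cov_trace r"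
      using second_moment[OF r] prob_space by simp
    finally show "(LINT y|N r. (norm (b + y))\<^sup>2) \<le> m" using r by (simp add: m_def)
  qed
  \<comment> \<open>for \<open>s \<le> sqrt m\<close> the first summand suffices, for larger \<open>s\<close> the second\<close>
  have young: "s powr \<theta> \<le> m powr (\<theta> / 2) + m powr (\<theta> / 2 - 1) * s\<^sup>2" if "s \<ge> 0" for s
  proof (cases "s \<le> sqrt m")
    case True
    have "s powr \<theta> \<le> sqrt m powr \<theta>" using True that \<theta> by (intro powr_mono2) auto
    also have "\<dots> = m powr (\<theta> / 2)" using m by (simp add: powr_half_sqrt[symmetric] powr_powr)
    finally show ?thesis by (simp add: add_increasing2)
  next
    case False
    then have s: "s > 0" "s\<^sup>2 \<ge> m" using m by (auto simp: not_le intro: less_trans[OF real_sqrt_gt_zero] real_less_rsqrt less_imp_le[OF real_sqrt_less_iff[THEN iffD1]] simp: real_sqrt_le_iff[of m "s\<^sup>2", symmetric] )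
    have "s powr \<theta> = (s\<^sup>2) powr (\<theta> / 2 - 1) * s\<^sup>2"
    proof -
      have "(s\<^sup>2) powr (\<theta> / 2 - 1) * s\<^sup>2 = (s\<^sup>2) powr (\<theta> / 2)" using s(1) by (simp add: powr_diff)
      moreover have "(s powr 2) powr (\<theta> / 2) = s powr \<theta>" unfolding powr_powr by simp
      moreover have "s powr 2 = s\<^sup>2" using s(1) by simp
      ultimately show ?thesis by (simp only:)
    qed
    also have "(s\<^sup>2) powr (\<theta> / 2 - 1) * s\<^sup>2 \<le> m powr (\<theta> / 2 - 1) * s\<^sup>2"
      using s m \<theta> by (intro mult_right_mono powr_mono2') auto
    finally show ?thesis by (simp add: add_increasing)
  qed
  have "ou r g x - g x = (LINT y|N r. g (semi r x + y + shift r) - g x)"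
    unfolding ou_def using integrable_N[OF _ holder_fun_shift_meas[OF g] gD(2)] r prob_space by simp
  then have "\<bar>ou r g x - g x\<bar> \<le> (LINT y|N r. \<bar>g (semi r x + y + shift r) - g x\<bar>)"
    by (simp add: integral_abs_bound)
  also have "\<dots> \<le> (LINT y|N r. K * (m powr (\<theta> / 2) + m powr (\<theta> / 2 - 1) * (norm (b + y))\<^sup>2))"
  proof (rule integral_mono)
    show "integrable (N r) (\<lambda>y. \<bar>g (semi r x + y + shift r) - g x\<bar>)"
      using integrable_N[OF _ holder_fun_shift_meas[OF g] gD(2)] r by simp
    show "integrable (N r) (\<lambda>y. K * (m powr (\<theta> / 2) + m powr (\<theta> / 2 - 1) * (norm (b + y))\<^sup>2))"
      using i2 by simp
    fix y
    have "\<bar>g (semi r x + y + shift r) - g x\<bar> \<le> K * norm (b + y) powr \<theta>"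
      using gD(3)[of "semi r x + y + shift r" x] by (simp add: b_def algebra_simps)
    also have "\<dots> \<le> K * (m powr (\<theta> / 2) + m powr (\<theta> / 2 - 1) * (norm (b + y))\<^sup>2)"
      using gD(1) by (intro mult_left_mono young) auto
    finally show "\<bar>g (semi r x + y + shift r) - g x\<bar> \<le> K * (m powr (\<theta> / 2) + m powr (\<theta> / 2 - 1) * (norm (b + y))\<^sup>2)" .
  qed
  also have "\<dots> = K * (m powr (\<theta> / 2) + m powr (\<theta> / 2 - 1) * (LINT y|N r. (norm (b + y))\<^sup>2))"
    using i2 prob_space by simp
  also have "\<dots> \<le> K * (m powr (\<theta> / 2) + m powr (\<theta> / 2 - 1) * m)"
    using gD(1) m2 by (intro mult_left_mono add_left_mono) auto
  also have "m powr (\<theta> / 2 - 1) * m = m powr (\<theta> / 2)" using m by (simp add: powr_diff)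
  finally show ?thesis unfolding m_def b_def by (simp add: mult.assoc)
qed

text \<open>This is for measurability in \<open>t\<close>, without which the time integral in the definition of the resolvent
would be the default value \<open>0\<close>.\<close>

lemma ou_right_continuous:
  assumes t: "t \<ge> 0" and f: "holder_fun B K f"
  shows "((\<lambda>r. ou (t + r) f x) \<longlongrightarrow> ou t f x) (at_right 0)"
proof (rule LIM_zero_cancel, rule Lim_null_comparison)
  have "\<forall>\<^sub>F r in at_right (0::real). r > 0" by (simp add: eventually_at_right_less)
  then show "\<forall>\<^sub>F r in at_right 0. norm (ou (t + r) f x - ou t f x)
      \<le> 2 * K * (2 * (norm (semi r x - x + shift r))\<^sup>2 + 2 * cov_trace r + r) powr (\<theta> / 2)"
  proof eventually_elim
    case (elim r)
    then show ?case using ou_near_identity[OF elim ou_holder_fun[OF t f]] ou_semigroup[OF t _ f, of r] by simp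
  qed
  have "((\<lambda>r. 2 * (norm (semi r x - x + shift r))\<^sup>2 + 2 * cov_trace r + r) \<longlongrightarrow> 2 * (norm (x - x + 0))\<^sup>2 + 2 * 0 + 0) (at_right 0)"
    by (intro tendsto_intros semi_tendsto shift_tendsto cov_trace_tendsto_0)
  then have l: "((\<lambda>r. 2 * (norm (semi r x - x + shift r))\<^sup>2 + 2 * cov_trace r + r) \<longlongrightarrow> 0) (at_right 0)" by simp
  have "\<forall>\<^sub>F r in at_right (0::real). r > 0" by (simp add: eventually_at_right_less)
  then have ev: "\<forall>\<^sub>F r in at_right 0. 0 \<le> 2 * (norm (semi r x - x + shift r))\<^sup>2 + 2 * cov_trace r + r"
  proof eventually_elim
    case (elim r)
    have "cov_trace r \<ge> 0" unfolding cov_trace_def using summable_qvar[of r] qvar_nonneg[of r] elim by (intro suminf_nonneg) auto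
    then show ?case using elim by simp
  qed
  have "((\<lambda>r. (2 * (norm (semi r x - x + shift r))\<^sup>2 + 2 * cov_trace r + r) powr (\<theta> / 2)) \<longlongrightarrow> 0 powr (\<theta> / 2)) (at_right 0)"
    by (rule tendsto_powr2[OF l tendsto_const ev]) (use \<theta> in simp)
  then show "((\<lambda>r. 2 * K * (2 * (norm (semi r x - x + shift r))\<^sup>2 + 2 * cov_trace r + r) powr (\<theta> / 2)) \<longlongrightarrow> 0) (at_right 0)"
    by (intro tendsto_mult_right_zero) simp
qed

text \<open>A right-continuous function is the limit of its samples on grids of mesh \<open>1 / Suc n\<close> approached from the
right.\<close>

lemma ou_time_measurable:
  assumes f: "holder_fun B K f"
  shows "(\<lambda>t. indicator {0..} t * ou t f x) \<in> borel_measurable borel"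
proof (rule borel_measurable_LIMSEQ_metric)
  \<comment> \<open>grid points strictly to the right of \<open>t\<close>, at distance at most \<open>1 / Suc n\<close>\<close>
  define T where "T n t = (real_of_int \<lfloor>real (Suc n) * t\<rfloor> + 1) / real (Suc n)" for n t
  show "(\<lambda>t. indicator {0..} t * ou (T n t) f x) \<in> borel_measurable borel" for n
  proof -
    have "(\<lambda>i::int. ou ((real_of_int i + 1) / real (Suc n)) f x) \<in> borel_measurable (count_space UNIV)" by simp
    moreover have "(\<lambda>t. \<lfloor>real (Suc n) * t\<rfloor>) \<in> measurable borel (count_space UNIV)" by measurable
    ultimately have "(\<lambda>t. ou (T n t) f x) \<in> borel_measurable borel"
      unfolding T_def by (rule measurable_compose[rotated])
    then show ?thesis by measurable
  qed
  fix t :: real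
  show "(\<lambda>n. indicator {0..} t * ou (T n t) f x) \<longlonglongrightarrow> indicator {0..} t * ou t f x"
  proof (cases "t \<ge> 0")
    case True
    have gt: "T n t - t > 0" and le: "T n t - t \<le> 1 / real (Suc n)" for n
    proof -
      have "real_of_int \<lfloor>real (Suc n) * t\<rfloor> \<le> real (Suc n) * t" "real (Suc n) * t < real_of_int \<lfloor>real (Suc n) * t\<rfloor> + 1"
        by linarith+
      then show "T n t - t > 0" "T n t - t \<le> 1 / real (Suc n)"
        unfolding T_def by (simp_all add: field_simps del: of_nat_Suc)
    qed
    have "(\<lambda>n. T n t - t) \<longlonglongrightarrow> 0"
      by (rule tendsto_sandwich[OF _ _ tendsto_const lim_1_over_n[THEN LIMSEQ_Suc]])
         (use gt le in \<open>auto intro!: always_eventually less_imp_le\<close>)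
    moreover have "T n t - t \<noteq> 0" for n using gt[of n] by linarith
    ultimately have "filterlim (\<lambda>n. T n t - t) (at_right 0) sequentially"
      using gt by (auto simp: filterlim_at intro!: always_eventually)
    then have "(\<lambda>n. ou (t + (T n t - t)) f x) \<longlonglongrightarrow> ou t f x"
      by (rule filterlim_compose[OF ou_right_continuous[OF True f]])
    then show ?thesis by (simp add: True)
  qed simp
qed

text \<open>Derivatives in directions \<open>h\<close> are limits of difference quotients of \<open>ou\<close>; the functional at a general \<open>k\<close> is
a series of such derivatives, since the basis vectors lie in the range of \<open>(-A)\<^bsup>-1/2\<^esup>\<close>.\<close>

lemma ou_deriv_time_measurable:
  assumes f: "holder_fun B K f"
  shows "(\<lambda>t. indicator {0<..} t * ou_deriv t f x (whiten_sqrt t k)) \<in> borel_measurable borel"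
proof -
  have 1: "(\<lambda>t. indicator {0<..} t * ou_deriv t f x (whiten t h)) \<in> borel_measurable borel" for h
  proof (rule borel_measurable_LIMSEQ_metric)
    show "(\<lambda>t. indicator {0<..} t * ((indicator {0..} t * ou t f (x + (1 / real (Suc n)) *\<^sub>R h) - indicator {0..} t * ou t f x) / (1 / real (Suc n))))
      \<in> borel_measurable borel" for n
      using ou_time_measurable[OF f] by measurable
    fix t :: real
    show "(\<lambda>n. indicator {0<..} t * ((indicator {0..} t * ou t f (x + (1 / real (Suc n)) *\<^sub>R h) - indicator {0..} t * ou t f x) / (1 / real (Suc n))))
      \<longlonglongrightarrow> indicator {0<..} t * ou_deriv t f x (whiten t h)"
    proof (cases "t > 0")
      case True
      have "((\<lambda>\<tau>. (ou t f (x + \<tau> *\<^sub>R h) - ou t f x) / \<tau>) \<longlongrightarrow> ou_deriv t f x (whiten t h)) (at 0)"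
        using ou_has_derivative[OF True f, of x h 0] by (simp add: DERIV_def)
      moreover have "filterlim (\<lambda>n. 1 / real (Suc n)) (at 0) sequentially"
        using lim_1_over_n[THEN LIMSEQ_Suc] by (auto simp: filterlim_at intro!: always_eventually)
      ultimately have "(\<lambda>n. (ou t f (x + (1 / real (Suc n)) *\<^sub>R h) - ou t f x) / (1 / real (Suc n))) \<longlonglongrightarrow> ou_deriv t f x (whiten t h)"
        by (rule filterlim_compose)
      then show ?thesis using True by simp
    qed simp
  qed
  show ?thesis
  proof (rule borel_measurable_LIMSEQ_metric)
    let ?h = "\<lambda>j. sqrt (l j) *\<^sub>R e j"
    show "(\<lambda>t. \<Sum>j<n. (k \<bullet> e j) * (indicator {0<..} t * ou_deriv t f x (whiten t (?h j)))) \<in> borel_measurable borel" for n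
      by (intro borel_measurable_sum borel_measurable_times borel_measurable_const 1)
    fix t :: real
    show "(\<lambda>n. \<Sum>j<n. (k \<bullet> e j) * (indicator {0<..} t * ou_deriv t f x (whiten t (?h j)))) \<longlonglongrightarrow> indicator {0<..} t * ou_deriv t f x (whiten_sqrt t k)"
    proof (cases "t > 0")
      case True
      interpret F: bounded_linear "\<lambda>k. ou_deriv t f x (whiten_sqrt t k)" using True f by (rule ou_deriv_whiten_sqrt_linear)
      have "(\<lambda>j. ou_deriv t f x (whiten_sqrt t ((k \<bullet> e j) *\<^sub>R e j))) sums ou_deriv t f x (whiten_sqrt t k)"
        by (rule F.sums[OF basis_expansion])
      moreover have "ou_deriv t f x (whiten_sqrt t ((k \<bullet> e j) *\<^sub>R e j)) = (k \<bullet> e j) * ou_deriv t f x (whiten t (?h j))" for j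
      proof -
        have "inv_sqrt (?h j) = e j"
          using l_pos[THEN less_imp_neq, THEN not_sym] by (intro coord_eqI) (auto simp: inv_sqrt_coord inner_basis)
        then have "whiten t (?h j) = whiten_sqrt t (e j)" using whiten_sqrt_inv_sqrt[OF True, of "?h j"] by simp
        then show ?thesis using F.scaleR[of "k \<bullet> e j" "e j"] by simp
      qed
      ultimately show ?thesis using True by (simp add: sums_def)
    qed simp
  qed
qed

end

section \<open>The resolvent\<close>

context ornstein_uhlenbeck
begin

abbreviation ou_integrand :: "real set \<Rightarrow> real \<Rightarrow> ('a \<Rightarrow> real) \<Rightarrow> 'a \<Rightarrow> real \<Rightarrow> real" where
  "ou_integrand T \<mu> f x t \<equiv> indicator T t * (exp (- \<mu> * t) * ou t f x)"

abbreviation deriv_integrand :: "real \<Rightarrow> ('a \<Rightarrow> real) \<Rightarrow> 'a \<Rightarrow> 'a \<Rightarrow> real \<Rightarrow> real" where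
  "deriv_integrand \<mu> f x k t \<equiv> indicator {0<..} t * (exp (- \<mu> * t) * ou_deriv t f x (whiten_sqrt t k))"

definition res :: "real \<Rightarrow> ('a \<Rightarrow> real) \<Rightarrow> 'a \<Rightarrow> real" where
  "res \<mu> f x = (LINT t|lborel. ou_integrand {0..} \<mu> f x t)"

text \<open>The pairing of \<open>(-A)\<^bsup>1/2\<^esup> D u(x)\<close> with \<open>k\<close>, once \<open>res\<close> is known to be differentiable. It is defined for
every \<open>k\<close> in the space.\<close>

definition res_deriv :: "real \<Rightarrow> ('a \<Rightarrow> real) \<Rightarrow> 'a \<Rightarrow> 'a \<Rightarrow> real" where
  "res_deriv \<mu> f x k = (LINT t|lborel. deriv_integrand \<mu> f x k t)"

definition sup_const :: "real \<Rightarrow> real" where "sup_const \<mu> = 2 * (2 / \<theta> + 1) * \<mu> powr (- \<theta> / 2)"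
definition holder_const :: real where "holder_const = 8 / \<theta> + 16 / (1 - \<theta>)"

lemma res_integrand_measurable:
  assumes "holder_fun B K f"
  shows "(\<lambda>t. ou_integrand {0..} \<mu> f x t) \<in> borel_measurable borel"
proof -
  have "(\<lambda>t. exp (- \<mu> * t) * (indicator {0..} t * ou t f x)) \<in> borel_measurable borel"
    using ou_time_measurable[OF assms, of x] by measurable
  then show ?thesis by (simp add: mult.left_commute)
qed

lemma res_deriv_integrand_measurable:
  assumes "holder_fun B K f"
  shows "(\<lambda>t. deriv_integrand \<mu> f x k t) \<in> borel_measurable borel"
proof -
  have "(\<lambda>t. exp (- \<mu> * t) * (indicator {0<..} t * ou_deriv t f x (whiten_sqrt t k))) \<in> borel_measurable borel"
    using ou_deriv_time_measurable[OF assms, of x k] by measurable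
  then show ?thesis by (simp add: mult.left_commute)
qed

lemma res_integrand_bound:
  assumes f: "holder_fun B K f"
  shows "\<bar>ou_integrand {0..} \<mu> f x t\<bar> \<le> B * (indicator {0..} t * exp (- \<mu> * t))"
proof (cases "t \<ge> 0")
  case True
  then show ?thesis
    using mult_left_mono[OF holder_boundedD(2)[OF ou_holder_fun[OF True f], of x], of "exp (- \<mu> * t)"]
    by (simp add: abs_mult mult.commute)
qed simp

lemma res_integrable:
  assumes \<mu>: "\<mu> > 0" and f: "holder_fun B K f"
  shows "integrable lborel (\<lambda>t. ou_integrand {0..} \<mu> f x t)"
proof (rule Bochner_Integration.integrable_bound)
  show "integrable lborel (\<lambda>t. B * (indicator {0..} t * exp (- \<mu> * t)))"
    by (intro integrable_mult_right integrable.intros[OF exp_integral_to_inf[OF \<mu>]])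
  show "(\<lambda>t. ou_integrand {0..} \<mu> f x t) \<in> borel_measurable lborel"
    using res_integrand_measurable[OF f] by simp
  show "AE t in lborel. norm (ou_integrand {0..} \<mu> f x t) \<le> norm (B * (indicator {0..} t * exp (- \<mu> * t)))"
    using order_trans[OF res_integrand_bound[OF f] abs_ge_self] by (intro AE_I2) (simp only: real_norm_def)
qed

lemma res_bound:
  assumes \<mu>: "\<mu> > 0" and f: "holder_fun B K f"
  shows "\<bar>res \<mu> f x\<bar> \<le> B / \<mu>"
proof -
  note e = exp_integral_to_inf[OF \<mu>, of 0]
  have "\<bar>res \<mu> f x\<bar> \<le> (LINT t|lborel. \<bar>ou_integrand {0..} \<mu> f x t\<bar>)"
    unfolding res_def by (rule integral_abs_bound)
  also have "\<dots> \<le> (LINT t|lborel. B * (indicator {0..} t * exp (- \<mu> * t)))"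
    by (intro integral_mono integrable_abs res_integrable[OF \<mu> f] integrable_mult_right integrable.intros[OF e]
        res_integrand_bound[OF f])
  also have "\<dots> = B * (1 / \<mu>)"
    unfolding integral_mult_right_zero has_bochner_integral_integral_eq[OF e] by simp
  finally show ?thesis by simp
qed

lemma res_eq:
  assumes f: "holder_fun B K f"
  shows "res \<mu> f x = (LINT t|lborel. ou_integrand {0<..} \<mu> f x t)"
  unfolding res_def
proof (rule integral_cong_AE)
  have "AE t in lborel. t \<noteq> (0::real)" by (rule AE_lborel_singleton)
  then show "AE t in lborel. ou_integrand {0..} \<mu> f x t = ou_integrand {0<..} \<mu> f x t"
    by eventually_elim (auto simp: indicator_def)
  show "(\<lambda>t. ou_integrand {0..} \<mu> f x t) \<in> borel_measurable lborel"
    using res_integrand_measurable[OF f] by simp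
  have "(\<lambda>t. indicator {0<..} t * (ou_integrand {0..} \<mu> f x t)) \<in> borel_measurable lborel"
    using res_integrand_measurable[OF f, of \<mu> x] by measurable
  moreover have "(\<lambda>t. indicator {0<..} t * (ou_integrand {0..} \<mu> f x t))
      = (\<lambda>t. ou_integrand {0<..} \<mu> f x t)"
    by (auto simp: indicator_def)
  ultimately show "(\<lambda>t. ou_integrand {0<..} \<mu> f x t) \<in> borel_measurable lborel" by simp
qed

lemma res_integrable':
  assumes \<mu>: "\<mu> > 0" and f: "holder_fun B K f"
  shows "integrable lborel (\<lambda>t. ou_integrand {0<..} \<mu> f x t)"
proof -
  have "integrable lborel (\<lambda>t. indicator {0<..} t * (ou_integrand {0..} \<mu> f x t))"
    by (rule Bochner_Integration.integrable_bound[OF res_integrable[OF \<mu> f, of x]])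
      (use res_integrand_measurable[OF f, of \<mu> x] in \<open>auto simp: indicator_def\<close>)
  moreover have "(\<lambda>t. indicator {0<..} t * (ou_integrand {0..} \<mu> f x t))
      = (\<lambda>t. ou_integrand {0<..} \<mu> f x t)"
    by (auto simp: indicator_def)
  ultimately show ?thesis by simp
qed

lemma res_deriv_integrand_bound:
  assumes f: "holder_fun B K f"
  shows "\<bar>deriv_integrand \<mu> f x k t\<bar>
    \<le> 2 * K * norm k * (laplace_kernel \<theta> \<mu> t)"
proof (cases "t > 0")
  case True
  then show ?thesis
    using mult_left_mono[OF ou_deriv_whiten_sqrt_bound[OF True f, of x k], of "exp (- \<mu> * t)"]
    by (simp add: abs_mult mult_ac)
qed simp

lemma res_deriv_integrable:
  assumes \<mu>: "\<mu> > 0" and f: "holder_fun B K f"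
  shows "integrable lborel (\<lambda>t. deriv_integrand \<mu> f x k t)"
proof (rule Bochner_Integration.integrable_bound)
  show "integrable lborel (\<lambda>t. 2 * K * norm k * (laplace_kernel \<theta> \<mu> t))"
    by (intro integrable_mult_right laplace_powr_bound \<theta> \<mu>)
  show "(\<lambda>t. deriv_integrand \<mu> f x k t) \<in> borel_measurable lborel"
    using res_deriv_integrand_measurable[OF f] by simp
  show "AE t in lborel. norm (deriv_integrand \<mu> f x k t)
      \<le> norm (2 * K * norm k * (laplace_kernel \<theta> \<mu> t))"
    using order_trans[OF res_deriv_integrand_bound[OF f] abs_ge_self] by (intro AE_I2) (simp only: real_norm_def)
qed

lemma res_deriv_bound:
  assumes \<mu>: "\<mu> > 0" and f: "holder_fun B K f"
  shows "\<bar>res_deriv \<mu> f x k\<bar> \<le> sup_const \<mu> * K * norm k"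
proof -
  have "\<bar>res_deriv \<mu> f x k\<bar> \<le> (LINT t|lborel. \<bar>deriv_integrand \<mu> f x k t\<bar>)"
    unfolding res_deriv_def by (rule integral_abs_bound)
  also have "\<dots> \<le> (LINT t|lborel. 2 * K * norm k * (laplace_kernel \<theta> \<mu> t))"
    by (intro integral_mono integrable_abs res_deriv_integrable[OF \<mu> f] integrable_mult_right laplace_powr_bound \<theta> \<mu>
        res_deriv_integrand_bound[OF f])
  also have "\<dots> \<le> 2 * K * norm k * ((2 / \<theta> + 1) * \<mu> powr (- \<theta> / 2))"
    unfolding integral_mult_right_zero
    using holder_boundedD(1)[OF f] by (intro mult_left_mono laplace_powr_bound \<theta> \<mu>) auto
  finally show ?thesis unfolding sup_const_def by (simp only: mult_ac)
qed

lemma res_deriv_linear: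
  assumes \<mu>: "\<mu> > 0" and f: "holder_fun B K f"
  shows "bounded_linear (res_deriv \<mu> f x)"
proof (rule bounded_linear_intro)
  note i = res_deriv_integrable[OF \<mu> f]
  have lin: "ou_deriv t f x (whiten_sqrt t (k + k')) = ou_deriv t f x (whiten_sqrt t k) + ou_deriv t f x (whiten_sqrt t k')"
    "ou_deriv t f x (whiten_sqrt t (c *\<^sub>R k)) = c * ou_deriv t f x (whiten_sqrt t k)" if "t > 0" for t k k' c
  proof -
    interpret F: bounded_linear "\<lambda>k. ou_deriv t f x (whiten_sqrt t k)" using that f by (rule ou_deriv_whiten_sqrt_linear)
    show "ou_deriv t f x (whiten_sqrt t (k + k')) = ou_deriv t f x (whiten_sqrt t k) + ou_deriv t f x (whiten_sqrt t k')"
      "ou_deriv t f x (whiten_sqrt t (c *\<^sub>R k)) = c * ou_deriv t f x (whiten_sqrt t k)" by (simp_all add: F.add F.scaleR)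
  qed
  show "res_deriv \<mu> f x (k + k') = res_deriv \<mu> f x k + res_deriv \<mu> f x k'" for k k'
    unfolding res_deriv_def Bochner_Integration.integral_add[OF i i, symmetric]
    by (intro Bochner_Integration.integral_cong refl) (auto simp: indicator_def lin distrib_left)
  show "res_deriv \<mu> f x (c *\<^sub>R k) = c *\<^sub>R res_deriv \<mu> f x k" for c k
    unfolding res_deriv_def real_scaleR_def integral_mult_right_zero[symmetric]
    by (intro Bochner_Integration.integral_cong refl) (auto simp: indicator_def lin)
  show "norm (res_deriv \<mu> f x k) \<le> norm k * (sup_const \<mu> * K)" for k
    using res_deriv_bound[OF \<mu> f, of x k] by (simp add: mult_ac)
qed

text \<open>This serves both the Hoelder estimate, where \<open>x'\<close> is constant in \<open>t\<close>, and the Taylor remainder, where \<open>x'\<close> is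
an intermediate point of the mean value theorem and depends on \<open>t\<close>.\<close>

lemma res_deriv_two_scale:
  assumes \<mu>: "\<mu> > 0" and f: "holder_fun B K f" and d: "d > 0" and h: "h \<in> borel_measurable borel" "\<And>t. t \<le> 0 \<Longrightarrow> h t = 0"
    and step: "\<And>t. t > 0 \<Longrightarrow> \<exists>x'. norm (x' - x) \<le> d \<and> h t = exp (- \<mu> * t) * (ou_deriv t f x' (whiten_sqrt t k) - ou_deriv t f x (whiten_sqrt t k))"
  shows "\<bar>LINT t|lborel. h t\<bar> \<le> holder_const * K * norm k * d powr \<theta>"
proof -
  have K: "K \<ge> 0" by (rule holder_boundedD[OF f])
  have e: "exp (- \<mu> * t) \<le> 1" if "t > 0" for t using \<mu> that by simp
  have "\<bar>LINT t|lborel. h t\<bar> \<le> (2 / \<theta> * (4 * K * norm k) + 2 / (1 - \<theta>) * (8 * K * norm k)) * d powr \<theta>"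
  proof (rule two_scale_bound[OF \<theta> d _ _ h])
    fix t :: real assume t: "t > 0"
    from step[OF t] obtain x' where x': "norm (x' - x) \<le> d"
      and ht: "h t = exp (- \<mu> * t) * (ou_deriv t f x' (whiten_sqrt t k) - ou_deriv t f x (whiten_sqrt t k))" by blast
    have "\<bar>h t\<bar> \<le> 1 * \<bar>ou_deriv t f x' (whiten_sqrt t k) - ou_deriv t f x (whiten_sqrt t k)\<bar>"
      unfolding ht abs_mult using e[OF t] by (intro mult_right_mono) auto
    then have h: "\<bar>h t\<bar> \<le> \<bar>ou_deriv t f x' (whiten_sqrt t k) - ou_deriv t f x (whiten_sqrt t k)\<bar>" by simp
    also have "\<dots> \<le> \<bar>ou_deriv t f x' (whiten_sqrt t k)\<bar> + \<bar>ou_deriv t f x (whiten_sqrt t k)\<bar>" by (rule abs_triangle_ineq4)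
    also have "\<dots> \<le> 4 * K * norm k * t powr (\<theta> / 2 - 1)"
      using ou_deriv_whiten_sqrt_bound[OF t f, of x' k] ou_deriv_whiten_sqrt_bound[OF t f, of x k] by (simp add: mult_ac)
    finally show "\<bar>h t\<bar> \<le> 4 * K * norm k * t powr (\<theta> / 2 - 1)" .
    have "\<bar>h t\<bar> \<le> 8 * K * t powr (\<theta> / 2 - 3 / 2) * norm (x' - x) * norm k"
      using h ou_deriv_whiten_sqrt_lipschitz[OF t f, of x' k x] by linarith
    also have "\<dots> \<le> 8 * K * t powr (\<theta> / 2 - 3 / 2) * d * norm k"
      using K x' by (intro mult_right_mono mult_left_mono) auto
    finally show "\<bar>h t\<bar> \<le> 8 * K * norm k * d * t powr (\<theta> / 2 - 3 / 2)" by (simp add: mult_ac)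
  qed (use K in auto)
  also have "\<dots> = holder_const * K * norm k * d powr \<theta>" by (simp add: holder_const_def algebra_simps)
  finally show ?thesis .
qed

lemma res_deriv_holder:
  assumes \<mu>: "\<mu> > 0" and f: "holder_fun B K f"
  shows "\<bar>res_deriv \<mu> f x k - res_deriv \<mu> f x' k\<bar> \<le> holder_const * K * norm k * norm (x - x') powr \<theta>"
proof (cases "x = x'")
  case False
  note i = res_deriv_integrable[OF \<mu> f]
  have "res_deriv \<mu> f x k - res_deriv \<mu> f x' k = (LINT t|lborel. deriv_integrand \<mu> f x k t
      - deriv_integrand \<mu> f x' k t)"
    unfolding res_deriv_def by (rule Bochner_Integration.integral_diff[OF i i, symmetric])
  moreover have "\<bar>LINT t|lborel. deriv_integrand \<mu> f x k t
      - deriv_integrand \<mu> f x' k t\<bar> \<le> holder_const * K * norm k * norm (x - x') powr \<theta>"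
  proof (rule res_deriv_two_scale[OF \<mu> f])
    show "(\<lambda>t. deriv_integrand \<mu> f x k t
      - deriv_integrand \<mu> f x' k t) \<in> borel_measurable borel"
      by (intro borel_measurable_diff res_deriv_integrand_measurable[OF f])
    fix t :: real assume "t > 0"
    then show "\<exists>y. norm (y - x') \<le> norm (x - x') \<and> deriv_integrand \<mu> f x k t
      - deriv_integrand \<mu> f x' k t = exp (- \<mu> * t) * (ou_deriv t f y (whiten_sqrt t k) - ou_deriv t f x' (whiten_sqrt t k))"
      by (intro exI[of _ x]) (simp add: right_diff_distrib)
  qed (use False in auto)
  ultimately show ?thesis by simp
qed simp

text \<open>For each \<open>t\<close> the mean value theorem turns the remainder of \<open>P\<^sub>t f\<close> into a difference of derivatives at two
points of distance at most \<open>norm h\<close>.\<close>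

lemma res_taylor:
  assumes \<mu>: "\<mu> > 0" and f: "holder_fun B K f"
  shows "\<bar>res \<mu> f (x + h) - res \<mu> f x - res_deriv \<mu> f x (inv_sqrt h)\<bar> \<le> holder_const * K * norm (inv_sqrt h) * norm h powr \<theta>"
proof (cases "h = 0")
  case False
  note i = res_deriv_integrable[OF \<mu> f] and i' = res_integrable'[OF \<mu> f]
  let ?F = "\<lambda>t. ou_integrand {0<..} \<mu> f (x + h) t - ou_integrand {0<..} \<mu> f x t
      - deriv_integrand \<mu> f x (inv_sqrt h) t"
  have "res \<mu> f (x + h) - res \<mu> f x - res_deriv \<mu> f x (inv_sqrt h) = (LINT t|lborel. ?F t)"
    unfolding res_deriv_def res_eq[OF f] using i i' by simp
  moreover have "\<bar>LINT t|lborel. ?F t\<bar> \<le> holder_const * K * norm (inv_sqrt h) * norm h powr \<theta>"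
  proof (rule res_deriv_two_scale[OF \<mu> f])
    have "integrable lborel ?F" by (intro Bochner_Integration.integrable_diff i i')
    then show "?F \<in> borel_measurable borel" using borel_measurable_integrable by force
    fix t :: real assume t: "t > 0"
    obtain x' where x': "norm (x' - x) \<le> norm h" "ou t f (x + h) - ou t f x = ou_deriv t f x' (whiten t h)"
      by (rule mean_value[OF t f])
    have "?F t = exp (- \<mu> * t) * ((ou t f (x + h) - ou t f x) - ou_deriv t f x (whiten_sqrt t (inv_sqrt h)))"
      using t by (simp add: right_diff_distrib)
    then show "\<exists>x'. norm (x' - x) \<le> norm h \<and> ?F t = exp (- \<mu> * t) * (ou_deriv t f x' (whiten_sqrt t (inv_sqrt h)) - ou_deriv t f x (whiten_sqrt t (inv_sqrt h)))"
      using x' by (intro exI[of _ x']) (simp add: whiten_sqrt_inv_sqrt[OF t])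
  qed (use False in auto)
  ultimately show ?thesis by simp
next
  case True
  have "inv_sqrt 0 = 0" by (rule linear_0[OF bounded_linear.linear[OF bounded_linear_inv_sqrt]])
  moreover have "res_deriv \<mu> f x 0 = 0" by (rule linear_0[OF bounded_linear.linear[OF res_deriv_linear[OF \<mu> f]]])
  ultimately show ?thesis using True by simp
qed

text \<open>The vector \<open>(-A)\<^bsup>1/2\<^esup> D u(x)\<close>, obtained by Riesz representation before \<open>D u(x)\<close> is known to exist.\<close>

definition sqrt_grad :: "real \<Rightarrow> ('a \<Rightarrow> real) \<Rightarrow> 'a \<Rightarrow> 'a" where
  "sqrt_grad \<mu> f x = (SOME v. \<forall>k. res_deriv \<mu> f x k = v \<bullet> k)"

lemma sqrt_grad_inner:
  assumes "\<mu> > 0" "holder_fun B K f"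
  shows "sqrt_grad \<mu> f x \<bullet> k = res_deriv \<mu> f x k"
proof -
  obtain v where "\<And>k. res_deriv \<mu> f x k = v \<bullet> k" using riesz_representation[OF res_deriv_linear[OF assms]] by blast
  then have "\<exists>v. \<forall>k. res_deriv \<mu> f x k = v \<bullet> k" by blast
  then have "\<forall>k. res_deriv \<mu> f x k = sqrt_grad \<mu> f x \<bullet> k" unfolding sqrt_grad_def by (rule someI_ex)
  then have "res_deriv \<mu> f x k = sqrt_grad \<mu> f x \<bullet> k" by (rule spec)
  then show ?thesis by (rule sym)
qed

lemma norm_le_if_inner_le:
  assumes "\<And>k. \<bar>v \<bullet> k\<bar> \<le> C * norm k"
  shows "norm (v::'a) \<le> C"
proof (cases "v = 0")
  case True
  show ?thesis using assms[of "e 0"] True by simp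
next
  case False
  have "norm v * norm v \<le> C * norm v" using assms[of v] by (simp add: norm_eq_sqrt_inner)
  then show ?thesis using False by simp
qed

lemma sqrt_grad_bound:
  assumes "\<mu> > 0" "holder_fun B K f"
  shows "norm (sqrt_grad \<mu> f x) \<le> sup_const \<mu> * K"
  by (rule norm_le_if_inner_le) (simp only: sqrt_grad_inner[OF assms] res_deriv_bound[OF assms])

lemma sqrt_grad_holder:
  assumes "\<mu> > 0" "holder_fun B K f"
  shows "norm (sqrt_grad \<mu> f x - sqrt_grad \<mu> f x') \<le> holder_const * K * norm (x - x') powr \<theta>"
proof (rule norm_le_if_inner_le)
  show "\<bar>(sqrt_grad \<mu> f x - sqrt_grad \<mu> f x') \<bullet> k\<bar> \<le> holder_const * K * norm (x - x') powr \<theta> * norm k" for k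
    using res_deriv_holder[OF assms, of x k x'] by (simp add: inner_diff_left sqrt_grad_inner[OF assms] mult_ac)
qed

lemma holder_const_pos: "holder_const > 0" using \<theta> by (simp add: holder_const_def add_pos_pos)

text \<open>\<open>(-A)\<^bsup>-1/2\<^esup>\<close> is symmetric, so \<open>res_deriv\<close> at \<open>inv_sqrt h\<close> is the pairing of \<open>inv_sqrt (sqrt_grad \<mu> f x)\<close> with
\<open>h\<close>; the Taylor remainder is of order \<open>norm h powr (1 + \<theta>)\<close>.\<close>

lemma res_gderiv:
  assumes \<mu>: "\<mu> > 0" and f: "holder_fun B K f"
  shows "GDERIV (res \<mu> f) x :> inv_sqrt (sqrt_grad \<mu> f x)"
  unfolding gderiv_def has_derivative_iff_norm
proof (intro conjI)
  show "bounded_linear (\<lambda>h. h \<bullet> inv_sqrt (sqrt_grad \<mu> f x))" by (rule bounded_linear_inner_left)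
  have K: "K \<ge> 0" by (rule holder_boundedD[OF f])
  have lim: "((\<lambda>y. holder_const * K * sqrt inv_l_sum * norm (y - x) powr \<theta>) \<longlongrightarrow> 0) (at x)"
  proof -
    have "((\<lambda>y. norm (y - x)) \<longlongrightarrow> norm (x - x)) (at x)" by (intro tendsto_intros)
    then have "((\<lambda>y. norm (y - x) powr \<theta>) \<longlongrightarrow> 0 powr \<theta>) (at x)"
      by (intro tendsto_powr2[OF _ tendsto_const]) (simp_all add: \<theta>)
    then show ?thesis by (intro tendsto_mult_right_zero) simp
  qed
  show "((\<lambda>y. norm (res \<mu> f y - res \<mu> f x - (y - x) \<bullet> inv_sqrt (sqrt_grad \<mu> f x)) / norm (y - x)) \<longlongrightarrow> 0) (at x)"
  proof (rule Lim_null_comparison[OF _ lim], rule always_eventually, rule allI)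
    fix y
    have "(y - x) \<bullet> inv_sqrt (sqrt_grad \<mu> f x) = res_deriv \<mu> f x (inv_sqrt (y - x))"
      by (metis sqrt_grad_inner[OF \<mu> f] inner_commute inv_sqrt_symmetric)
    then have "\<bar>res \<mu> f y - res \<mu> f x - (y - x) \<bullet> inv_sqrt (sqrt_grad \<mu> f x)\<bar> \<le> holder_const * K * norm (inv_sqrt (y - x)) * norm (y - x) powr \<theta>"
      using res_taylor[OF \<mu> f, of x "y - x"] by simp
    also have "\<dots> \<le> holder_const * K * (sqrt inv_l_sum * norm (y - x)) * norm (y - x) powr \<theta>"
      using K holder_const_pos by (intro mult_right_mono mult_left_mono norm_inv_sqrt_le) auto
    finally show "norm (norm (res \<mu> f y - res \<mu> f x - (y - x) \<bullet> inv_sqrt (sqrt_grad \<mu> f x)) / norm (y - x))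
        \<le> holder_const * K * sqrt inv_l_sum * norm (y - x) powr \<theta>"
      by (cases "y = x") (simp_all add: divide_le_eq mult_ac)
  qed
qed

lemma res_deriv_convergence:
  assumes \<mu>: "\<mu> > 0" and fn: "\<And>n. holder_fun B K (fn n)" and f: "holder_fun B' K' f" and lim: "\<And>x. (\<lambda>n. fn n x) \<longlonglongrightarrow> f x"
  shows "(\<lambda>n. res_deriv \<mu> (fn n) x k) \<longlonglongrightarrow> res_deriv \<mu> f x k"
  unfolding res_deriv_def
proof (rule integral_dominated_convergence)
  show "integrable lborel (\<lambda>t. 2 * K * norm k * (laplace_kernel \<theta> \<mu> t))"
    by (intro integrable_mult_right laplace_powr_bound \<theta> \<mu>)
  show "AE t in lborel. norm (deriv_integrand \<mu> (fn n) x k t)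
      \<le> 2 * K * norm k * (laplace_kernel \<theta> \<mu> t)" for n
    using res_deriv_integrand_bound[OF fn] by (intro AE_I2) (simp only: real_norm_def)
  show "(\<lambda>t. deriv_integrand \<mu> f x k t) \<in> borel_measurable lborel"
    "(\<lambda>t. deriv_integrand \<mu> (fn n) x k t) \<in> borel_measurable lborel" for n
    using res_deriv_integrand_measurable[OF f] res_deriv_integrand_measurable[OF fn] by simp_all
  have ou_deriv: "(\<lambda>n. ou_deriv t (fn n) x w) \<longlonglongrightarrow> ou_deriv t f x w" if t: "t > 0" for t w
    unfolding ou_deriv_def
  proof (rule integral_dominated_convergence)
    interpret nondegenerate_gaussian e "N t" "cov t" using t by (rule nondegenerate)
    show "integrable (N t) (\<lambda>y. B * \<bar>w \<bullet> y\<bar>)" by (intro integrable_mult_right integrable_abs integrable_inner)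
    show "AE y in N t. norm ((w \<bullet> y) * fn n (semi t x + y + shift t)) \<le> B * \<bar>w \<bullet> y\<bar>" for n
    proof (rule AE_I2)
      show "norm ((w \<bullet> y) * fn n (semi t x + y + shift t)) \<le> B * \<bar>w \<bullet> y\<bar>" for y
        using mult_right_mono[OF holder_boundedD(2)[OF fn[of n], of "semi t x + y + shift t"], of "\<bar>w \<bullet> y\<bar>"]
        by (simp add: abs_mult mult.commute)
    qed
    show "AE y in N t. (\<lambda>n. (w \<bullet> y) * fn n (semi t x + y + shift t)) \<longlonglongrightarrow> (w \<bullet> y) * f (semi t x + y + shift t)"
      by (intro AE_I2 tendsto_intros lim)
    show "(\<lambda>y. (w \<bullet> y) * f (semi t x + y + shift t)) \<in> borel_measurable (N t)"
      "(\<lambda>y. (w \<bullet> y) * fn n (semi t x + y + shift t)) \<in> borel_measurable (N t)" for n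
      using holder_fun_shift_meas[OF f] holder_fun_shift_meas[OF fn] by measurable
  qed
  have "(\<lambda>n. deriv_integrand \<mu> (fn n) x k t)
      \<longlonglongrightarrow> deriv_integrand \<mu> f x k t" for t :: real
    by (cases "t > 0") (auto intro!: tendsto_intros ou_deriv)
  then show "AE t in lborel. (\<lambda>n. deriv_integrand \<mu> (fn n) x k t)
      \<longlonglongrightarrow> deriv_integrand \<mu> f x k t" by simp
qed

end

section \<open>The semigroup and the square root on the eigenbasis\<close>

text \<open>By Baire's theorem one of the closed sets on which all \<open>T n\<close> are bounded by \<open>m\<close> contains a ball.\<close>

lemma banach_steinhaus_seq:
  fixes T :: "nat \<Rightarrow> 'a::banach \<Rightarrow> 'b::real_normed_vector"
  assumes lin: "\<And>n. bounded_linear (T n)" and bdd: "\<And>x. bounded (range (\<lambda>n. T n x))"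
  obtains M where "M \<ge> 0" "\<And>n x. norm (T n x) \<le> M * norm x"
proof -
  define V where "V m = {x. \<forall>n. norm (T n x) \<le> real m}" for m
  have cl: "closed (V m)" for m
  proof -
    have "V m = (\<Inter>n. {x. norm (T n x) \<le> real m})" by (auto simp: V_def)
    moreover have "closed {x. norm (T n x) \<le> real m}" for n
      by (intro closed_Collect_le continuous_intros linear_continuous_on lin)
    ultimately show ?thesis by auto
  qed
  have "x \<in> (\<Union>m. V m)" for x
  proof -
    obtain b where "\<And>n. norm (T n x) \<le> b" using bdd[of x] by (auto simp: bounded_iff)
    moreover obtain m where "b \<le> real m" using real_arch_simple by blast
    ultimately show ?thesis by (auto simp: V_def intro: order_trans)
  qed
  then have un: "\<Union>(range V) = UNIV" by auto
  have "\<exists>m. interior (V m) \<noteq> {}"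
  proof (rule ccontr)
    assume "\<not> ?thesis"
    then have "(euclidean :: 'a topology) interior_of \<Union>(range V) = {}"
      using cl by (intro Baire_category_alt disjI1 completely_metrizable_space_euclidean) auto
    then show False unfolding un by simp
  qed
  then obtain m x0 r where r: "r > 0" "ball x0 r \<subseteq> V m"
    by (metis all_not_in_conv mem_interior)
  show ?thesis
  proof (rule that[of "4 * real m / r"])
    show "4 * real m / r \<ge> 0" using r by simp
    fix n x
    interpret bounded_linear "T n" by (rule lin)
    show "norm (T n x) \<le> 4 * real m / r * norm x"
    proof (cases "x = 0")
      case False
      define c where "c = r / (2 * norm x)"
      have c: "c > 0" using r False by (simp add: c_def)
      have "norm (c *\<^sub>R x) < r" using r False by (simp add: c_def)
      then have "x0 + c *\<^sub>R x \<in> V m" "x0 \<in> V m" using r by (auto simp: dist_norm subset_iff)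
      then have "norm (T n (x0 + c *\<^sub>R x)) \<le> real m" "norm (T n x0) \<le> real m" by (auto simp: V_def)
      moreover have "c * norm (T n x) = norm (T n (x0 + c *\<^sub>R x) - T n x0)"
        using c by (simp add: add scaleR)
      ultimately have "c * norm (T n x) \<le> 2 * real m"
        using norm_triangle_ineq4[of "T n (x0 + c *\<^sub>R x)" "T n x0"] by simp
      then have "norm (T n x) \<le> 2 * real m / c" using c by (simp add: field_simps)
      also have "\<dots> = 4 * real m / r * norm x" using r False by (simp add: c_def)
      finally show ?thesis .
    qed (simp add: zero)
  qed
qed

text \<open>Otherwise there are \<open>t n\<close> tending to \<open>0\<close> with \<open>S (t n)\<close> of unbounded operator norm, although \<open>S (t n) y\<close>
converges for every \<open>y\<close>.\<close>

lemma C0_semigroup_locally_bounded: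
  fixes S :: "real \<Rightarrow> 'a::{real_inner,banach} \<Rightarrow> 'a"
  assumes S: "C0_semigroup S"
  obtains \<delta> M where "\<delta> > 0" "M \<ge> 0" "\<And>t x. 0 \<le> t \<Longrightarrow> t \<le> \<delta> \<Longrightarrow> norm (S t x) \<le> M * norm x"
proof (rule ccontr)
  assume no: "\<not> thesis"
  have "\<exists>t x. 0 \<le> t \<and> t \<le> 1 / real (Suc n) \<and> norm (S t x) > real (Suc n) * norm x" for n
    using no that[of "1 / real (Suc n)" "real (Suc n)"] by (force simp: not_le)
  then obtain t x where tx: "\<And>n. 0 \<le> t n" "\<And>n. t n \<le> 1 / real (Suc n)" "\<And>n. norm (S (t n) (x n)) > real (Suc n) * norm (x n)"
    by metis
  have pos: "t n > 0" for n
  proof (rule ccontr)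
    assume "\<not> t n > 0"
    then have "t n = 0" using tx(1)[of n] by simp
    then have "norm (x n) > real (Suc n) * norm (x n)" using tx(3)[of n] S by (simp add: C0_semigroup_def)
    then show False using mult_right_mono[of 1 "real (Suc n)" "norm (x n)"] by simp
  qed
  have "t \<longlonglongrightarrow> 0"
    by (rule tendsto_sandwich[OF _ _ tendsto_const lim_1_over_n[THEN LIMSEQ_Suc]])
       (use tx in \<open>auto intro!: always_eventually\<close>)
  moreover have "t n \<noteq> 0" for n using pos[of n] by simp
  ultimately have fl: "filterlim t (at_right 0) sequentially"
    using pos by (auto simp: filterlim_at intro!: always_eventually)
  obtain M where M: "M \<ge> 0" "\<And>n x. norm (S (t n) x) \<le> M * norm x"
  proof (rule banach_steinhaus_seq[of "\<lambda>n. S (t n)"])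
    show "bounded_linear (S (t n))" for n using S tx(1) by (simp add: C0_semigroup_def)
    show "bounded (range (\<lambda>n. S (t n) y))" for y
    proof (rule convergent_imp_bounded)
      have "((\<lambda>t. S t y) \<longlongrightarrow> y) (at_right 0)" using S by (simp add: C0_semigroup_def)
      then show "(\<lambda>n. S (t n) y) \<longlonglongrightarrow> y" using fl by (rule filterlim_compose)
    qed
  qed blast
  obtain n where n: "M \<le> real n" using real_arch_simple by blast
  have "real (Suc n) * norm (x n) < M * norm (x n)" using tx(3)[of n] M(2)[of n "x n"] by linarith
  also have "\<dots> \<le> real (Suc n) * norm (x n)" using n by (intro mult_right_mono) auto
  finally show False by simp
qed

text \<open>The generator only provides a right derivative of the orbit at \<open>0\<close>, and a function with vanishing right
derivative may still jump. Therefore the orbit is compared with the exponential over \<open>n\<close> steps of length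
\<open>s / n\<close>: a telescoping sum with locally bounded \<open>S\<close> bounds the error by \<open>n\<close> times the error of one step,
which is of smaller order than \<open>1 / n\<close>.\<close>

lemma semigroup_eigenvector:
  fixes S :: "real \<Rightarrow> 'a::{real_inner,banach} \<Rightarrow> 'a"
  assumes S: "C0_semigroup S" and gen: "((\<lambda>t. (S t x - x) /\<^sub>R t) \<longlongrightarrow> - (a *\<^sub>R x)) (at_right 0)"
    and a: "a > 0" and t: "t \<ge> 0"
  shows "S t x = exp (- t * a) *\<^sub>R x"
proof -
  have S0: "S 0 y = y" and Sadd: "\<And>s t. s \<ge> 0 \<Longrightarrow> t \<ge> 0 \<Longrightarrow> S (s + t) y = S s (S t y)" for y
    using S by (auto simp: C0_semigroup_def)
  have lin: "s \<ge> 0 \<Longrightarrow> bounded_linear (S s)" for s using S by (simp add: C0_semigroup_def)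
  obtain \<delta> M where \<delta>: "\<delta> > 0" "M \<ge> 0" "\<And>t x. 0 \<le> t \<Longrightarrow> t \<le> \<delta> \<Longrightarrow> norm (S t x) \<le> M * norm x"
    using C0_semigroup_locally_bounded[OF S] by blast
  define D where "D r = norm (S r x - exp (- r * a) *\<^sub>R x)" for r
  have Dlim: "((\<lambda>r. D r / r) \<longlongrightarrow> 0) (at_right 0)"
  proof -
    have "((\<lambda>r. exp (- r * a)) has_real_derivative - a) (at 0)"
      by (auto intro!: derivative_eq_intros)
    then have "((\<lambda>r. (exp (- r * a) - 1) / r) \<longlongrightarrow> - a) (at 0)" by (simp add: DERIV_def)
    then have "((\<lambda>r. (exp (- r * a) - 1) / r) \<longlongrightarrow> - a) (at_right 0)"
      by (rule tendsto_within_subset) auto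
    then have "((\<lambda>r. (S r x - x) /\<^sub>R r - ((exp (- r * a) - 1) / r) *\<^sub>R x) \<longlongrightarrow> - (a *\<^sub>R x) - (- a) *\<^sub>R x) (at_right 0)"
      by (intro tendsto_intros gen)
    then have "((\<lambda>r. norm ((S r x - x) /\<^sub>R r - ((exp (- r * a) - 1) / r) *\<^sub>R x)) \<longlongrightarrow> 0) (at_right 0)"
      using tendsto_norm_zero by force
    moreover have "\<forall>\<^sub>F r in at_right (0::real). r > 0" by (simp add: eventually_at_right_less)
    then have "\<forall>\<^sub>F r in at_right 0. norm ((S r x - x) /\<^sub>R r - ((exp (- r * a) - 1) / r) *\<^sub>R x) = D r / r"
    proof eventually_elim
      case (elim r)
      have "(S r x - x) /\<^sub>R r - ((exp (- r * a) - 1) / r) *\<^sub>R x = inverse r *\<^sub>R (S r x - exp (- r * a) *\<^sub>R x)"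
        by (simp add: algebra_simps divide_inverse)
      then show ?case using elim by (simp add: D_def divide_inverse mult.commute)
    qed
    ultimately show ?thesis by (rule Lim_transform_eventually)
  qed
  have small: "S s x = exp (- s * a) *\<^sub>R x" if s: "0 < s" "s \<le> \<delta>" for s
  proof -
    have le: "D s \<le> M * s * (D (s / real (Suc n)) / (s / real (Suc n)))" for n
    proof -
      define r where "r = s / real (Suc n)"
      have r: "r > 0" using s by (simp add: r_def)
      have "norm (S (real j * r) x - exp (- (real j * r) * a) *\<^sub>R x) \<le> real j * M * D r" if "j \<le> Suc n" for j
        using that
      proof (induction j)
        case 0 then show ?case by (simp add: S0)
      next
        case (Suc j)
        have jr: "0 \<le> real j * r" "real j * r \<le> \<delta>"
        proof -
          have "real j * r \<le> real (Suc n) * r" using Suc.prems r by (intro mult_right_mono) auto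
          also have "\<dots> = s" by (simp add: r_def)
          finally show "real j * r \<le> \<delta>" using s by simp
        qed (use r in simp)
        interpret T: bounded_linear "S (real j * r)" using jr(1) by (rule lin)
        have "real (Suc j) * r = real j * r + r" by (simp add: algebra_simps)
        then have "S (real (Suc j) * r) x = S (real j * r) (S r x)" using jr r Sadd by simp
        moreover have "exp (- (real (Suc j) * r) * a) = exp (- r * a) * exp (- (real j * r) * a)"
          by (simp add: exp_add[symmetric] algebra_simps)
        ultimately have "S (real (Suc j) * r) x - exp (- (real (Suc j) * r) * a) *\<^sub>R x
          = S (real j * r) (S r x - exp (- r * a) *\<^sub>R x) + exp (- r * a) *\<^sub>R (S (real j * r) x - exp (- (real j * r) * a) *\<^sub>R x)"
          by (simp add: T.diff T.scaleR scaleR_diff_right)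
        also have "norm \<dots> \<le> M * D r + 1 * (real j * M * D r)"
        proof (rule order_trans[OF norm_triangle_ineq add_mono])
          show "norm (S (real j * r) (S r x - exp (- r * a) *\<^sub>R x)) \<le> M * D r"
            unfolding D_def by (rule \<delta>(3)[OF jr])
          have "exp (- r * a) \<le> 1" using r a by simp
          then show "norm (exp (- r * a) *\<^sub>R (S (real j * r) x - exp (- (real j * r) * a) *\<^sub>R x)) \<le> 1 * (real j * M * D r)"
            unfolding norm_scaleR using Suc.IH Suc.prems by (intro mult_mono) auto
        qed
        finally show ?case by (simp add: algebra_simps)
      qed
      from this[of "Suc n"] have "norm (S (real (Suc n) * r) x - exp (- (real (Suc n) * r) * a) *\<^sub>R x) \<le> real (Suc n) * M * D r"
        by blast
      moreover have "real (Suc n) * r = s" by (simp add: r_def)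
      ultimately have "D s \<le> real (Suc n) * M * D r" by (simp only: D_def)
      also have "\<dots> = M * s * (D r / r)" using s by (simp add: r_def)
      finally show ?thesis by (simp add: r_def)
    qed
    have "filterlim (\<lambda>n. s / real (Suc n)) (at_right 0) sequentially"
    proof -
      have "(\<lambda>n. s * (1 / real (Suc n))) \<longlonglongrightarrow> s * 0"
        by (intro tendsto_intros lim_1_over_n[THEN LIMSEQ_Suc])
      then show ?thesis using s by (auto simp: filterlim_at intro!: always_eventually)
    qed
    then have "(\<lambda>n. M * s * (D (s / real (Suc n)) / (s / real (Suc n)))) \<longlonglongrightarrow> M * s * 0"
      by (intro tendsto_mult tendsto_const filterlim_compose[OF Dlim])
    then have "D s \<le> M * s * 0" by (rule LIMSEQ_le_const) (use le in blast)
    then show ?thesis by (simp add: D_def)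
  qed
  show ?thesis
  proof (cases "t = 0")
    case False
    obtain n where n: "t / \<delta> \<le> real n" using real_arch_simple by blast
    \<comment> \<open>arbitrary times are multiples of a time in the range where the bound holds\<close>
    define s where "s = t / real (Suc n)"
    have s: "0 < s" "s \<le> \<delta>"
      using False t n \<delta>(1) by (auto simp: s_def field_simps intro: order_trans)
    have "S (real j * s) x = exp (- (real j * s) * a) *\<^sub>R x" for j
    proof (induction j)
      case (Suc j)
      interpret T: bounded_linear "S s" using s by (intro lin) simp
      have "real (Suc j) * s = s + real j * s" by (simp add: algebra_simps)
      then have "S (real (Suc j) * s) x = S s (S (real j * s) x)" using s Sadd by simp
      also have "\<dots> = exp (- (real j * s) * a) *\<^sub>R exp (- s * a) *\<^sub>R x"
        unfolding Suc.IH T.scaleR small[OF s] ..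
      also have "\<dots> = exp (- (real (Suc j) * s) * a) *\<^sub>R x"
        by (simp add: exp_add[symmetric] algebra_simps)
      finally show ?case .
    qed (simp add: S0)
    from this[of "Suc n"] show ?thesis by (simp add: s_def)
  qed (simp add: S0)
qed

lemma (in orthonormal_basis) semigroup_eq_diag:
  assumes S: "C0_semigroup S" and a: "\<And>k. a k > 0"
    and gen: "\<And>k. ((\<lambda>t. (S t (e k) - e k) /\<^sub>R t) \<longlongrightarrow> - (a k *\<^sub>R e k)) (at_right 0)"
    and t: "t \<ge> 0"
  shows "S t x = diag (\<lambda>k. exp (- t * a k)) x"
proof (rule coord_eqI)
  fix k
  have m: "\<bar>exp (- t * a k)\<bar> \<le> 1" for k using a[of k] t by simp
  interpret T: bounded_linear "S t" using S t by (simp add: C0_semigroup_def)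
  have "(\<lambda>j. S t ((x \<bullet> e j) *\<^sub>R e j) \<bullet> e k) sums (S t x \<bullet> e k)"
    by (intro bounded_linear.sums[OF bounded_linear_inner_left] T.sums basis_expansion)
  moreover have "S t ((x \<bullet> e j) *\<^sub>R e j) \<bullet> e k = (if j = k then exp (- t * a k) * (x \<bullet> e k) else 0)" for j
    by (simp add: T.scaleR semigroup_eigenvector[OF S gen a t] inner_basis)
  ultimately have "S t x \<bullet> e k = exp (- t * a k) * (x \<bullet> e k)"
    using sums_unique2[OF _ sums_single[of k "\<lambda>_. exp (- t * a k) * (x \<bullet> e k)"]] by simp
  moreover have "diag (\<lambda>k. exp (- t * a k)) x \<bullet> e k = exp (- t * a k) * (x \<bullet> e k)"
    by (rule diag_coord) (rule m)
  ultimately show "S t x \<bullet> e k = diag (\<lambda>k. exp (- t * a k)) x \<bullet> e k" by (simp only:)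
qed

lemma (in orthonormal_basis) cov_op_eq_diag:
  assumes S: "C0_semigroup S" and a: "\<And>k. a k > 0" and sum: "summable (\<lambda>k. inverse (a k))"
    and gen: "\<And>k. ((\<lambda>t. (S t (e k) - e k) /\<^sub>R t) \<longlongrightarrow> - (a k *\<^sub>R e k)) (at_right 0)"
    and t: "t \<ge> 0"
  shows "cov_op S t x = diag (\<lambda>k. (1 - exp (- 2 * t * a k)) / (2 * a k)) x"
proof (rule coord_eqI)
  fix k
  have coord: "S s y \<bullet> e k = exp (- s * a k) * (y \<bullet> e k)" if "s \<ge> 0" for s y k
  proof -
    have "\<bar>exp (- s * a k)\<bar> \<le> 1" for k using a[of k] that by simp
    then show ?thesis unfolding semigroup_eq_diag[OF S a gen that] by (rule diag_coord)
  qed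
  have contr: "norm (S s y) \<le> norm y" if "s \<ge> 0" for s y
    using norm_le_coord[of "S s y" 1 y] that a by (simp add: coord abs_mult mult_left_le_one_le less_imp_le)
  have diff: "norm (S (s + r) x - S s x) \<le> norm (S r x - x)" if "s \<ge> 0" "r \<ge> 0" for s r
  proof -
    interpret T: bounded_linear "S s" using S that by (simp add: C0_semigroup_def)
    have "S (s + r) x - S s x = S s (S r x - x)" using S that by (simp add: C0_semigroup_def T.diff)
    then show ?thesis using contr[OF that(1)] by simp
  qed
  have cont: "continuous_on {0..t} (\<lambda>s. S (2 * s) x)"
    unfolding continuous_on_iff
  proof (intro ballI allI impI)
    fix s \<epsilon> :: real assume s: "s \<in> {0..t}" and \<epsilon>: "\<epsilon> > 0"
    have "((\<lambda>t. S t x) \<longlongrightarrow> x) (at_right 0)" using S by (simp add: C0_semigroup_def)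
    then have "\<forall>\<^sub>F r in at_right 0. dist (S r x) x < \<epsilon>" using \<epsilon> by (rule tendstoD)
    then obtain b where b: "b > 0" "\<And>r. 0 < r \<Longrightarrow> r < b \<Longrightarrow> dist (S r x) x < \<epsilon>"
      unfolding eventually_at_right_field by auto
    have b0: "norm (S r x - x) < \<epsilon>" if "0 \<le> r" "r < b" for r
      using b(2)[of r] that \<epsilon> S by (cases "r = 0") (auto simp: dist_norm C0_semigroup_def)
    show "\<exists>d>0. \<forall>s'\<in>{0..t}. dist s' s < d \<longrightarrow> dist (S (2 * s') x) (S (2 * s) x) < \<epsilon>"
    proof (intro exI conjI ballI impI)
      show "b / 2 > 0" using b by simp
      fix s' assume s': "s' \<in> {0..t}" "dist s' s < b / 2"
      show "dist (S (2 * s') x) (S (2 * s) x) < \<epsilon>"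
      proof (cases "s \<le> s'")
        case True
        then show ?thesis
          using diff[of "2 * s" "2 * s' - 2 * s"] b0[of "2 * s' - 2 * s"] s s' by (simp add: dist_norm)
      next
        case False
        then show ?thesis
          using diff[of "2 * s'" "2 * s - 2 * s'"] b0[of "2 * s - 2 * s'"] s s' by (simp add: dist_norm norm_minus_commute)
      qed
    qed
  qed
  have "cov_op S t x \<bullet> e k = integral {0..t} (\<lambda>s. S (2 * s) x \<bullet> e k)"
    unfolding cov_op_def
    using integral_linear[OF integrable_continuous_interval[OF cont] bounded_linear_inner_left[of "e k"]]
    by (simp add: o_def)
  also have "\<dots> = integral {0..t} (\<lambda>s. exp (- 2 * s * a k) * (x \<bullet> e k))"
    by (intro integral_cong) (simp add: coord)
  also have "\<dots> = (1 - exp (- 2 * t * a k)) / (2 * a k) * (x \<bullet> e k)"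
  proof (rule integral_unique)
    have "((\<lambda>s. exp (- 2 * s * a k) * (x \<bullet> e k)) has_integral
      (- exp (- 2 * t * a k) / (2 * a k) * (x \<bullet> e k) - - exp (- 2 * 0 * a k) / (2 * a k) * (x \<bullet> e k))) {0..t}"
      using a[of k] t by (intro fundamental_theorem_of_calculus)
        (auto intro!: derivative_eq_intros simp flip: has_real_derivative_iff_has_vector_derivative)
    then show "((\<lambda>s. exp (- 2 * s * a k) * (x \<bullet> e k)) has_integral (1 - exp (- 2 * t * a k)) / (2 * a k) * (x \<bullet> e k)) {0..t}"
      by (simp add: algebra_simps diff_divide_distrib)
  qed
  also have "\<dots> = diag (\<lambda>k. (1 - exp (- 2 * t * a k)) / (2 * a k)) x \<bullet> e k"
  proof (rule diag_coord[symmetric])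
    fix j
    have "inverse (a j) \<le> (\<Sum>k. inverse (a k))"
      using sum_le_suminf[OF sum, of "{j}"] a by (simp add: less_imp_le)
    moreover have "0 \<le> (1 - exp (- 2 * t * a j)) / (2 * a j)" "(1 - exp (- 2 * t * a j)) / (2 * a j) \<le> 1 / (2 * a j)"
      using a[of j] t by (auto intro!: divide_right_mono)
    moreover have "1 / (2 * a j) \<le> inverse (a j)" using a[of j] by (simp add: field_simps)
    ultimately show "\<bar>(1 - exp (- 2 * t * a j)) / (2 * a j)\<bar> \<le> (\<Sum>k. inverse (a k))" by linarith
  qed
  finally show "cov_op S t x \<bullet> e k = diag (\<lambda>k. (1 - exp (- 2 * t * a k)) / (2 * a k)) x \<bullet> e k" .
qed

text \<open>The vector \<open>y = R x - sqrt a *\<^sub>R x\<close> satisfies \<open>R y = - sqrt a *\<^sub>R y\<close>, so positivity of \<open>R\<close> forces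
\<open>y = 0\<close>.\<close>

lemma sqrt_op_eigenvector:
  assumes R: "is_sqrt_op D (\<lambda>x. - A x) D' R" and x: "x \<in> D" "A x = - (a *\<^sub>R x)" and a: "a > 0"
  shows "x \<in> D'" "R x = sqrt a *\<^sub>R x"
proof -
  have lin: "linear_op D' R" and pos: "\<And>x. x \<in> D' \<Longrightarrow> 0 \<le> R x \<bullet> x" and D: "D = {x \<in> D'. R x \<in> D'}"
    and RR: "R (R x) = a *\<^sub>R x"
    using R x by (auto simp: is_sqrt_op_def self_adjoint_op_def)
  have sub: "subspace D'" using lin by (simp add: linear_op_def)
  show xD: "x \<in> D'" using x D by simp
  have RxD: "R x \<in> D'" using x D by simp
  have add: "R (y + w) = R y + R w" if "y \<in> D'" "w \<in> D'" for y w using lin that by (simp add: linear_op_def)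
  have scale: "R (c *\<^sub>R y) = c *\<^sub>R R y" if "y \<in> D'" for c y using lin that by (simp add: linear_op_def)
  define y where "y = R x + (- sqrt a) *\<^sub>R x"
  have yD: "y \<in> D'" unfolding y_def by (intro subspace_add[OF sub] subspace_scale[OF sub] xD RxD)
  have "R y = R (R x) + (- sqrt a) *\<^sub>R R x"
    unfolding y_def by (simp only: add[OF RxD subspace_scale[OF sub xD]] scale[OF xD])
  also have "R (R x) = (sqrt a * sqrt a) *\<^sub>R x" using RR a by simp
  finally have "R y = (- sqrt a) *\<^sub>R y" by (simp add: y_def algebra_simps)
  then have "R y \<bullet> y = - (sqrt a * (y \<bullet> y))" by simp
  then have "sqrt a * (y \<bullet> y) \<le> 0" using pos[OF yD] by simp
  then have "y \<bullet> y \<le> 0" using a by (simp add: mult_le_0_iff)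
  then have "y = 0" using inner_gt_zero_iff[of y] by (meson not_le)
  then show "R x = sqrt a *\<^sub>R x" by (simp add: y_def)
qed

section \<open>Schauder estimates\<close>

lemma grad_eqI:
  assumes "GDERIV f x :> g"
  shows "grad f x = g"
  unfolding grad_def
proof (rule the_equality)
  show "GDERIV f x :> g" by fact
next
  fix g' assume "GDERIV f x :> g'"
  then have "(\<lambda>h. h \<bullet> g') = (\<lambda>h. h \<bullet> g)"
    using assms has_derivative_unique unfolding gderiv_def by blast
  then have "(g' - g) \<bullet> g' = (g' - g) \<bullet> g" by (rule fun_cong)
  then have "(g' - g) \<bullet> (g' - g) = 0" by (simp add: inner_diff_right)
  then show "g' = g" by simp
qed

lemma holder_bounded_mono:
  assumes "holder_bounded \<theta> B K f" "B \<le> B'" "K \<le> K'"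
  shows "holder_bounded \<theta> B' K' f"
  unfolding holder_bounded_def
proof (intro conjI allI)
  note fD = holder_boundedD[OF assms(1)]
  show "0 \<le> K'" using fD(1) assms(3) by simp
  show "\<bar>f x\<bar> \<le> B'" for x using fD(2)[of x] assms(2) by simp
  show "\<bar>f x - f y\<bar> \<le> K' * norm (x - y) powr \<theta>" for x y
    by (rule order_trans[OF fD(3) mult_right_mono[OF assms(3)]]) simp
qed

text \<open>Two distinct points are needed: the supremum of an empty set of quotients carries no information.\<close>

lemma Cb_holder_bounds:
  fixes f :: "'a::real_normed_vector \<Rightarrow> real"
  assumes f: "f \<in> Cb_holder \<theta> " and ne: "(a::'a) \<noteq> b"
  shows "holder_bounded \<theta> (sup_norm f) (holder_seminorm \<theta> f) f" "0 \<le> sup_norm f" "0 \<le> holder_seminorm \<theta> f"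
proof -
  have bdd: "bdd_above (range (\<lambda>x. norm (f x)))" and bq: "bdd_above (holder_quotients \<theta> f)"
    using f by (auto simp: Cb_holder_def bounded_iff bdd_above_def)
  have s: "\<bar>f x\<bar> \<le> sup_norm f" for x
    unfolding sup_norm_def using cSUP_upper[OF UNIV_I bdd, of x] by simp
  then show "0 \<le> sup_norm f" using abs_ge_zero order_trans by blast
  have q: "\<bar>f x - f y\<bar> * norm (x - y) powr (- \<theta>) \<le> holder_seminorm \<theta> f" if "x \<noteq> y" for x y
    unfolding holder_seminorm_def using that by (intro cSup_upper bq) (auto simp: holder_quotients_def)
  show k: "0 \<le> holder_seminorm \<theta> f" using order_trans[OF _ q[OF ne]] by simp
  have "\<bar>f x - f y\<bar> \<le> holder_seminorm \<theta> f * norm (x - y) powr \<theta>" for x y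
  proof (cases "x = y")
    case False
    have "\<bar>f x - f y\<bar> = \<bar>f x - f y\<bar> * norm (x - y) powr (- \<theta>) * norm (x - y) powr \<theta>"
      using False by (simp add: powr_minus)
    also have "\<dots> \<le> holder_seminorm \<theta> f * norm (x - y) powr \<theta>"
      by (intro mult_right_mono q False) simp
    finally show ?thesis .
  qed simp
  then show "holder_bounded \<theta> (sup_norm f) (holder_seminorm \<theta> f) f"
    using s k by (simp add: holder_bounded_def)
qed

lemma Cb_holderI:
  fixes g :: "'a::real_normed_vector \<Rightarrow> 'b::real_normed_vector"
  assumes ne: "(a::'a) \<noteq> b" and B: "\<And>x. norm (g x) \<le> B" and K: "\<And>x y. norm (g x - g y) \<le> K * norm (x - y) powr \<theta>"
  shows "g \<in> Cb_holder \<theta>" "sup_norm g \<le> B" "holder_seminorm \<theta> g \<le> K"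
proof -
  have q: "r \<le> K" if "r \<in> holder_quotients \<theta> g" for r
  proof -
    obtain x y where xy: "x \<noteq> y" "r = norm (g x - g y) * norm (x - y) powr (- \<theta>)"
      using \<open>r \<in> _\<close> by (auto simp: holder_quotients_def)
    have "r \<le> K * norm (x - y) powr \<theta> * norm (x - y) powr (- \<theta>)"
      unfolding xy(2) by (intro mult_right_mono K) simp
    also have "\<dots> = K" using xy(1) by (simp add: powr_minus)
    finally show ?thesis .
  qed
  show "g \<in> Cb_holder \<theta>" using B q by (auto simp: Cb_holder_def bounded_iff bdd_above_def)
  show "sup_norm g \<le> B" unfolding sup_norm_def using B by (intro cSUP_least) auto
  have "holder_quotients \<theta> g \<noteq> {}" using ne by (auto simp: holder_quotients_def)
  then show "holder_seminorm \<theta> g \<le> K" unfolding holder_seminorm_def using q by (rule cSup_least)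
qed

theorem theorem7:
  fixes D D' :: "'a::{real_inner,banach,second_countable_topology} set"
    and A R :: "'a \<Rightarrow> 'a"
    and e :: "nat \<Rightarrow> 'a" and l :: "nat \<Rightarrow> real"
    and S :: "real \<Rightarrow> 'a \<Rightarrow> 'a"
    and N :: "real \<Rightarrow> 'a measure"
    and \<theta> :: real
  assumes "self_adjoint_op D A" and "negative_definite_op D A" and "trace_class_inverse D A"
    and "eigenbasis D A e l"
    and "generated_semigroup D A S"
    and "is_sqrt_op D (\<lambda>x. - A x) D' R"
    and "\<And>t. t \<ge> 0 \<Longrightarrow> centered_gaussian (N t) (cov_op S t)"
    and "0 < \<theta>" and "\<theta> < 1"
  shows
    "let u = resolvent_OU S D' R N in
     (\<forall>\<mu>>0. \<forall>z. \<forall>f\<in>Cb_holder \<theta>. u \<mu> z f \<in> C1_b) \<and>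
     (\<forall>\<mu>>0. \<forall>z. \<forall>f\<in>Cb_holder \<theta>.
        (\<forall>x. grad (u \<mu> z f) x \<in> D') \<and>
        (\<lambda>x. R (grad (u \<mu> z f) x)) \<in> Cb_holder \<theta>) \<and>
     (\<exists>C :: real \<Rightarrow> real. \<exists>M > 0.
        (\<forall>\<mu>>0. C \<mu> > 0) \<and>
        (\<forall>\<mu> \<nu>. 0 < \<mu> \<longrightarrow> \<mu> < \<nu> \<longrightarrow> C \<nu> < C \<mu>) \<and> (C \<longlongrightarrow> 0) at_top \<and>
        (\<forall>\<mu>>0. \<forall>z. \<forall>f\<in>Cb_holder \<theta>.
           (\<forall>x. summable (\<lambda>k. l k * (grad (u \<mu> z f) x \<bullet> e k)\<^sup>2)) \<and>
           (SUP x. sqrt (\<Sum>k. l k * (grad (u \<mu> z f) x \<bullet> e k)\<^sup>2)) =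
             sup_norm (\<lambda>x. R (grad (u \<mu> z f) x)) \<and>
           sup_norm (\<lambda>x. R (grad (u \<mu> z f) x)) \<le> C \<mu> * holder_norm \<theta> f \<and>
           holder_seminorm \<theta> (\<lambda>x. R (grad (u \<mu> z f) x)) \<le> M * holder_norm \<theta> f)) \<and>
     (\<forall>\<mu>>0. \<forall>f\<in>Cb_holder \<theta>. \<forall>fn. (\<forall>n. fn n \<in> Cb_holder \<theta>) \<longrightarrow>
        (\<exists>K. \<forall>n. holder_norm \<theta> (fn n) \<le> K) \<longrightarrow>
        (\<forall>x. (\<lambda>n. fn n x) \<longlonglongrightarrow> f x) \<longrightarrow>
        (\<forall>h x z. (\<lambda>n. R (grad (u \<mu> z (fn n)) x) \<bullet> h) \<longlonglongrightarrow> R (grad (u \<mu> z f) x) \<bullet> h))"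
proof -
  interpret orthonormal_basis e
    using assms(4) by unfold_locales (auto simp: eigenbasis_def)
  have l_pos: "l k > 0" and eD: "e k \<in> D" "A (e k) = - (l k *\<^sub>R e k)" and l_sum: "summable (\<lambda>k. inverse (l k))" for k
    using assms(4) by (auto simp: eigenbasis_def)
  have C0: "C0_semigroup S" using assms(5) by (simp add: generated_semigroup_def)
  have gen: "((\<lambda>t. (S t (e k) - e k) /\<^sub>R t) \<longlongrightarrow> - (l k *\<^sub>R e k)) (at_right 0)" for k
    using assms(5) eD[of k] by (auto simp: generated_semigroup_def)
  have cov: "cov_op S t = diag (\<lambda>k. (1 - exp (- 2 * t * l k)) / (2 * l k))" if "t \<ge> 0" for t
    using cov_op_eq_diag[OF C0 l_pos l_sum gen that] by auto
  have OU: "ornstein_uhlenbeck e l N \<theta>"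
    using l_pos l_sum assms(7-9) cov
    by (intro ornstein_uhlenbeck.intro ornstein_uhlenbeck_axioms.intro orthonormal_basis_axioms) auto
  interpret O: ornstein_uhlenbeck e l N z \<theta> for z by (rule OU)
  have S_eq: "S t x = O.semi t x" if "t \<ge> 0" for t x
    unfolding O.semi_def by (rule semigroup_eq_diag[OF C0 l_pos gen that])
  \<comment> \<open>\<open>R\<close> is determined by its action on the basis; self-adjointness decides membership in \<open>D'\<close>\<close>
  note Re = sqrt_op_eigenvector[OF assms(6) eD l_pos]
  have sa: "(y \<in> D' \<and> R y = w) \<longleftrightarrow> (\<forall>x\<in>D'. R x \<bullet> y = x \<bullet> w)" for y w
    using assms(6) by (simp add: is_sqrt_op_def self_adjoint_op_def)
  have R_coord: "R x \<bullet> e k = sqrt (l k) * (x \<bullet> e k)" if "x \<in> D'" for x k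
    using sa[of "e k" "R (e k)"] Re that by simp
  have R_inv_sqrt: "O.inv_sqrt w \<in> D'" "R (O.inv_sqrt w) = w" for w
  proof -
    have "R x \<bullet> O.inv_sqrt w = x \<bullet> w" if "x \<in> D'" for x
    proof (rule sums_unique2[OF parseval_inner])
      show "(\<lambda>k. (R x \<bullet> e k) * (O.inv_sqrt w \<bullet> e k)) sums (x \<bullet> w)"
        using parseval_inner[of x w] l_pos[THEN less_imp_neq, THEN not_sym]
        by (simp add: R_coord[OF that] O.inv_sqrt_coord)
    qed
    then show "O.inv_sqrt w \<in> D'" "R (O.inv_sqrt w) = w" using sa by blast+
  qed
  have inj: "inj_on R D'"
  proof (rule inj_onI)
    fix x y assume xy: "x \<in> D'" "y \<in> D'" "R x = R y"
    then have "sqrt (l k) * (x \<bullet> e k) = sqrt (l k) * (y \<bullet> e k)" for k using R_coord by metis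
    then show "x = y" using l_pos[THEN less_imp_neq, THEN not_sym] by (intro coord_eqI) auto
  qed
  have shift: "shift_op S D' R t z = O.shift z t" if "t \<ge> 0" for t z
    unfolding shift_op_def O.shift_def S_eq[OF that] by (rule inv_into_f_eq[OF inj R_inv_sqrt])
  have resolvent_eq: "resolvent_OU S D' R N \<mu> z f = O.res z \<mu> f" for \<mu> z f
    unfolding resolvent_OU_def O.res_def set_lebesgue_integral_def
    by (intro ext Bochner_Integration.integral_cong refl)
       (auto simp: indicator_def gen_OU_def O.ou_def S_eq shift)
  have ne: "e 0 \<noteq> 0" using inner_basis[of 0 0] by auto
  have hb: "holder_bounded \<theta> (sup_norm f) (holder_norm \<theta> f) f" if "f \<in> Cb_holder \<theta>" for f :: "'a \<Rightarrow> real"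
  proof -
    note b = Cb_holder_bounds[OF that ne]
    have "holder_seminorm \<theta> f \<le> holder_norm \<theta> f" using b by (simp add: holder_norm_def)
    then show ?thesis by (rule holder_bounded_mono[OF b(1) order_refl])
  qed
  have grad: "grad (O.res z \<mu> f) x = O.inv_sqrt (O.sqrt_grad z \<mu> f x)" if "\<mu> > 0" "f \<in> Cb_holder \<theta>" for z \<mu> f x
    by (rule grad_eqI) (rule O.res_gderiv[OF that(1) hb[OF that(2)]])
  have Rgrad: "R (grad (O.res z \<mu> f) x) = O.sqrt_grad z \<mu> f x" if "\<mu> > 0" "f \<in> Cb_holder \<theta>" for z \<mu> f x
    unfolding grad[OF that] by (rule R_inv_sqrt)
  have main: "O.sqrt_grad z \<mu> f \<in> Cb_holder \<theta>" "sup_norm (O.sqrt_grad z \<mu> f) \<le> O.sup_const \<mu> * holder_norm \<theta> f"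
      "holder_seminorm \<theta> (O.sqrt_grad z \<mu> f) \<le> O.holder_const * holder_norm \<theta> f"
    if "\<mu> > 0" "f \<in> Cb_holder \<theta>" for z \<mu> f
    using Cb_holderI[OF ne O.sqrt_grad_bound[OF that(1) hb[OF that(2)]] O.sqrt_grad_holder[OF that(1) hb[OF that(2)]]] .
  have C1: "O.res z \<mu> f \<in> C1_b" if "\<mu> > 0" "f \<in> Cb_holder \<theta>" for z \<mu> f
  proof -
    note h = hb[OF that(2)]
    have "continuous_on UNIV (O.sqrt_grad z \<mu> f)"
      unfolding continuous_on_eq_continuous_at[OF open_UNIV] continuous_at
    proof (intro ballI)
      show "(O.sqrt_grad z \<mu> f \<longlongrightarrow> O.sqrt_grad z \<mu> f x) (at x)" for x
        by (rule holder_tendsto[OF assms(8)]) (rule O.sqrt_grad_holder[OF that(1) h])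
    qed
    then have "continuous_on UNIV (grad (O.res z \<mu> f))"
      unfolding grad[OF that, abs_def] by (rule bounded_linear.continuous_on[OF O.bounded_linear_inv_sqrt])
    moreover have "norm (grad (O.res z \<mu> f) x) \<le> sqrt (O.inv_l_sum) * (O.sup_const \<mu> * holder_norm \<theta> f)" for x
      unfolding grad[OF that] by (rule order_trans[OF O.norm_inv_sqrt_le mult_left_mono[OF O.sqrt_grad_bound[OF that(1) h]]])
        (simp add: O.inv_l_sum_nonneg)
    then have "bounded (range (grad (O.res z \<mu> f)))" by (intro boundedI) blast
    moreover have "norm (O.res z \<mu> f x) \<le> sup_norm f / \<mu>" for x
      unfolding real_norm_def by (rule O.res_bound[OF that(1) h])
    then have "bounded (range (O.res z \<mu> f))" by (intro boundedI) blast
    moreover have "GDERIV (O.res z \<mu> f) x :> grad (O.res z \<mu> f) x" for x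
      unfolding grad[OF that] by (rule O.res_gderiv[OF that(1) h])
    ultimately show ?thesis by (simp add: C1_b_def)
  qed
  have pars: "(\<lambda>k. l k * (grad (O.res z \<mu> f) x \<bullet> e k)\<^sup>2) sums (norm (O.sqrt_grad z \<mu> f x))\<^sup>2"
    if "\<mu> > 0" "f \<in> Cb_holder \<theta>" for z \<mu> f x
  proof -
    have "l k * (O.inv_sqrt w \<bullet> e k)\<^sup>2 = (w \<bullet> e k)\<^sup>2" for w k
      using l_pos[of k] by (simp add: O.inv_sqrt_coord power_divide)
    then show ?thesis unfolding grad[OF that] using parseval by simp
  qed
  have conv: "(\<lambda>n. R (grad (O.res z \<mu> (fn n)) x) \<bullet> h) \<longlonglongrightarrow> R (grad (O.res z \<mu> f) x) \<bullet> h"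
    if \<mu>: "\<mu> > 0" and f: "f \<in> Cb_holder \<theta>" and fn: "\<And>n. fn n \<in> Cb_holder \<theta>"
      and K: "\<And>n. holder_norm \<theta> (fn n) \<le> K" and lim: "\<And>x. (\<lambda>n. fn n x) \<longlonglongrightarrow> f x" for \<mu> f fn K h x z
  proof -
    have "holder_bounded \<theta> K K (fn n)" for n
    proof -
      note b = Cb_holder_bounds[OF fn ne, of n]
      have "sup_norm (fn n) \<le> K" using b K[of n] by (simp add: holder_norm_def)
      then show ?thesis using K by (rule holder_bounded_mono[OF hb[OF fn]])
    qed
    from O.res_deriv_convergence[OF \<mu> this hb[OF f] lim, of z x h] show ?thesis
      by (simp add: Rgrad[OF \<mu> f] Rgrad[OF \<mu> fn] O.sqrt_grad_inner[OF \<mu> hb[OF f]] O.sqrt_grad_inner[OF \<mu> hb[OF fn]])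
  qed
  have c: "2 * (2 / \<theta> + 1) > 0" using assms(8) by (simp add: add_pos_pos)
  show ?thesis
    unfolding Let_def resolvent_eq
  proof (intro conjI exI[of _ O.sup_const] exI[of _ O.holder_const] allI ballI impI)
    show "O.holder_const > 0" by (rule O.holder_const_pos)
    show "O.sup_const \<mu> > 0" if "\<mu> > 0" for \<mu>
      unfolding O.sup_const_def using c that by (intro mult_pos_pos) auto
    show "O.sup_const \<nu> < O.sup_const \<mu>" if "0 < \<mu>" "\<mu> < \<nu>" for \<mu> \<nu>
      unfolding O.sup_const_def using c that assms(8) by (intro mult_strict_left_mono powr_less_mono2_neg) auto
    have "((\<lambda>\<mu>. \<mu> powr (- \<theta> / 2)) \<longlongrightarrow> 0) at_top"
      by (rule tendsto_neg_powr) (use assms(8) filterlim_ident in auto)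
    then show "(O.sup_const \<longlongrightarrow> 0) at_top" unfolding O.sup_const_def by (rule tendsto_mult_right_zero)
  next
    fix \<mu> :: real and z and f :: "'a \<Rightarrow> real" assume a: "0 < \<mu>" "f \<in> Cb_holder \<theta>"
    show "O.res z \<mu> f \<in> C1_b" by (rule C1[OF a])
    show "grad (O.res z \<mu> f) x \<in> D'" for x unfolding grad[OF a] by (rule R_inv_sqrt)
    have eq: "(\<lambda>x. R (grad (O.res z \<mu> f) x)) = O.sqrt_grad z \<mu> f" using Rgrad[OF a] by auto
    show "(\<lambda>x. R (grad (O.res z \<mu> f) x)) \<in> Cb_holder \<theta>"
      "sup_norm (\<lambda>x. R (grad (O.res z \<mu> f) x)) \<le> O.sup_const \<mu> * holder_norm \<theta> f"
      "holder_seminorm \<theta> (\<lambda>x. R (grad (O.res z \<mu> f) x)) \<le> O.holder_const * holder_norm \<theta> f"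
      unfolding eq by (rule main[OF a])+
    show "summable (\<lambda>k. l k * (grad (O.res z \<mu> f) x \<bullet> e k)\<^sup>2)" for x
      using pars[OF a] by (rule sums_summable)
    show "(SUP x. sqrt (\<Sum>k. l k * (grad (O.res z \<mu> f) x \<bullet> e k)\<^sup>2)) = sup_norm (\<lambda>x. R (grad (O.res z \<mu> f) x))"
      unfolding eq sup_norm_def sums_unique[OF pars[OF a, of z], symmetric] by simp
    fix fn :: "nat \<Rightarrow> 'a \<Rightarrow> real" and h x
    assume fn: "\<forall>n. fn n \<in> Cb_holder \<theta>" "\<exists>K. \<forall>n. holder_norm \<theta> (fn n) \<le> K" "\<forall>x. (\<lambda>n. fn n x) \<longlonglongrightarrow> f x"
    then obtain K where "\<And>n. holder_norm \<theta> (fn n) \<le> K" by blast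
    then show "(\<lambda>n. R (grad (O.res z \<mu> (fn n)) x) \<bullet> h) \<longlonglongrightarrow> R (grad (O.res z \<mu> f) x) \<bullet> h"
      using fn(1,3) by (intro conv[OF a]) simp_all
  qed
qed

end
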